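(* Let $\mathfrak g'$ be a simply-laced simple Lie algebra with diagram automorphism $\sigma$, $\mathfrak g=(\mathfrak g')^\sigma$, and ${}^L\mathfrak g$ the Langlands dual of $\mathfrak g$. Let $\mu_1,\dots,\mu_N$ be dominant integral weights of ${}^L\mathfrak g$ and $\mu_1',\dots,\mu_N'$ the corresponding ($\sigma$-invariant) weights of $\mathfrak g'$. For generic regular $\chi\in\mathfrak h$ such that $\chi'\in\mathfrak h'$ is regular, and generic $z_1,\dots,z_N$, there exists an embedding of the tensor product of the simple ${}^L\mathfrak g$-modules with highest weights $\mu_k$ into the tensor product of the simple $\mathfrak g'$-modules with the corresponding highest weights $\mu'_k$: $$\bigotimes_{k=1}^N V_{\mu_k}(z_k)\hookrightarrow\bigotimes_{k=1}^N V'_{\mu'_k}(z_k).$$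
   Context: $(\mathfrak g',\mathfrak g)=(A_{2\ell-1},C_\ell)$, $(D_{\ell+1},B_\ell)$, $(E_6,F_4)$ ($\sigma$ of order 2), $(D_4,G_2)$ (order 3). $\mathfrak h'\subset\mathfrak g'$ is a Cartan subalgebra whose subspace of $\sigma$-invariants $\mathfrak h=(\mathfrak h')^\sigma$ is a Cartan subalgebra of $\mathfrak g$; $\chi'$ is the image of $\chi$ under $\mathfrak h\subset\mathfrak h'$ ($\chi$ and $\chi'$ play the role of twist parameters of the Gaudin models of ${}^L\mathfrak g$ and $\mathfrak g'$ respectively). Since $({}^L\mathfrak h)^*=\mathfrak h$, integral weights $\mu_k$ of ${}^L\mathfrak g$ are integral coweights of $\mathfrak g$; these are $\sigma$-invariant coweights of $\mathfrak g'$, identified with weights $\mu'_k$ of $\mathfrak g'$ by the invariant form normalized so that all roots of $\mathfrak g'$ have square length 2 (the fundamental weight of ${}^L\mathfrak g$ labeled by a $\sigma$-orbit of vertices of the Dynkin diagram of $\mathfrak g'$ goes to the sum of the fundamental weights of $\mathfrak g'$ over the orbit). $V_{\mu}$ and $V'_{\mu'}$ are the irreducible finite-dimensional modules over ${}^L\mathfrak g$ and $\mathfrak g'$ with the indicated highest weights, $V_\mu(z)$, $V'_{\mu'}(z)$ are the corresponding evaluation modules of the current algebras ${}^L\mathfrak g[s]$, $\mathfrak g'[s]$ at $s=z$, and $z_1,\dots,z_N$ are distinct complex numbers. The embedding is an embedding of vector spaces. *)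

theory Defs
  imports
    Complex_Main
    "HOL-Computational_Algebra.Polynomial"
    "HOL-Library.Function_Algebras"
    "HOL-Library.FuncSet"
    "HOL-Combinatorics.Orbits"
begin

text \<open>A Lie algebra is a subspace (the carrier) of an ambient complex vector space, so that
  subalgebras are obtained by shrinking the carrier.\<close>

record 'g lie =
  carrier :: "'g set"
  smult :: "complex \<Rightarrow> 'g \<Rightarrow> 'g"
  bracket :: "'g \<Rightarrow> 'g \<Rightarrow> 'g"

definition linear_form_on :: "(complex \<Rightarrow> 'a::ab_group_add \<Rightarrow> 'a) \<Rightarrow> 'a set \<Rightarrow> ('a \<Rightarrow> complex) \<Rightarrow> bool" where
  "linear_form_on s U u \<longleftrightarrow>
     (\<forall>x\<in>U. \<forall>y\<in>U. u (x + y) = u x + u y) \<and> (\<forall>c. \<forall>x\<in>U. u (s c x) = c * u x)"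

definition finite_dim :: "(complex \<Rightarrow> 'a::ab_group_add \<Rightarrow> 'a) \<Rightarrow> 'a set \<Rightarrow> bool" where
  "finite_dim s U \<longleftrightarrow> (\<exists>B. finite B \<and> B \<subseteq> U \<and> module.span s B = U)"

definition lie_algebra :: "'g::ab_group_add lie \<Rightarrow> bool" where
  "lie_algebra G \<longleftrightarrow>
     vector_space (smult G) \<and> module.subspace (smult G) (carrier G) \<and>
     (\<forall>x\<in>carrier G. \<forall>y\<in>carrier G. bracket G x y \<in> carrier G) \<and>
     (\<forall>x\<in>carrier G. \<forall>y\<in>carrier G. \<forall>z\<in>carrier G.
        bracket G (x + y) z = bracket G x z + bracket G y z \<and>
        bracket G x (y + z) = bracket G x y + bracket G x z) \<and>
     (\<forall>c. \<forall>x\<in>carrier G. \<forall>y\<in>carrier G.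
        bracket G (smult G c x) y = smult G c (bracket G x y) \<and>
        bracket G x (smult G c y) = smult G c (bracket G x y)) \<and>
     (\<forall>x\<in>carrier G. bracket G x x = 0) \<and>
     (\<forall>x\<in>carrier G. \<forall>y\<in>carrier G. \<forall>z\<in>carrier G.
        bracket G x (bracket G y z) + bracket G y (bracket G z x) + bracket G z (bracket G x y) = 0)"

definition lie_subalgebra :: "'g::ab_group_add lie \<Rightarrow> 'g set \<Rightarrow> bool" where
  "lie_subalgebra G S \<longleftrightarrow>
     module.subspace (smult G) S \<and> S \<subseteq> carrier G \<and> (\<forall>x\<in>S. \<forall>y\<in>S. bracket G x y \<in> S)"

definition lie_ideal :: "'g::ab_group_add lie \<Rightarrow> 'g set \<Rightarrow> bool" where
  "lie_ideal G S \<longleftrightarrow>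
     module.subspace (smult G) S \<and> S \<subseteq> carrier G \<and> (\<forall>x\<in>carrier G. \<forall>y\<in>S. bracket G x y \<in> S)"

definition simple_lie_algebra :: "'g::ab_group_add lie \<Rightarrow> bool" where
  "simple_lie_algebra G \<longleftrightarrow>
     lie_algebra G \<and> finite_dim (smult G) (carrier G) \<and>
     (\<exists>x\<in>carrier G. \<exists>y\<in>carrier G. bracket G x y \<noteq> 0) \<and>
     (\<forall>S. lie_ideal G S \<longrightarrow> S = {0} \<or> S = carrier G)"

definition lie_automorphism :: "'g::ab_group_add lie \<Rightarrow> ('g \<Rightarrow> 'g) \<Rightarrow> bool" where
  "lie_automorphism G \<sigma> \<longleftrightarrow>
     bij_betw \<sigma> (carrier G) (carrier G) \<and>
     (\<forall>x\<in>carrier G. \<forall>y\<in>carrier G.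
        \<sigma> (x + y) = \<sigma> x + \<sigma> y \<and> \<sigma> (bracket G x y) = bracket G (\<sigma> x) (\<sigma> y)) \<and>
     (\<forall>c. \<forall>x\<in>carrier G. \<sigma> (smult G c x) = smult G c (\<sigma> x))"

definition fixed_subalgebra :: "('g \<Rightarrow> 'g) \<Rightarrow> 'g lie \<Rightarrow> 'g lie" where
  "fixed_subalgebra \<sigma> G = G\<lparr>carrier := {x \<in> carrier G. \<sigma> x = x}\<rparr>"

primrec lower_central :: "'g::ab_group_add lie \<Rightarrow> 'g set \<Rightarrow> nat \<Rightarrow> 'g set" where
  "lower_central G h 0 = h"
| "lower_central G h (Suc n) =
     module.span (smult G) {bracket G x y | x y. x \<in> h \<and> y \<in> lower_central G h n}"

definition cartan_subalgebra :: "'g::ab_group_add lie \<Rightarrow> 'g set \<Rightarrow> bool" where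
  "cartan_subalgebra G h \<longleftrightarrow>
     lie_subalgebra G h \<and> (\<exists>n. lower_central G h n = {0}) \<and>
     {x \<in> carrier G. \<forall>y\<in>h. bracket G x y \<in> h} = h"

definition regular_element :: "'g::ab_group_add lie \<Rightarrow> 'g set \<Rightarrow> 'g \<Rightarrow> bool" where
  "regular_element G h x \<longleftrightarrow> x \<in> h \<and> {y \<in> carrier G. bracket G x y = 0} = h"

text \<open>A simple Lie algebra with a Cartan subalgebra and Chevalley generators; \<open>t i\<close> is the
  simple coroot and the Cartan matrix entry \<open>a i j\<close> is the value of the simple root
  \<open>\<alpha>\<^sub>j\<close> on the coroot \<open>t i\<close>.\<close>

definition chevalley_generators ::
  "'g::ab_group_add lie \<Rightarrow> 'g set \<Rightarrow> 'i set \<Rightarrow> ('i \<Rightarrow> 'i \<Rightarrow> int) \<Rightarrow>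
     ('i \<Rightarrow> 'g) \<Rightarrow> ('i \<Rightarrow> 'g) \<Rightarrow> ('i \<Rightarrow> 'g) \<Rightarrow> bool" where
  "chevalley_generators G h I a e f t \<longleftrightarrow>
     simple_lie_algebra G \<and> cartan_subalgebra G h \<and> finite I \<and>
     (\<forall>i\<in>I. e i \<in> carrier G \<and> f i \<in> carrier G \<and> t i \<in> h) \<and>
     inj_on t I \<and> \<not> module.dependent (smult G) (t ` I) \<and> module.span (smult G) (t ` I) = h \<and>
     (\<forall>i\<in>I. a i i = 2) \<and>
     (\<forall>i\<in>I. \<forall>j\<in>I.
        bracket G (t i) (t j) = 0 \<and>
        bracket G (e i) (f j) = (if i = j then t i else 0) \<and>
        bracket G (t i) (e j) = smult G (of_int (a i j)) (e j) \<and>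
        bracket G (t i) (f j) = smult G (- of_int (a i j)) (f j)) \<and>
     (\<forall>S. lie_subalgebra G S \<and> e ` I \<union> f ` I \<subseteq> S \<longrightarrow> S = carrier G)"

text \<open>The dual Lie algebra is the one with the transposed Cartan matrix; the two sets of generators
  identify the simple roots of one algebra with the simple coroots of the other.\<close>

definition langlands_dual ::
  "'g::ab_group_add lie \<Rightarrow> 'g set \<Rightarrow> ('i \<Rightarrow> 'g) \<Rightarrow> ('i \<Rightarrow> 'g) \<Rightarrow> ('i \<Rightarrow> 'g) \<Rightarrow> 'i set \<Rightarrow>
   'l::ab_group_add lie \<Rightarrow> 'l set \<Rightarrow> ('i \<Rightarrow> 'l) \<Rightarrow> ('i \<Rightarrow> 'l) \<Rightarrow> ('i \<Rightarrow> 'l) \<Rightarrow> bool" where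
  "langlands_dual G h e f t I L hL eL fL tL \<longleftrightarrow>
     (\<exists>b. chevalley_generators G h I b e f t \<and>
          chevalley_generators L hL I (\<lambda>i j. b j i) eL fL tL)"

text \<open>Vertices are labelled \<open>1, \<dots>, n\<close> as in Bourbaki.\<close>

datatype dynkin = TypeA nat | TypeD nat | TypeE6

fun rank :: "dynkin \<Rightarrow> nat" where
  "rank (TypeA n) = n"
| "rank (TypeD n) = n"
| "rank TypeE6 = 6"

fun edges :: "dynkin \<Rightarrow> nat set set" where
  "edges (TypeA n) = {{k, k + 1} | k. 1 \<le> k \<and> k + 1 \<le> n}"
| "edges (TypeD n) = {{k, k + 1} | k. 1 \<le> k \<and> k + 2 \<le> n} \<union> {{n - 2, n}}"
| "edges TypeE6 = {{1, 3}, {3, 4}, {4, 5}, {5, 6}, {2, 4}}"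

definition cartan_matrix :: "dynkin \<Rightarrow> nat \<Rightarrow> nat \<Rightarrow> int" where
  "cartan_matrix X i j = (if i = j then 2 else if {i, j} \<in> edges X then -1 else 0)"

text \<open>The type of \<open>\<gg>'\<close> and the order of \<open>\<sigma>\<close>; the fixed subalgebras are of type
  \<open>C\<^sub>l\<close>, \<open>B\<^sub>l\<close>, \<open>F\<^sub>4\<close> and \<open>G\<^sub>2\<close> respectively.\<close>

inductive folding_type :: "dynkin \<Rightarrow> nat \<Rightarrow> bool" where
  "2 \<le> l \<Longrightarrow> folding_type (TypeA (2 * l - 1)) 2"
| "3 \<le> l \<Longrightarrow> folding_type (TypeD (l + 1)) 2"
| "folding_type TypeE6 2"
| "folding_type (TypeD 4) 3"

definition diagram_automorphism ::
  "'g::ab_group_add lie \<Rightarrow> 'i set \<Rightarrow> ('i \<Rightarrow> 'i \<Rightarrow> int) \<Rightarrow> ('i \<Rightarrow> 'g) \<Rightarrow> ('i \<Rightarrow> 'g) \<Rightarrow>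
     ('i \<Rightarrow> 'i) \<Rightarrow> ('g \<Rightarrow> 'g) \<Rightarrow> bool" where
  "diagram_automorphism G I a e f p \<sigma> \<longleftrightarrow>
     p permutes I \<and> (\<forall>i\<in>I. \<forall>j\<in>I. a (p i) (p j) = a i j) \<and>
     lie_automorphism G \<sigma> \<and> (\<forall>i\<in>I. \<sigma> (e i) = e (p i) \<and> \<sigma> (f i) = f (p i))"

definition has_order :: "'g lie \<Rightarrow> ('g \<Rightarrow> 'g) \<Rightarrow> nat \<Rightarrow> bool" where
  "has_order G \<sigma> d \<longleftrightarrow>
     d > 0 \<and> (\<forall>x\<in>carrier G. (\<sigma> ^^ d) x = x) \<and>
     (\<forall>m. 0 < m \<and> m < d \<longrightarrow> (\<exists>x\<in>carrier G. (\<sigma> ^^ m) x \<noteq> x))"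

text \<open>No two vertices of an orbit are adjacent for the types above, so the sums over the orbits of
  the Chevalley generators of \<open>\<gg>'\<close> are Chevalley generators of the fixed subalgebra.\<close>

definition orbit_sum :: "('i \<Rightarrow> 'g::comm_monoid_add) \<Rightarrow> 'i set \<Rightarrow> 'g" where
  "orbit_sum e o' = (\<Sum>i\<in>o'. e i)"

text \<open>An invariant symmetric bilinear form, nondegenerate on the Cartan subalgebra \<open>h\<close>, for which
  all roots have square length 2. A root is the form \<open>\<kappa> v\<close> on \<open>h\<close> for a unique \<open>v\<close> in \<open>h\<close>, and its
  square length is \<open>\<kappa> v v\<close>.\<close>

definition normalized_form :: "'g::ab_group_add lie \<Rightarrow> 'g set \<Rightarrow> ('g \<Rightarrow> 'g \<Rightarrow> complex) \<Rightarrow> bool" where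
  "normalized_form G h \<kappa> \<longleftrightarrow>
     (\<forall>x\<in>carrier G. linear_form_on (smult G) (carrier G) (\<kappa> x)) \<and>
     (\<forall>x\<in>carrier G. \<forall>y\<in>carrier G. \<kappa> x y = \<kappa> y x) \<and>
     (\<forall>x\<in>carrier G. \<forall>y\<in>carrier G. \<forall>z\<in>carrier G. \<kappa> (bracket G x y) z = \<kappa> x (bracket G y z)) \<and>
     (\<forall>v\<in>h. (\<forall>y\<in>h. \<kappa> v y = 0) \<longrightarrow> v = 0) \<and>
     (\<forall>v\<in>h. v \<noteq> 0 \<and> (\<exists>x\<in>carrier G. x \<noteq> 0 \<and> (\<forall>y\<in>h. bracket G y x = smult G (\<kappa> v y) x))
        \<longrightarrow> \<kappa> v v = 2)"

definition dominant_integral ::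
  "'l::ab_group_add lie \<Rightarrow> 'l set \<Rightarrow> 'i set \<Rightarrow> ('i \<Rightarrow> 'l) \<Rightarrow> ('l \<Rightarrow> complex) \<Rightarrow> bool" where
  "dominant_integral L hL I tL \<mu> \<longleftrightarrow>
     linear_form_on (smult L) hL \<mu> \<and> (\<forall>i\<in>I. \<mu> (tL i) \<in> \<nat>)"

text \<open>The coweight of \<open>G\<close> corresponding to the weight \<open>\<mu>\<close> of the Langlands dual of \<open>G\<close> is the
  element \<open>m\<close> of \<open>h\<close> on which the simple roots of \<open>G\<close> (with root vectors \<open>e i\<close>) take the values of
  \<open>\<mu>\<close> on the simple coroots \<open>tL i\<close> of the dual.\<close>

definition corresponding_coweight ::
  "'g::ab_group_add lie \<Rightarrow> 'g set \<Rightarrow> 'i set \<Rightarrow> ('i \<Rightarrow> 'g) \<Rightarrow> ('i \<Rightarrow> 'l) \<Rightarrow> ('l \<Rightarrow> complex) \<Rightarrow> 'g \<Rightarrow> bool" where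
  "corresponding_coweight G h I e tL \<mu> m \<longleftrightarrow>
     m \<in> h \<and> (\<forall>i\<in>I. bracket G m (e i) = smult G (\<mu> (tL i)) (e i))"

record ('g, 'v) rep =
  space :: "'v set"
  vscale :: "complex \<Rightarrow> 'v \<Rightarrow> 'v"
  act :: "'g \<Rightarrow> 'v \<Rightarrow> 'v"

definition lie_module :: "'g::ab_group_add lie \<Rightarrow> ('g, 'v::ab_group_add) rep \<Rightarrow> bool" where
  "lie_module G V \<longleftrightarrow>
     vector_space (vscale V) \<and> module.subspace (vscale V) (space V) \<and>
     (\<forall>x\<in>carrier G. \<forall>v\<in>space V. act V x v \<in> space V) \<and>
     (\<forall>x\<in>carrier G. \<forall>y\<in>carrier G. \<forall>v\<in>space V. act V (x + y) v = act V x v + act V y v) \<and>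
     (\<forall>x\<in>carrier G. \<forall>v\<in>space V. \<forall>w\<in>space V. act V x (v + w) = act V x v + act V x w) \<and>
     (\<forall>c. \<forall>x\<in>carrier G. \<forall>v\<in>space V.
        act V (smult G c x) v = vscale V c (act V x v) \<and>
        act V x (vscale V c v) = vscale V c (act V x v)) \<and>
     (\<forall>x\<in>carrier G. \<forall>y\<in>carrier G. \<forall>v\<in>space V.
        act V (bracket G x y) v = act V x (act V y v) - act V y (act V x v))"

definition irreducible_module :: "'g::ab_group_add lie \<Rightarrow> ('g, 'v::ab_group_add) rep \<Rightarrow> bool" where
  "irreducible_module G V \<longleftrightarrow>
     lie_module G V \<and> space V \<noteq> {0} \<and>
     (\<forall>W. module.subspace (vscale V) W \<and> W \<subseteq> space V \<and>
          (\<forall>x\<in>carrier G. \<forall>w\<in>W. act V x w \<in> W) \<longrightarrow> W = {0} \<or> W = space V)"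

definition simple_highest_weight_module ::
  "'g::ab_group_add lie \<Rightarrow> 'g set \<Rightarrow> 'i set \<Rightarrow> ('i \<Rightarrow> 'g) \<Rightarrow> ('g \<Rightarrow> complex) \<Rightarrow>
     ('g, 'v::ab_group_add) rep \<Rightarrow> bool" where
  "simple_highest_weight_module G h I e \<mu> V \<longleftrightarrow>
     irreducible_module G V \<and> finite_dim (vscale V) (space V) \<and>
     (\<exists>v\<in>space V. v \<noteq> 0 \<and> (\<forall>i\<in>I. act V (e i) v = 0) \<and> (\<forall>x\<in>h. act V x v = vscale V (\<mu> x) v))"

text \<open>Elements of the current algebra \<open>G[s]\<close> are polynomials with coefficients in \<open>G\<close>.\<close>

definition current_eval :: "'g::ab_group_add lie \<Rightarrow> complex \<Rightarrow> 'g poly \<Rightarrow> 'g" where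
  "current_eval G z p = (\<Sum>i\<le>degree p. smult G (z ^ i) (coeff p i))"

definition evaluation_module ::
  "'g::ab_group_add lie \<Rightarrow> ('g, 'v) rep \<Rightarrow> complex \<Rightarrow> ('g poly, 'v) rep" where
  "evaluation_module G V z =
     \<lparr>space = space V, vscale = vscale V, act = (\<lambda>p. act V (current_eval G z p))\<rparr>"

definition multilinear_form :: "'k set \<Rightarrow> ('k \<Rightarrow> ('x, 'v::ab_group_add) rep) \<Rightarrow> (('k \<Rightarrow> 'v) \<Rightarrow> complex) \<Rightarrow> bool" where
  "multilinear_form K V \<phi> \<longleftrightarrow>
     (\<forall>v \<in> (\<Pi>\<^sub>E k\<in>K. space (V k)). \<forall>k\<in>K.
        linear_form_on (vscale (V k)) (space (V k)) (\<lambda>a. \<phi> (v(k := a))))"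

text \<open>Multilinear forms separate the points of a tensor product of vector spaces, so a pure tensor
  may be represented by its values on multilinear forms, and the tensor product by the span of the
  pure tensors.\<close>

definition pure_tensor ::
  "'k set \<Rightarrow> ('k \<Rightarrow> ('x, 'v::ab_group_add) rep) \<Rightarrow> ('k \<Rightarrow> 'v) \<Rightarrow> (('k \<Rightarrow> 'v) \<Rightarrow> complex) \<Rightarrow> complex" where
  "pure_tensor K V v = (\<lambda>\<phi>. if multilinear_form K V \<phi> then \<phi> v else 0)"

definition tensor_scale :: "complex \<Rightarrow> ('f \<Rightarrow> complex) \<Rightarrow> 'f \<Rightarrow> complex" where
  "tensor_scale c T = (\<lambda>\<phi>. c * T \<phi>)"

text \<open>The action is transposed from the one on multilinear forms; it sends the pure tensor of \<open>v\<close>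
  to the sum over \<open>k\<close> of the pure tensors of \<open>v(k := x v\<^sub>k)\<close>.\<close>

definition tensor_module ::
  "'k set \<Rightarrow> ('k \<Rightarrow> ('x, 'v::ab_group_add) rep) \<Rightarrow> ('x, (('k \<Rightarrow> 'v) \<Rightarrow> complex) \<Rightarrow> complex) rep" where
  "tensor_module K V =
     \<lparr>space = module.span tensor_scale (pure_tensor K V ` (\<Pi>\<^sub>E k\<in>K. space (V k))),
      vscale = tensor_scale,
      act = (\<lambda>x T \<phi>. if multilinear_form K V \<phi>
                      then T (\<lambda>v. \<Sum>k\<in>K. \<phi> (v(k := act (V k) x (v k)))) else 0)\<rparr>"

text \<open>Only the vector spaces underlying the two modules are compared, which may be modules over
  different algebras.\<close>

definition vector_space_embeds ::
  "('x, 'v::ab_group_add) rep \<Rightarrow> ('y, 'w::ab_group_add) rep \<Rightarrow> bool" where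
  "vector_space_embeds V W \<longleftrightarrow>
     (\<exists>F. Vector_Spaces.linear (vscale V) (vscale W) F \<and> inj_on F (space V) \<and> F ` space V \<subseteq> space W)"

inductive_set polynomial_functions :: "('p \<Rightarrow> complex) set \<Rightarrow> ('p \<Rightarrow> complex) set"
  for X :: "('p \<Rightarrow> complex) set" where
  const: "(\<lambda>_. c) \<in> polynomial_functions X"
| coord: "u \<in> X \<Longrightarrow> u \<in> polynomial_functions X"
| add: "u \<in> polynomial_functions X \<Longrightarrow> v \<in> polynomial_functions X \<Longrightarrow>
          (\<lambda>p. u p + v p) \<in> polynomial_functions X"
| mult: "u \<in> polynomial_functions X \<Longrightarrow> v \<in> polynomial_functions X \<Longrightarrow>
          (\<lambda>p. u p * v p) \<in> polynomial_functions X"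

text \<open>\<open>Q\<close> holds on a nonempty principal Zariski open subset of the affine space \<open>S\<close> with coordinate
  functions \<open>X\<close>.\<close>

definition generically :: "'p set \<Rightarrow> ('p \<Rightarrow> complex) set \<Rightarrow> ('p \<Rightarrow> bool) \<Rightarrow> bool" where
  "generically S X Q \<longleftrightarrow>
     (\<exists>P\<in>polynomial_functions X. (\<exists>p\<in>S. P p \<noteq> 0) \<and> (\<forall>p\<in>S. P p \<noteq> 0 \<longrightarrow> Q p))"

text \<open>Coordinates on pairs of an element of \<open>h\<close> and a point \<open>(z\<^sub>k)\<close>, where \<open>k\<close> ranges over \<open>K\<close>.\<close>

definition parameter_coordinates ::
  "'g::ab_group_add lie \<Rightarrow> 'g set \<Rightarrow> 'k set \<Rightarrow> ('g \<times> ('k \<Rightarrow> complex) \<Rightarrow> complex) set" where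
  "parameter_coordinates G h K =
     {\<lambda>(\<chi>, z). u \<chi> | u. linear_form_on (smult G) h u} \<union> {\<lambda>(\<chi>, z). z k | k. k \<in> K}"

end

theory Submission
  imports Defs "HOL-Computational_Algebra.Primes" "HOL-Library.Product_Plus"
begin

text \<open>An embedding of vector spaces exists for all \<open>\<chi>\<close> and \<open>z\<close> as soon as \<open>dim V\<^sub>\<mu> \<le> dim V'\<^sub>\<mu>\<^sub>'\<close> for each
  factor. Since \<open>\<mu>'\<close> is \<open>\<sigma>\<close>-invariant, there is \<open>S\<close> on \<open>V'\<^sub>\<mu>\<^sub>'\<close> with \<open>S (x v) = \<sigma>(x) S v\<close> that fixes the highest weight
  vector. Taking the trace of \<open>S\<close> times the Casimir operator on the weight spaces of \<open>\<sigma>\<close>-invariant weights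
  gives a recursion of Freudenthal type for the trace of \<open>S\<close>, in which the roots enter only through
  their \<open>\<sigma>\<close>-orbit sums. These sums are the roots of the dual of the folded Lie algebra, and the
  recursion is Freudenthal's for \<open>V\<^sub>\<mu>\<close>. So the weight multiplicities of \<open>V\<^sub>\<mu>\<close> are traces of \<open>S\<close> on weight
  spaces of \<open>V'\<^sub>\<mu>\<^sub>'\<close>, and these are bounded by the dimensions, because \<open>S\<close> has finite order. No
  classification is used: the Dynkin types enter only through the symmetry of the Cartan matrix and
  the primality of the order of \<open>\<sigma>\<close>.\<close>

text \<open>The obstacle is the commutator step of Freudenthal's argument. Moving a root vector past
  \<open>S\<close> and around the trace replaces it by its image under \<open>\<sigma>\<close>, so
  it meets its partner of opposite weight again only after a whole \<open>\<sigma>\<close>-orbit;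
  this is why labels shift by orbit sums. Two facts dispose of the intermediate terms and of signs:
  the difference of two distinct roots of one orbit is never a root, and \<open>\<sigma>\<close>
  fixes the root vectors of invariant roots. Both rest on the orthogonality of the simple roots in
  an orbit, and both are carried from simple roots to all roots by products of reflections over an
  orbit, which commute with \<open>\<sigma>\<close>. The recursion has only one solution because
  |\<mu> + \<rho> + n| < |\<mu> + \<rho>| for every weight \<mu> + n other than \<mu>. Freudenthal's
  formula for the dual algebra is the same theorem for the trivial automorphism. Positive roots,
  one-dimensional root spaces, the Killing form and the Casimir operator are all developed from the
  Chevalley generators.\<close>

lemma sum_fun_apply: "(\<Sum>k\<in>A. g k) j = (\<Sum>k\<in>A. g k j)"
  by (induction A rule: infinite_finite_induct) simp_all

section \<open>Coordinates with respect to a finite basis of a subspace\<close>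

locale fbasis = vector_space s for s :: "complex \<Rightarrow> 'v::ab_group_add \<Rightarrow> 'v" +
  fixes B M :: "'v set"
  assumes finB: "finite B" and indB: "independent B" and spanB: "span B = M"
begin

text \<open>Coordinates are taken in a basis of the whole ambient space that extends
  \<open>B\<close>, which makes them linear without membership conditions.\<close>

definition coord :: "'v \<Rightarrow> 'v \<Rightarrow> complex" where
  "coord b v = representation (extend_basis B) v b"

lemma ext: "B \<subseteq> extend_basis B" "independent (extend_basis B)" "span (extend_basis B) = UNIV"
  using extend_basis_superset[OF indB] independent_extend_basis[OF indB] span_extend_basis[OF indB]
  by auto

lemma coord_add: "coord b (v + w) = coord b v + coord b w"
  unfolding coord_def using ext by (subst representation_add) auto

lemma coord_scale: "coord b (s c v) = c * coord b v"
  unfolding coord_def using ext by (subst representation_scale) auto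

lemma coord_zero: "coord b 0 = 0"
  using coord_scale[of b 0 0] by simp

lemma coord_diff: "coord b (v - w) = coord b v - coord b w"
  using coord_add[of b "v - w" w] by simp

lemma coord_sum: "coord b (\<Sum>i\<in>A. f i) = (\<Sum>i\<in>A. coord b (f i))"
  by (induction A rule: infinite_finite_induct) (simp_all add: coord_add coord_zero)

lemma coord_basis: "b' \<in> B \<Longrightarrow> coord b b' = (if b = b' then 1 else 0)"
  unfolding coord_def using ext by (subst representation_basis) auto

definition proj :: "'v \<Rightarrow> 'v" where
  "proj v = (\<Sum>b\<in>B. s (coord b v) b)"

lemma proj_in: "proj v \<in> M"
  unfolding proj_def spanB[symmetric] by (intro span_sum span_scale span_base)

lemma proj_add: "proj (v + w) = proj v + proj w"
  by (simp add: proj_def coord_add scale_left_distrib sum.distrib)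

lemma proj_scale: "proj (s c v) = s c (proj v)"
  by (simp add: proj_def coord_scale scale_sum_right)

lemma proj_basis: "b \<in> B \<Longrightarrow> proj b = b"
  unfolding proj_def using finB by (simp add: coord_basis if_distrib [of "\<lambda>c. s c _"] sum.delta cong: if_cong)

lemma proj_id: assumes "v \<in> M" shows "proj v = v"
proof -
  have [simp]: "proj 0 = 0" by (simp add: proj_def coord_zero)
  have "v \<in> span B" using assms spanB by simp
  then show ?thesis
    by (induction rule: span_induct_alt) (simp_all add: proj_add proj_scale proj_basis)
qed

lemma expand: "v \<in> M \<Longrightarrow> v = (\<Sum>b\<in>B. s (coord b v) b)"
  using proj_id by (simp add: proj_def)

lemma subspace_M: "subspace M" using spanB by auto

lemma B_sub: "B \<subseteq> M" using spanB span_superset by auto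

end

text \<open>Choosing the basis inside a prescribed spanning set \<open>W\<close> is what later
  produces bases of weight vectors; \<open>F\<close> only bounds the size.\<close>

lemma fbasis_subset:
  assumes "vector_space s" "finite F" "M \<subseteq> module.span s F" "W \<subseteq> M" "module.span s W = M"
  obtains B where "fbasis s B M" "B \<subseteq> W"
proof -
  interpret vector_space s by fact
  obtain B where B: "B \<subseteq> W" "independent B" "span B = span W"
    using maximal_independent_subset[of W] by (metis span_minimal span_mono subset_antisym subspace_span)
  have "finite B"
    using independent_span_bound[of F B] span_superset[of B] assms B by auto
  then show thesis using B assms that[of B] by (simp add: fbasis_def fbasis_axioms_def vector_space_axioms)
qed

lemma fbasis_exists:
  assumes "vector_space s" "finite_dim s M"
  obtains B where "fbasis s B M"
proof -
  interpret vector_space s by fact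
  from assms(2) obtain F where "finite F" "span F = M" unfolding finite_dim_def by auto
  then show thesis using fbasis_subset[OF assms(1), of F M F] that span_superset by auto
qed

text \<open>A function \<open>n\<close> in the root lattice stands for \<open>\<Sum>\<^sub>j n\<^sub>j \<alpha>\<^sub>j\<close>. In a module with highest weight \<open>\<lambda>\<close>
  the weights are labelled by their difference from \<open>\<lambda>\<close>, so that the highest weight is labelled 0.\<close>

definition rho_pair :: "'i set \<Rightarrow> ('i \<Rightarrow> 'i \<Rightarrow> int) \<Rightarrow> ('i \<Rightarrow> int) \<Rightarrow> 'i \<Rightarrow> int" where
  "rho_pair I a n i = (\<Sum>j\<in>I. a i j * n j)"

definition alp :: "'i \<Rightarrow> 'i \<Rightarrow> int" where
  "alp i = (\<lambda>j. if j = i then 1 else 0)"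

definition lattice :: "'i set \<Rightarrow> ('i \<Rightarrow> int) set" where
  "lattice I = {n. \<forall>i. i \<notin> I \<longrightarrow> n i = 0}"

lemma rho_pair_add: "rho_pair I a (n + m) i = rho_pair I a n i + rho_pair I a m i"
  by (simp add: rho_pair_def algebra_simps sum.distrib)

lemma rho_pair_diff: "rho_pair I a (n - m) i = rho_pair I a n i - rho_pair I a m i"
  by (simp add: rho_pair_def algebra_simps sum_subtractf)

lemma rho_pair_minus: "rho_pair I a (- n) i = - rho_pair I a n i"
  by (simp add: rho_pair_def sum_negf)

lemma rho_pair_zero [simp]: "rho_pair I a 0 i = 0"
  by (simp add: rho_pair_def)

lemma rho_pair_alp: "finite I \<Longrightarrow> j \<in> I \<Longrightarrow> rho_pair I a (alp j) i = a i j"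
  by (simp add: rho_pair_def alp_def if_distrib cong: if_cong)

lemma lattice_add: "n \<in> lattice I \<Longrightarrow> m \<in> lattice I \<Longrightarrow> n + m \<in> lattice I"
  and lattice_diff: "n \<in> lattice I \<Longrightarrow> m \<in> lattice I \<Longrightarrow> n - m \<in> lattice I"
  and lattice_minus: "n \<in> lattice I \<Longrightarrow> - n \<in> lattice I"
  and lattice_zero [simp]: "0 \<in> lattice I"
  and lattice_alp: "i \<in> I \<Longrightarrow> alp i \<in> lattice I"
  by (auto simp: lattice_def alp_def)

section \<open>Lie algebras with Chevalley generators\<close>

text \<open>The bracket is bilinear on the whole ambient type with values in \<open>C\<close>, so
  that rewriting needs no membership conditions. The Jacobi identity has the shape of a module law,
  so that the adjoint representation is literally an instance of \<open>chev_mod\<close>.\<close>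

locale chev =
  fixes sg :: "complex \<Rightarrow> 'g::ab_group_add \<Rightarrow> 'g" and br :: "'g \<Rightarrow> 'g \<Rightarrow> 'g" and C :: "'g set"
    and I :: "'i set" and a :: "'i \<Rightarrow> 'i \<Rightarrow> int" and e f t :: "'i \<Rightarrow> 'g"
  assumes vsg: "vector_space sg"
    and br_add_left: "br (x + y) z = br x z + br y z"
    and br_add_right: "br x (y + z) = br x y + br x z"
    and br_scale_left: "br (sg c x) y = sg c (br x y)"
    and br_scale_right: "br x (sg c y) = sg c (br x y)"
    and br_self: "br x x = 0"
    and jacobi: "br (br x y) z = br x (br y z) - br y (br x z)"
    and br_C: "br x y \<in> C"
    and subC: "module.subspace sg C"
    and fdC: "finite_dim sg C"
    and eC: "i \<in> I \<Longrightarrow> e i \<in> C" and fC: "i \<in> I \<Longrightarrow> f i \<in> C" and tC: "i \<in> I \<Longrightarrow> t i \<in> C"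
    and finI: "finite I" and neI: "I \<noteq> {}"
    and a_diag: "i \<in> I \<Longrightarrow> a i i = 2"
    and br_tt: "i \<in> I \<Longrightarrow> j \<in> I \<Longrightarrow> br (t i) (t j) = 0"
    and br_ef: "i \<in> I \<Longrightarrow> j \<in> I \<Longrightarrow> br (e i) (f j) = (if i = j then t i else 0)"
    and br_te: "i \<in> I \<Longrightarrow> j \<in> I \<Longrightarrow> br (t i) (e j) = sg (of_int (a i j)) (e j)"
    and br_tf: "i \<in> I \<Longrightarrow> j \<in> I \<Longrightarrow> br (t i) (f j) = sg (- of_int (a i j)) (f j)"
    and t_indep: "(\<Sum>i\<in>I. sg (u i) (t i)) = 0 \<Longrightarrow> i \<in> I \<Longrightarrow> u i = 0"
    and generate: "module.subspace sg S \<Longrightarrow> S \<subseteq> C \<Longrightarrow> (\<And>x y. x \<in> S \<Longrightarrow> y \<in> S \<Longrightarrow> br x y \<in> S) \<Longrightarrow>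
        (\<And>i. i \<in> I \<Longrightarrow> e i \<in> S) \<Longrightarrow> (\<And>i. i \<in> I \<Longrightarrow> f i \<in> S) \<Longrightarrow> S = C"
    and simple: "module.subspace sg S \<Longrightarrow> S \<subseteq> C \<Longrightarrow> (\<And>x y. x \<in> C \<Longrightarrow> y \<in> S \<Longrightarrow> br x y \<in> S) \<Longrightarrow>
        S = {0} \<or> S = C"

sublocale chev \<subseteq> vg: vector_space sg by (rule vsg)

locale chev_mod = chev sg br C I a e f t
  for sg :: "complex \<Rightarrow> 'g::ab_group_add \<Rightarrow> 'g" and br :: "'g \<Rightarrow> 'g \<Rightarrow> 'g" and C :: "'g set"
    and I :: "'i set" and a :: "'i \<Rightarrow> 'i \<Rightarrow> int" and e f t :: "'i \<Rightarrow> 'g" +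
  fixes sv :: "complex \<Rightarrow> 'v::ab_group_add \<Rightarrow> 'v" and ac :: "'g \<Rightarrow> 'v \<Rightarrow> 'v" and M :: "'v set"
    and lam :: "'i \<Rightarrow> complex"
  assumes vsv: "vector_space sv"
    and ac_add_left: "ac (x + y) v = ac x v + ac y v"
    and ac_add_right: "ac x (v + w) = ac x v + ac x w"
    and ac_scale_left: "ac (sg c x) v = sv c (ac x v)"
    and ac_scale_right: "ac x (sv c v) = sv c (ac x v)"
    and ac_br: "ac (br x y) v = ac x (ac y v) - ac y (ac x v)"
    and ac_M: "ac x v \<in> M"
    and subM: "module.subspace sv M"

sublocale chev_mod \<subseteq> vv: vector_space sv by (rule vsv)

text \<open>The base weight of the adjoint module is 0, so its weight labels are the roots
  themselves.\<close>

sublocale chev \<subseteq> ad: chev_mod sg br C I a e f t sg br C "\<lambda>_. 0"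
  by unfold_locales (simp_all add: br_add_left br_add_right br_scale_left br_scale_right jacobi br_C subC)

context chev begin

definition rsp :: "('i \<Rightarrow> int) \<Rightarrow> 'g set" where
  "rsp r = {x \<in> C. \<forall>i\<in>I. br (t i) x = sg (of_int (rho_pair I a r i)) x}"

lemma rspD: "x \<in> rsp r \<Longrightarrow> i \<in> I \<Longrightarrow> br (t i) x = sg (of_int (rho_pair I a r i)) x"
  and rsp_C: "x \<in> rsp r \<Longrightarrow> x \<in> C"
  by (auto simp: rsp_def)

lemma e_rsp: "i \<in> I \<Longrightarrow> e i \<in> rsp (alp i)"
  and f_rsp: "i \<in> I \<Longrightarrow> f i \<in> rsp (- alp i)"
  and t_rsp: "i \<in> I \<Longrightarrow> t i \<in> rsp 0"
  using finI by (auto simp: rsp_def eC fC tC br_te br_tf br_tt rho_pair_alp rho_pair_minus)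

lemma br_zero [simp]: "br 0 x = 0" "br x 0 = 0"
  using br_scale_left[of 0 0 x] br_scale_right[of x 0 0] by simp_all

lemma br_minus_left: "br (- x) y = - br x y"
  using br_scale_left[of "-1" x y] by simp

lemma br_minus_right: "br x (- y) = - br x y"
  using br_scale_right[of x "-1" y] by simp

lemma br_anti: "br y x = - br x y"
proof -
  have "br x y + br y x = br (x + y) (x + y)"
    using br_self[of x] br_self[of y] by (simp only: br_add_left br_add_right) simp
  then have "br x y + br y x = 0" by (simp only: br_self)
  then show ?thesis by (simp add: eq_neg_iff_add_eq_0 add.commute)
qed

text \<open>The Chevalley involution on the level of data: the Cartan matrix is unchanged, so every
  statement about the positive half yields one about the negative half.\<close>

lemma chev_opp: "chev sg br C I a f e (\<lambda>i. - t i)"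
proof (unfold_locales, goal_cases)
  case (17 i j)
  then show ?case using br_ef[of j i] br_anti[of "f i" "e j"] by auto
next
  case (20 c i)
  then have "(\<Sum>i\<in>I. sg (- c i) (t i)) = 0" by simp
  with 20 t_indep[of "\<lambda>i. - c i" i] show ?case by simp
next
  case (21 S)
  then show ?case by (intro generate)
next
  case (22 S)
  then show ?case by (intro simple)
qed (use subC in \<open>auto simp: br_add_left br_add_right br_scale_left br_scale_right br_self jacobi br_C
      subC fdC eC fC tC finI neI a_diag br_tt br_te br_tf br_minus_left br_minus_right intro: vg.subspace_neg\<close>)

end

context chev_mod begin

lemma ac_zero [simp]: "ac 0 v = 0" "ac x 0 = 0"
  using ac_scale_left[of 0 0 v] ac_scale_right[of x 0 0] by simp_all

lemma ac_minus_left: "ac (- x) v = - ac x v"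
  using ac_scale_left[of "-1" x v] by simp

lemma ac_minus_right: "ac x (- v) = - ac x v"
  using ac_scale_right[of x "-1" v] by simp

lemma ac_diff_right: "ac x (v - w) = ac x v - ac x w"
  using ac_add_right[of x v "- w"] by (simp add: ac_minus_right)

lemma ac_sum_left: "ac (\<Sum>k\<in>A. g k) v = (\<Sum>k\<in>A. ac (g k) v)"
  by (induction A rule: infinite_finite_induct) (simp_all add: ac_add_left)

lemma ac_sum_right: "ac x (\<Sum>k\<in>A. g k) = (\<Sum>k\<in>A. ac x (g k))"
  by (induction A rule: infinite_finite_induct) (simp_all add: ac_add_right)

lemma ac_swap: "ac x (ac y v) = ac y (ac x v) + ac (br x y) v"
  by (simp add: ac_br)

definition ev :: "('i \<Rightarrow> int) \<Rightarrow> 'i \<Rightarrow> complex" where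
  "ev n i = lam i + of_int (rho_pair I a n i)"

definition wsp :: "('i \<Rightarrow> int) \<Rightarrow> 'v set" where
  "wsp n = {v \<in> M. \<forall>i\<in>I. ac (t i) v = sv (ev n i) v}"

lemma wspD: "v \<in> wsp n \<Longrightarrow> i \<in> I \<Longrightarrow> ac (t i) v = sv (ev n i) v"
  and wsp_M: "v \<in> wsp n \<Longrightarrow> v \<in> M"
  by (auto simp: wsp_def)

lemma subspace_wsp: "vv.subspace (wsp n)"
  using subM by (auto simp: wsp_def vv.subspace_def ac_add_right vv.scale_right_distrib ac_scale_right
      mult.commute)

lemma ac_wsp: assumes "x \<in> rsp r" "v \<in> wsp n" shows "ac x v \<in> wsp (n + r)"
proof -
  have "ac (t i) (ac x v) = sv (ev (n + r) i) (ac x v)" if "i \<in> I" for i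
    using that assms by (subst ac_swap)
      (simp add: rspD wspD ac_scale_left ac_scale_right ac_add_right ev_def rho_pair_add vv.scale_left_distrib)
  then show ?thesis by (auto simp: wsp_def ac_M)
qed

lemma ac_pow_wsp: "x \<in> rsp r \<Longrightarrow> v \<in> wsp n \<Longrightarrow> (ac x ^^ k) v \<in> wsp (n + (\<lambda>i. int k * r i))"
proof (induction k)
  case 0 then show ?case by (simp add: plus_fun_def)
next
  case (Suc k)
  then have "ac x ((ac x ^^ k) v) \<in> wsp (n + (\<lambda>i. int k * r i) + r)" by (intro ac_wsp)
  moreover have "n + (\<lambda>i. int k * r i) + r = n + (\<lambda>i. int (Suc k) * r i)"
    by (simp add: fun_eq_iff algebra_simps)
  ultimately show ?case by (simp only: funpow.simps o_apply)
qed

text \<open>The elements of \<open>C\<close> stabilising \<open>W\<close> form a subalgebra.\<close>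

lemma stable_gen:
  assumes "vv.subspace W" "W \<subseteq> M"
    and "\<And>i v. i \<in> I \<Longrightarrow> v \<in> W \<Longrightarrow> ac (e i) v \<in> W" "\<And>i v. i \<in> I \<Longrightarrow> v \<in> W \<Longrightarrow> ac (f i) v \<in> W"
    and "x \<in> C" "v \<in> W"
  shows "ac x v \<in> W"
proof -
  let ?S = "{x \<in> C. \<forall>v\<in>W. ac x v \<in> W}"
  have "?S = C"
  proof (rule generate)
    show "vg.subspace ?S"
      using assms(1) subC unfolding vg.subspace_def
      by (auto simp: ac_add_left ac_scale_left vv.subspace_0 vv.subspace_add vv.subspace_scale)
    show "br x y \<in> ?S" if "x \<in> ?S" "y \<in> ?S" for x y
      using that assms(1) by (auto simp: br_C ac_br vv.subspace_diff)
  qed (use assms eC fC in auto)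
  then show ?thesis using assms(5,6) by auto
qed

text \<open>Comparing coordinates of \<open>ac (t i) v\<close> forces every basis vector that occurs
  in \<open>v\<close> to have the eigenvalues of \<open>v\<close>. The subspace \<open>N\<close> may
  be smaller than \<open>M\<close>, because the lemma also serves cyclic submodules.\<close>

lemma wsp_in_span:
  assumes "fbasis sv B N" "\<And>b. b \<in> B \<Longrightarrow> \<exists>n. b \<in> wsp n" "v \<in> wsp r" and v: "v \<in> N"
  shows "v \<in> vv.span (B \<inter> wsp r)"
proof -
  interpret fbasis sv B N by fact
  have "b \<in> wsp r" if b: "b \<in> B" "coord b v \<noteq> 0" for b
  proof -
    obtain n where n: "b \<in> wsp n" using assms b by auto
    have "ev n i = ev r i" if i: "i \<in> I" for i
    proof -
      have ex: "\<exists>c. ac (t i) b' = sv c b' \<and> (b' = b \<longrightarrow> c = ev n i)" if "b' \<in> B" for b'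
        using assms(2)[OF that] wspD[OF n i] wspD[OF _ i] by metis
      then obtain c where c: "\<And>b'. b' \<in> B \<Longrightarrow> ac (t i) b' = sv (c b') b' \<and> (b' = b \<longrightarrow> c b' = ev n i)"
        by metis
      have "ac (t i) v = (\<Sum>b'\<in>B. ac (t i) (sv (coord b' v) b'))"
        by (subst expand[OF v]) (rule ac_sum_right)
      also have "\<dots> = (\<Sum>b'\<in>B. sv (coord b' v * c b') b')"
        using c by (intro sum.cong) (auto simp: ac_scale_right)
      finally have "coord b (ac (t i) v) = (\<Sum>b'\<in>B. coord b' v * c b' * coord b b')"
        by (simp add: coord_sum coord_scale)
      also have "\<dots> = (\<Sum>b'\<in>B. if b' = b then coord b' v * c b' else 0)"
        by (intro sum.cong) (auto simp: coord_basis)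
      also have "\<dots> = coord b v * ev n i" using b finB c by simp
      finally have "coord b (ac (t i) v) = coord b v * ev n i" .
      moreover have "coord b (ac (t i) v) = ev r i * coord b v"
        using wspD[OF assms(3) i] by (simp add: coord_scale)
      ultimately show ?thesis using b by simp
    qed
    then show ?thesis using n wspD[OF n] by (auto simp: wsp_def)
  qed
  then have "sv (coord b v) b \<in> vv.span (B \<inter> wsp r)" if "b \<in> B" for b
    using that by (cases "coord b v = 0") (auto intro: vv.span_scale vv.span_base vv.span_zero)
  then show ?thesis by (subst expand[OF v]) (rule vv.span_sum)
qed

end

definition lin :: "(complex \<Rightarrow> 'v::ab_group_add \<Rightarrow> 'v) \<Rightarrow> ('v \<Rightarrow> 'v) \<Rightarrow> bool" where
  "lin s F \<longleftrightarrow> (\<forall>v w. F (v + w) = F v + F w) \<and> (\<forall>c v. F (s c v) = s c (F v))"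

lemma lin_comp: "lin s F \<Longrightarrow> lin s G \<Longrightarrow> lin s (\<lambda>v. F (G v))"
  by (simp add: lin_def)

lemma lin_sum: assumes "vector_space s" "lin s F" shows "F (\<Sum>i\<in>A. g i) = (\<Sum>i\<in>A. F (g i))"
proof -
  interpret vector_space s by fact
  have "F (s 0 0) = s 0 (F 0)" using assms(2) unfolding lin_def by blast
  then have "F 0 = 0" by simp
  then show ?thesis using assms(2)
    by (induction A rule: infinite_finite_induct) (simp_all add: lin_def)
qed

section \<open>Triangular decomposition by iterated brackets of the generators\<close>

primrec bw :: "('g::zero \<Rightarrow> 'g \<Rightarrow> 'g) \<Rightarrow> ('i \<Rightarrow> 'g) \<Rightarrow> 'i list \<Rightarrow> 'g" where
  "bw br x [] = 0"
| "bw br x (i # w) = (if w = [] then x i else br (x i) (bw br x w))"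

definition cnt :: "'i list \<Rightarrow> 'i \<Rightarrow> int" where
  "cnt w = (\<lambda>j. int (count_list w j))"

lemma cnt_Nil [simp]: "cnt [] = 0" and cnt_Cons: "cnt (i # w) = cnt w + alp i"
  by (auto simp: cnt_def alp_def fun_eq_iff)

lemma cnt_lattice: "set w \<subseteq> I \<Longrightarrow> cnt w \<in> lattice I"
  by (auto simp: lattice_def cnt_def count_list_0_iff)

context chev begin

definition words :: "('i \<Rightarrow> 'g) \<Rightarrow> 'g set" where
  "words x = {bw br x w | w. set w \<subseteq> I}"

lemma ad_wsp: "ad.wsp r = rsp r"
  by (auto simp: ad.wsp_def rsp_def ad.ev_def)

lemma word_rsp: "set w \<subseteq> I \<Longrightarrow> bw br e w \<in> rsp (cnt w)"
proof (induction w)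
  case Nil
  show ?case using subC by (auto simp: rsp_def vg.subspace_0)
next
  case (Cons i w)
  show ?case
  proof (cases "w = []")
    case True
    then show ?thesis using Cons by (auto simp: cnt_Cons e_rsp)
  next
    case False
    have "br (e i) (bw br e w) \<in> ad.wsp (cnt w + alp i)"
      using Cons by (intro ad.ac_wsp e_rsp) (auto simp: ad_wsp)
    then show ?thesis using False by (simp only: cnt_Cons bw.simps if_False ad_wsp)
  qed
qed

text \<open>Induction on the word: \<open>f i\<close> passes \<open>e j\<close> at the cost of
  \<open>t j\<close>, which acts on the remaining word by a scalar. The span in question is stable
  under \<open>e j\<close>, which sends a coroot to a multiple of \<open>e j\<close>.\<close>

lemma word_bracket_f:
  assumes "i \<in> I" "set w \<subseteq> I"
  shows "br (f i) (bw br e w) \<in> vg.span (t ` I \<union> words e)"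
  using assms(2)
proof (induction w)
  case Nil
  then show ?case by (simp add: vg.span_zero)
next
  case (Cons j w)
  have ef: "br (f i) (e j) = - (if j = i then t j else 0)"
    using br_anti[of "e j" "f i"] Cons.prems assms(1) by (simp add: br_ef)
  have word: "bw br e w \<in> vg.span (t ` I \<union> words e)" if "set w \<subseteq> I" for w
    using that by (auto simp: words_def intro!: vg.span_base)
  show ?case
  proof (cases "w = []")
    case True
    have "t j \<in> vg.span (t ` I \<union> words e)" using Cons.prems by (intro vg.span_base) auto
    then show ?thesis using ef True by (cases "j = i") (simp_all add: vg.span_neg vg.span_zero)
  next
    case False
    have closed: "br (e j) y \<in> vg.span (t ` I \<union> words e)" if "y \<in> vg.span (t ` I \<union> words e)" for y
      using that
    proof (induction rule: vg.span_induct_alt)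
      case base
      then show ?case by (simp add: vg.span_zero)
    next
      case (step c x y)
      have "br (e j) x \<in> vg.span (t ` I \<union> words e)"
      proof (cases "x \<in> words e")
        case True
        then obtain w' where w': "x = bw br e w'" "set w' \<subseteq> I" by (auto simp: words_def)
        then have "br (e j) x = (if w' = [] then 0 else bw br e (j # w'))" by simp
        moreover have "bw br e (j # w') \<in> vg.span (t ` I \<union> words e)"
          using w' Cons.prems by (intro word) simp
        ultimately show ?thesis by (simp only: vg.span_zero split: if_split) simp
      next
        case False
        then obtain k where "x = t k" "k \<in> I" using step by auto
        then have "br (e j) x = sg (- of_int (a k j)) (bw br e [j])"
          using Cons.prems br_anti[of "t k" "e j"] \<open>k \<in> I\<close> by (simp add: br_te)
        then show ?thesis using word[of "[j]"] Cons.prems vg.span_scale[of "bw br e [j]"] by (simp add: vg.span_neg)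
      qed
      then show ?case using step by (simp add: br_add_right br_scale_right vg.span_add vg.span_scale)
    qed
    have "br (t i) (bw br e w) = sg (of_int (rho_pair I a (cnt w) i)) (bw br e w)"
      using word_rsp[of w] assms(1) Cons.prems by (auto simp: rsp_def)
    then have "br (br (f i) (e j)) (bw br e w) \<in> vg.span (t ` I \<union> words e)"
      using ef word[of w] Cons.prems
      by (cases "j = i") (simp_all add: br_minus_left vg.span_zero vg.span_neg vg.span_scale)
    moreover have "br (f i) (bw br e (j # w)) = br (br (f i) (e j)) (bw br e w) + br (e j) (br (f i) (bw br e w))"
      using False by (simp add: jacobi)
    ultimately show ?thesis using closed Cons by (auto intro!: vg.span_add)
  qed
qed

lemma word_bracket_e:
  assumes "i \<in> I" "set w \<subseteq> I"
  shows "br (e i) (bw br f w) \<in> vg.span (t ` I \<union> words f)"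
proof -
  interpret opp: chev sg br C I a f e "\<lambda>i. - t i" by (rule chev_opp)
  have "br (e i) (bw br f w) \<in> vg.span ((\<lambda>i. - t i) ` I \<union> words f)"
    using opp.word_bracket_f[OF assms] .
  moreover have "(\<lambda>i. - t i) ` I \<subseteq> vg.span (t ` I \<union> words f)"
    by (intro image_subsetI vg.span_neg vg.span_base) simp
  then have "(\<lambda>i. - t i) ` I \<union> words f \<subseteq> vg.span (t ` I \<union> words f)"
    using vg.span_superset[of "t ` I \<union> words f"] by simp
  ultimately show ?thesis using vg.span_minimal vg.subspace_span by blast
qed

lemma word_rsp_f: assumes "set w \<subseteq> I" shows "bw br f w \<in> rsp (- cnt w)"
proof -
  interpret opp: chev sg br C I a f e "\<lambda>i. - t i" by (rule chev_opp)
  have "bw br f w \<in> opp.rsp (cnt w)" using opp.word_rsp[OF assms] .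
  then show ?thesis by (auto simp: opp.rsp_def rsp_def rho_pair_minus br_minus_left) (metis minus_minus)
qed

definition gens :: "'g set" where
  "gens = t ` I \<union> words e \<union> words f"

lemma gens_rsp: "x \<in> gens \<Longrightarrow>
    \<exists>n\<in>lattice I. x \<in> rsp n \<and> ((\<exists>w. set w \<subseteq> I \<and> w \<noteq> [] \<and> n = cnt w \<and> x = bw br e w) \<or>
      (\<exists>w. set w \<subseteq> I \<and> w \<noteq> [] \<and> n = - cnt w \<and> x = bw br f w) \<or> n = 0 \<and> (x \<in> t ` I \<or> x = 0))"
proof -
  assume "x \<in> gens"
  then consider i where "i \<in> I" "x = t i" | w where "set w \<subseteq> I" "x = bw br e w"
    | w where "set w \<subseteq> I" "x = bw br f w" by (auto simp: gens_def words_def)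
  then show ?thesis
  proof cases
    case 1
    then show ?thesis using t_rsp by (intro bexI[of _ 0]) auto
  next
    case (2 w)
    then show ?thesis using word_rsp[of w] cnt_lattice[of w I]
      by (intro bexI[of _ "cnt w"]) (cases "w = []", auto)
  next
    case (3 w)
    then show ?thesis using word_rsp_f[of w] cnt_lattice[of w I]
      by (intro bexI[of _ "- cnt w"]) (cases "w = []", auto simp: lattice_minus)
  qed
qed

lemma gens_C: "gens \<subseteq> C"
  using gens_rsp rsp_C by blast

text \<open>The span is stable under every \<open>e i\<close> and \<open>f i\<close>, hence under
  all of \<open>C\<close> by \<open>stable_gen\<close>; being then a subalgebra that contains the
  generators, it is everything.\<close>

lemma gens_span: "vg.span gens = C"
proof -
  let ?N = "vg.span gens"
  have word: "bw br e w \<in> ?N" "bw br f w \<in> ?N" if "set w \<subseteq> I" for w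
    using that by (auto simp: gens_def words_def intro!: vg.span_base)
  have NC: "?N \<subseteq> C" using gens_C subC by (simp add: vg.span_minimal)
  have sub: "vg.span (t ` I \<union> words e) \<subseteq> ?N" "vg.span (t ` I \<union> words f) \<subseteq> ?N"
    by (auto simp: gens_def intro!: vg.span_mono)
  have ext: "br z x \<in> ?N" if "x \<in> ?N" "\<And>x. x \<in> gens \<Longrightarrow> br z x \<in> ?N" for x z
    using that
    by (induction rule: vg.span_induct_alt) (simp_all add: vg.span_zero br_add_right br_scale_right vg.span_add vg.span_scale)
  have cases: thesis if "x \<in> gens" "\<And>j. x = t j \<Longrightarrow> j \<in> I \<Longrightarrow> thesis"
    "\<And>w. x = bw br e w \<Longrightarrow> set w \<subseteq> I \<Longrightarrow> thesis" "\<And>w. x = bw br f w \<Longrightarrow> set w \<subseteq> I \<Longrightarrow> thesis" for x thesis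
    using that by (auto simp: gens_def words_def)
  have e: "br (e i) x \<in> ?N" if i: "i \<in> I" and x: "x \<in> gens" for i x
    using x
  proof (rule cases)
    fix j assume "x = t j" "j \<in> I"
    then have "br (e i) x = sg (- of_int (a j i)) (bw br e [i])"
      using i br_anti[of "t j" "e i"] by (simp add: br_te)
    moreover have "bw br e [i] \<in> ?N" using i by (intro word) simp
    ultimately show ?thesis by (simp only: vg.span_scale)
  next
    fix w assume w: "x = bw br e w" "set w \<subseteq> I"
    have "bw br e (i # w) \<in> ?N" using i w by (intro word) simp
    then show ?thesis using w by (cases "w = []") (simp_all add: vg.span_zero)
  next
    fix w assume w: "x = bw br f w" "set w \<subseteq> I"
    then show ?thesis using word_bracket_e[OF i w(2)] sub by auto
  qed
  have f: "br (f i) x \<in> ?N" if i: "i \<in> I" and x: "x \<in> gens" for i x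
    using x
  proof (rule cases)
    fix j assume "x = t j" "j \<in> I"
    then have "br (f i) x = sg (of_int (a j i)) (bw br f [i])"
      using i br_anti[of "t j" "f i"] by (simp add: br_tf)
    moreover have "bw br f [i] \<in> ?N" using i by (intro word) simp
    ultimately show ?thesis by (simp only: vg.span_scale)
  next
    fix w assume w: "x = bw br f w" "set w \<subseteq> I"
    have "bw br f (i # w) \<in> ?N" using i w by (intro word) simp
    then show ?thesis using w by (cases "w = []") (simp_all add: vg.span_zero)
  next
    fix w assume w: "x = bw br e w" "set w \<subseteq> I"
    then show ?thesis using word_bracket_f[OF i w(2)] sub by auto
  qed
  have ideal: "br x v \<in> ?N" if "x \<in> C" "v \<in> ?N" for x v
    by (rule ad.stable_gen[OF vg.subspace_span NC _ _ that]) (simp_all add: ext e f)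
  show ?thesis
  proof (rule generate)
    show "e i \<in> ?N" if "i \<in> I" for i using word(1)[of "[i]"] that by simp
    show "f i \<in> ?N" if "i \<in> I" for i using word(2)[of "[i]"] that by simp
    show "br x y \<in> ?N" if "x \<in> ?N" "y \<in> ?N" for x y using that NC by (intro ideal) auto
  qed (use NC in auto)
qed

text \<open>Taking the basis among coroots and words makes every basis vector a root vector whose
  label has coefficients of one sign.\<close>

definition adB :: "'g set" where
  "adB = (SOME B. fbasis sg B C \<and> B \<subseteq> gens)"

lemma adB: "fbasis sg adB C" "adB \<subseteq> gens"
proof -
  obtain F where "finite F" "vg.span F = C" using fdC unfolding finite_dim_def by auto
  then have "\<exists>B. fbasis sg B C \<and> B \<subseteq> gens"
    using fbasis_subset[OF vsg _ _ gens_C gens_span, of F] by (metis order_refl)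
  from someI_ex[OF this] show "fbasis sg adB C" "adB \<subseteq> gens" unfolding adB_def by auto
qed

text \<open>Labels have to be chosen here: their uniqueness is \<open>weight_separation\<close>,
  which rests on the Killing form, and that form is computed with these labels.\<close>

definition adwt :: "'g \<Rightarrow> 'i \<Rightarrow> int" where
  "adwt b = (SOME n. n \<in> lattice I \<and> b \<in> rsp n)"

lemma adwt: assumes "b \<in> adB" shows "adwt b \<in> lattice I \<and> b \<in> rsp (adwt b)"
proof -
  have "b \<in> gens" using assms adB by auto
  then have "\<exists>n. n \<in> lattice I \<and> b \<in> rsp n" using gens_rsp[of b] by auto
  then show ?thesis unfolding adwt_def by (rule someI_ex)
qed

end

section \<open>Strings of weights for the sl2-triples of simple roots\<close>

locale wmod = chev_mod sg br C I a e f t sv ac M lam + fbasis sv B M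
  for sg :: "complex \<Rightarrow> 'g::ab_group_add \<Rightarrow> 'g" and br :: "'g \<Rightarrow> 'g \<Rightarrow> 'g" and C :: "'g set"
    and I :: "'i set" and a :: "'i \<Rightarrow> 'i \<Rightarrow> int" and e f t :: "'i \<Rightarrow> 'g"
    and sv :: "complex \<Rightarrow> 'v::ab_group_add \<Rightarrow> 'v" and ac :: "'g \<Rightarrow> 'v \<Rightarrow> 'v" and M :: "'v set"
    and lam :: "'i \<Rightarrow> complex" and B :: "'v set" +
  fixes wt :: "'v \<Rightarrow> 'i \<Rightarrow> int"
  assumes wt_lattice: "b \<in> B \<Longrightarrow> wt b \<in> lattice I"
    and wt_wsp: "b \<in> B \<Longrightarrow> b \<in> wsp (wt b)"

sublocale chev \<subseteq> adw: wmod sg br C I a e f t sg br C "\<lambda>_. 0" adB adwt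
proof -
  interpret fbasis sg adB C by (rule adB)
  show "wmod sg br C I a e f t sg br C (\<lambda>_. 0) adB adwt"
    by unfold_locales (use adwt in \<open>auto simp: ad_wsp\<close>)
qed

context wmod begin

lemma coord_t:
  assumes "v \<in> M" "i \<in> I" "b \<in> B"
  shows "coord b (ac (t i) v) = ev (wt b) i * coord b v"
proof -
  have "ac (t i) v = (\<Sum>b'\<in>B. sv (coord b' v * ev (wt b') i) b')"
    by (subst expand[OF assms(1)]) (use wspD[OF wt_wsp assms(2)] in \<open>simp add: ac_sum_right ac_scale_right\<close>)
  then have "coord b (ac (t i) v) = (\<Sum>b'\<in>B. if b' = b then coord b' v * ev (wt b') i else 0)"
    by (auto simp: coord_sum coord_scale coord_basis intro!: sum.cong)
  then show ?thesis using assms finB by simp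
qed

lemma eigen_exists:
  assumes "v \<in> M" "v \<noteq> 0"
  obtains b where "b \<in> B" "coord b v \<noteq> 0"
proof -
  have "\<exists>b\<in>B. coord b v \<noteq> 0"
  proof (rule ccontr)
    assume "\<not> ?thesis"
    then have "(\<Sum>b\<in>B. sv (coord b v) b) = 0" by (intro sum.neutral) auto
    then show False using expand[OF assms(1)] assms(2) by simp
  qed
  then show thesis using that by auto
qed

lemma t_f_pow:
  assumes "ac (t i) v = sv c v" "i \<in> I"
  shows "ac (t i) ((ac (f i) ^^ n) v) = sv (c - 2 * of_nat n) ((ac (f i) ^^ n) v)"
proof (induction n)
  case 0
  then show ?case using assms by simp
next
  case (Suc n)
  have "ac (t i) (ac (f i) ((ac (f i) ^^ n) v)) = sv (c - 2 * of_nat (Suc n)) (ac (f i) ((ac (f i) ^^ n) v))"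
  proof -
    have "ac (t i) (ac (f i) ((ac (f i) ^^ n) v)) =
        sv (c - 2 * of_nat n) (ac (f i) ((ac (f i) ^^ n) v)) + sv (- 2) (ac (f i) ((ac (f i) ^^ n) v))"
      using assms by (subst ac_swap) (simp add: Suc ac_scale_right br_tf a_diag ac_minus_left ac_scale_left)
    also have "\<dots> = sv (c - 2 * of_nat n + (- 2)) (ac (f i) ((ac (f i) ^^ n) v))"
      by (rule vv.scale_left_distrib[symmetric])
    also have "c - 2 * of_nat n + (- 2) = c - 2 * of_nat (Suc n)" by simp
    finally show ?thesis .
  qed
  then show ?case by simp
qed

text \<open>Otherwise the powers would be eigenvectors of \<open>t i\<close> for infinitely many
  eigenvalues \<open>c - 2 * of_nat n\<close>, while only finitely many occur on
  \<open>B\<close>.\<close>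

lemma f_nilpotent:
  assumes "v \<in> M" "ac (t i) v = sv c v" "i \<in> I"
  shows "\<exists>n. (ac (f i) ^^ n) v = 0"
proof (rule ccontr)
  assume neg: "\<not> ?thesis"
  have "c - 2 * of_nat n \<in> (\<lambda>b. ev (wt b) i) ` B" for n
  proof -
    have M: "(ac (f i) ^^ n) v \<in> M" using assms ac_M by (cases n) auto
    obtain b where b: "b \<in> B" "coord b ((ac (f i) ^^ n) v) \<noteq> 0"
      using eigen_exists[OF M] neg by blast
    have "ev (wt b) i * coord b ((ac (f i) ^^ n) v) = (c - 2 * of_nat n) * coord b ((ac (f i) ^^ n) v)"
      using coord_t[OF M assms(3) b(1)] by (simp only: t_f_pow[OF assms(2,3)] coord_scale)
    then have "ev (wt b) i = c - 2 * of_nat n" using b(2) by simp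
    then show ?thesis using b(1) by force
  qed
  then have "range (\<lambda>n::nat. c - 2 * of_nat n) \<subseteq> (\<lambda>b. ev (wt b) i) ` B" by auto
  moreover have "inj (\<lambda>n::nat. c - 2 * of_nat n :: complex)" by (auto simp: inj_on_def)
  ultimately show False using finB finite_subset finite_imageD infinite_UNIV_nat
    by (metis finite_imageI)
qed

lemma t_e_pow:
  assumes "ac (t i) v = sv c v" "i \<in> I"
  shows "ac (t i) ((ac (e i) ^^ n) v) = sv (c + 2 * of_nat n) ((ac (e i) ^^ n) v)"
proof (induction n)
  case 0
  then show ?case using assms by simp
next
  case (Suc n)
  have "ac (t i) (ac (e i) ((ac (e i) ^^ n) v)) = sv (c + 2 * of_nat (Suc n)) (ac (e i) ((ac (e i) ^^ n) v))"
  proof -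
    have "ac (t i) (ac (e i) ((ac (e i) ^^ n) v)) =
        sv (c + 2 * of_nat n) (ac (e i) ((ac (e i) ^^ n) v)) + sv 2 (ac (e i) ((ac (e i) ^^ n) v))"
      using assms by (subst ac_swap) (simp add: Suc ac_scale_right br_te a_diag ac_scale_left)
    also have "\<dots> = sv (c + 2 * of_nat n + 2) (ac (e i) ((ac (e i) ^^ n) v))"
      by (rule vv.scale_left_distrib[symmetric])
    also have "c + 2 * of_nat n + 2 = c + 2 * of_nat (Suc n)" by simp
    finally show ?thesis .
  qed
  then show ?case by simp
qed

text \<open>The sl2 relation for moving \<open>f\<close> past a power of \<open>e\<close>,
  specialised to an eigenvector so that only a scalar remains.\<close>

lemma e_pow_f:
  assumes "ac (t i) v = sv c v" "i \<in> I"
  shows "(ac (e i) ^^ Suc m) (ac (f i) v) =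
    ac (f i) ((ac (e i) ^^ Suc m) v) + sv (of_nat (m + 1) * (c + of_nat m)) ((ac (e i) ^^ m) v)"
proof (induction m)
  case 0
  show ?case using assms by (simp add: ac_swap[of "e i" "f i"] br_ef)
next
  case (Suc m)
  have "(ac (e i) ^^ Suc (Suc m)) (ac (f i) v) =
      ac (e i) (ac (f i) ((ac (e i) ^^ Suc m) v) + sv (of_nat (m + 1) * (c + of_nat m)) ((ac (e i) ^^ m) v))"
    using Suc by simp
  also have "\<dots> = ac (f i) (ac (e i) ((ac (e i) ^^ Suc m) v)) + ac (t i) ((ac (e i) ^^ Suc m) v) +
      sv (of_nat (m + 1) * (c + of_nat m)) ((ac (e i) ^^ Suc m) v)"
    using assms by (simp add: ac_add_right ac_scale_right ac_swap[of "e i" "f i"] br_ef)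
  also have "\<dots> = ac (f i) ((ac (e i) ^^ Suc (Suc m)) v) +
      sv (c + 2 * of_nat (Suc m) + of_nat (m + 1) * (c + of_nat m)) ((ac (e i) ^^ Suc m) v)"
    using t_e_pow[OF assms, of "Suc m"] by (simp add: vv.scale_left_distrib del: of_nat_Suc of_nat_add)
  also have "c + 2 * of_nat (Suc m) + of_nat (m + 1) * (c + of_nat m) = of_nat (Suc m + 1) * (c + of_nat (Suc m))"
    by (simp add: algebra_simps)
  finally show ?case .
qed

text \<open>When \<open>f\<close> kills \<open>v\<close>, the relation \<open>e_pow_f\<close> reads
  e^(m+1) f v = 0 = f e^(m+1) v + (m+1)(m-k) e^m v; the coefficient is nonzero for m < k, so e^(m+1)
  v = 0 would force e^m v = 0.\<close>

lemma e_pow_singular: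
  assumes "ac (t i) v = sv (- of_nat k) v" "i \<in> I" "ac (f i) v = 0" "v \<noteq> 0" "m \<le> k"
  shows "(ac (e i) ^^ m) v \<noteq> 0"
  using assms(5)
proof (induction m)
  case 0
  then show ?case using assms by simp
next
  case (Suc m)
  have z: "(ac (e i) ^^ n) 0 = 0" for n by (induction n) simp_all
  show ?case
  proof
    assume 0: "(ac (e i) ^^ Suc m) v = 0"
    have "sv (of_nat (m + 1) * (- of_nat k + of_nat m)) ((ac (e i) ^^ m) v) = 0"
      using e_pow_f[OF assms(1,2), of m] assms(3) 0 z by simp
    moreover have "of_nat (m + 1) * (- of_nat k + of_nat m) \<noteq> (0::complex)"
      using Suc.prems by (simp del: of_nat_Suc of_nat_add add: of_nat_eq_iff)
    ultimately show False using Suc by simp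
  qed
qed

text \<open>If \<open>f v \<noteq> 0\<close> then \<open>e\<^sup>k\<^sup>+\<^sup>2 f v = f e\<^sup>k\<^sup>+\<^sup>2 v + (k + 2) e\<^sup>k\<^sup>+\<^sup>1 v\<close> reduces the claim to \<open>f v\<close>.\<close>

lemma e_pow_nonzero:
  assumes "v \<in> M" "ac (t i) v = sv (- of_nat k) v" "i \<in> I" "v \<noteq> 0"
  shows "(ac (e i) ^^ k) v \<noteq> 0"
proof -
  obtain n where "(ac (f i) ^^ n) v = 0" using f_nilpotent[OF assms(1-3)] by blast
  then show ?thesis using assms
  proof (induction n arbitrary: v k)
    case 0
    then show ?case by simp
  next
    case (Suc n)
    show ?case
    proof (cases "ac (f i) v = 0")
      case True
      then show ?thesis using e_pow_singular Suc by blast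
    next
      case False
      have "ac (t i) (ac (f i) v) = sv (- of_nat (k + 2)) (ac (f i) v)"
        using t_f_pow[OF Suc.prems(3,4), of 1] by (simp add: algebra_simps)
      then have nz: "(ac (e i) ^^ (k + 2)) (ac (f i) v) \<noteq> 0"
        using Suc.IH[of "ac (f i) v" "k + 2"] Suc.prems False ac_M by (simp add: funpow_swap1)
      show ?thesis
      proof
        assume "(ac (e i) ^^ k) v = 0"
        then have "(ac (e i) ^^ Suc (Suc k)) (ac (f i) v) = 0"
          by (subst e_pow_f[OF Suc.prems(3,4)]) simp
        then show False using nz by simp
      qed
    qed
  qed
qed

lemma wmod_opp: "wmod sg br C I a f e (\<lambda>i. - t i) sv ac M (\<lambda>i. - lam i) B (\<lambda>b. - wt b)"
proof -
  interpret opp: chev sg br C I a f e "\<lambda>i. - t i" by (rule chev_opp)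
  interpret opp: chev_mod sg br C I a f e "\<lambda>i. - t i" sv ac M "\<lambda>i. - lam i"
    by unfold_locales (simp_all add: ac_add_left ac_add_right ac_scale_left ac_scale_right ac_br ac_M subM)
  show ?thesis
  proof unfold_locales
    fix b assume b: "b \<in> B"
    show "- wt b \<in> lattice I" using wt_lattice[OF b] by (rule lattice_minus)
    have "opp.ev (- wt b) i = - ev (wt b) i" for i
      by (simp add: opp.ev_def ev_def rho_pair_minus)
    then show "b \<in> opp.wsp (- wt b)"
      using wt_wsp[OF b] by (simp add: opp.wsp_def wsp_def ac_minus_left)
  qed
qed

lemma f_pow_nonzero:
  assumes "v \<in> M" "ac (t i) v = sv (of_nat k) v" "i \<in> I" "v \<noteq> 0"
  shows "(ac (f i) ^^ k) v \<noteq> 0"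
proof -
  interpret opp: wmod sg br C I a f e "\<lambda>i. - t i" sv ac M "\<lambda>i. - lam i" B "\<lambda>b. - wt b" by (rule wmod_opp)
  show ?thesis using opp.e_pow_nonzero[of v i k] assms by (simp add: ac_minus_left)
qed

end

section \<open>The Killing form\<close>

context fbasis begin

definition tr :: "('v \<Rightarrow> 'v) \<Rightarrow> complex" where
  "tr F = (\<Sum>b\<in>B. coord b (F b))"

lemma coord_lin_expand:
  assumes "lin s F" "v \<in> M"
  shows "coord b (F v) = (\<Sum>c\<in>B. coord c v * coord b (F c))"
proof -
  have "F v = F (\<Sum>c\<in>B. s (coord c v) c)" using expand[OF assms(2)] by simp
  also have "\<dots> = (\<Sum>c\<in>B. s (coord c v) (F c))"
    using assms(1) by (subst lin_sum[OF vector_space_axioms assms(1)]) (simp add: lin_def)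
  finally show ?thesis by (simp add: coord_sum coord_scale)
qed

lemma tr_comm:
  assumes "lin s F" "lin s G" "\<And>b. b \<in> B \<Longrightarrow> F b \<in> M" "\<And>b. b \<in> B \<Longrightarrow> G b \<in> M"
  shows "tr (\<lambda>v. F (G v)) = tr (\<lambda>v. G (F v))"
proof -
  have "tr (\<lambda>v. F (G v)) = (\<Sum>b\<in>B. \<Sum>c\<in>B. coord c (G b) * coord b (F c))"
    unfolding tr_def using assms by (intro sum.cong refl coord_lin_expand) auto
  also have "\<dots> = (\<Sum>c\<in>B. \<Sum>b\<in>B. coord b (F c) * coord c (G b))"
    by (subst sum.swap) (simp add: mult.commute)
  also have "\<dots> = tr (\<lambda>v. G (F v))"
    unfolding tr_def using assms by (intro sum.cong refl coord_lin_expand[symmetric]) auto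
  finally show ?thesis .
qed

end

context chev_mod begin

lemma lin_ac: "lin sv (ac x)"
  by (simp add: lin_def ac_add_right ac_scale_right)

lemma lin_pow: "lin sv F \<Longrightarrow> lin sv (F ^^ k)"
  by (induction k) (simp_all add: lin_def)

end

context chev begin

definition kf :: "'g \<Rightarrow> 'g \<Rightarrow> complex" where
  "kf x y = adw.tr (\<lambda>z. br x (br y z))"

lemma kf_add_left: "kf (x + y) z = kf x z + kf y z"
  and kf_add_right: "kf z (x + y) = kf z x + kf z y"
  and kf_scale_left: "kf (sg c x) z = c * kf x z"
  and kf_scale_right: "kf z (sg c x) = c * kf z x"
  by (simp_all add: kf_def adw.tr_def br_add_left br_add_right br_scale_left br_scale_right
      adw.coord_add adw.coord_scale sum.distrib sum_distrib_left)

lemma kf_comm: "kf x y = kf y x"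
  unfolding kf_def by (rule adw.tr_comm) (simp_all add: ad.lin_ac br_C)

lemma kf_invariant: "kf (br x y) z = kf x (br y z)"
proof -
  have "adw.tr (\<lambda>v. br y (br x (br z v))) = adw.tr (\<lambda>v. br x (br z (br y v)))"
    by (rule adw.tr_comm[of "br y" "\<lambda>v. br x (br z v)"]) (simp_all add: ad.lin_ac br_C lin_comp)
  then show ?thesis
    by (simp add: kf_def adw.tr_def jacobi ad.ac_diff_right adw.coord_diff sum_subtractf)
qed

definition Kt :: "'i \<Rightarrow> 'i \<Rightarrow> int" where
  "Kt i j = (\<Sum>b\<in>adB. rho_pair I a (adwt b) i * rho_pair I a (adwt b) j)"

lemma br_t_adB: "i \<in> I \<Longrightarrow> b \<in> adB \<Longrightarrow> br (t i) b = sg (of_int (rho_pair I a (adwt b) i)) b"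
  using adwt[of b] by (simp add: rsp_def)

lemma kf_tt: "i \<in> I \<Longrightarrow> j \<in> I \<Longrightarrow> kf (t i) (t j) = of_int (Kt i j)"
  by (simp add: kf_def adw.tr_def br_t_adB br_scale_right adw.coord_scale adw.coord_basis Kt_def mult.commute
      cong: sum.cong)

text \<open>Write \<open>t i\<close> as the bracket of \<open>e i\<close> and \<open>f i\<close> and
  move it by invariance. The left side is symmetric in \<open>i\<close> and \<open>j\<close>, which
  makes the Cartan matrix symmetrizable.\<close>

lemma kf_tt_ef: "i \<in> I \<Longrightarrow> j \<in> I \<Longrightarrow> of_int (Kt i j) = of_int (a j i) * kf (e i) (f i)"
proof -
  assume ij: "i \<in> I" "j \<in> I"
  have "br (f i) (t j) = sg (of_int (a j i)) (f i)"
    using ij br_anti[of "f i" "t j"] by (simp add: br_tf)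
  then have "kf (br (e i) (f i)) (t j) = of_int (a j i) * kf (e i) (f i)"
    by (simp add: kf_invariant kf_scale_right)
  then show ?thesis using ij by (simp add: br_ef kf_tt)
qed

lemma t_nonzero: "i \<in> I \<Longrightarrow> t i \<noteq> 0"
  using t_indep[of "\<lambda>j. if j = i then 1 else 0" i] finI
  by (auto simp: if_distrib[of "\<lambda>c. sg c _"] cong: if_cong)

lemma e_nonzero: "i \<in> I \<Longrightarrow> e i \<noteq> 0" and f_nonzero: "i \<in> I \<Longrightarrow> f i \<noteq> 0"
  using br_ef[of i i] t_nonzero[of i] by force+

text \<open>A sum of squares of integers, in which a basis vector occurring in \<open>e i\<close>
  contributes 4.\<close>

lemma Kt_pos: assumes "i \<in> I" shows "Kt i i > 0"
proof -
  obtain b where b: "b \<in> adB" "adw.coord b (e i) \<noteq> 0"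
    using adw.eigen_exists[OF eC[OF assms] e_nonzero[OF assms]] by blast
  have "2 * adw.coord b (e i) = of_int (rho_pair I a (adwt b) i) * adw.coord b (e i)"
    using adw.coord_t[OF eC[OF assms] assms b(1)] assms by (simp add: br_te a_diag adw.coord_scale ad.ev_def)
  then have "of_int (rho_pair I a (adwt b) i) = (of_int 2 :: complex)" using b by simp
  then have "rho_pair I a (adwt b) i = 2" by (simp only: of_int_eq_iff)
  then show ?thesis
    unfolding Kt_def using adw.finB b by (intro sum_pos2[of _ b]) auto
qed

text \<open>Half the Killing square length of the coroot, which equals
  \<open>kf (e i) (f i)\<close>. The reciprocals of these numbers symmetrize
  \<open>a\<close>.\<close>

definition cK :: "'i \<Rightarrow> real" where
  "cK i = of_int (Kt i i) / 2"

lemma cK_pos: "i \<in> I \<Longrightarrow> cK i > 0"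
  by (simp add: cK_def Kt_pos)

lemma kf_ef: "i \<in> I \<Longrightarrow> kf (e i) (f i) = of_real (cK i)"
  using kf_tt_ef[of i i] by (simp add: a_diag cK_def)

lemma Kt_a: "i \<in> I \<Longrightarrow> j \<in> I \<Longrightarrow> of_int (Kt i j) = of_int (a j i) * cK i"
proof -
  assume "i \<in> I" "j \<in> I"
  then have "complex_of_real (of_int (Kt i j)) = complex_of_real (of_int (a j i) * cK i)"
    using kf_tt_ef[of i j] kf_ef[of i] by simp
  then show ?thesis by (simp only: of_real_eq_iff)
qed

lemma Kt_sym: "Kt i j = Kt j i"
  by (simp add: Kt_def mult.commute)

lemma a_cK_sym: "i \<in> I \<Longrightarrow> j \<in> I \<Longrightarrow> of_int (a j i) * cK i = of_int (a i j) * cK j"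
  using Kt_a[of i j] Kt_a[of j i] Kt_sym[of i j] by simp

text \<open>The line through \<open>h\<close> is an ideal. If it were all of \<open>C\<close>,
  brackets would vanish, against \<open>br (e i) (f i) = t i\<close>.\<close>

lemma central_zero:
  assumes "h \<in> C" "\<And>x. x \<in> C \<Longrightarrow> br h x = 0"
  shows "h = 0"
proof -
  have h: "br x (sg c h) = 0" if "x \<in> C" for x c
    using assms(2)[OF that] br_anti[of x h] by (simp add: br_scale_right)
  have "range (\<lambda>c. sg c h) = {0} \<or> range (\<lambda>c. sg c h) = C"
  proof (rule simple)
    show "vg.subspace (range (\<lambda>c. sg c h))" using vg.span_singleton vg.subspace_span by metis
    show "range (\<lambda>c. sg c h) \<subseteq> C" using assms(1) subC by (auto intro: vg.subspace_scale)
    show "br x y \<in> range (\<lambda>c. sg c h)" if "x \<in> C" "y \<in> range (\<lambda>c. sg c h)" for x y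
      using that h by (auto intro: range_eqI[of _ _ 0])
  qed
  then show ?thesis
  proof
    assume "range (\<lambda>c. sg c h) = {0}"
    then have "sg 1 h \<in> {0}" by blast
    then show ?thesis by simp
  next
    assume C: "range (\<lambda>c. sg c h) = C"
    obtain i where i: "i \<in> I" using neI by auto
    then obtain c where "f i = sg c h" using C fC by auto
    then have "br (e i) (f i) = 0" using h[OF eC[OF i]] by simp
    then show ?thesis using i t_nonzero by (simp add: br_ef)
  qed
qed

text \<open>With y = x / cK the form is the Killing square length of h, the sum of the y_i t_i,
  hence the sum over \<open>adB\<close> of the squared eigenvalues of ad h. If all of these vanish,
  h is central and therefore 0.\<close>

lemma posdef_cK:
  fixes x :: "'i \<Rightarrow> real"
  assumes "i \<in> I" "x i \<noteq> 0"
  shows "(\<Sum>i\<in>I. \<Sum>j\<in>I. x i * x j * of_int (a i j) / cK i) > 0"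
proof -
  define y where "y = (\<lambda>i. x i / cK i)"
  define w where "w = (\<lambda>b. \<Sum>i\<in>I. y i * of_int (rho_pair I a (adwt b) i))"
  have "(\<Sum>i\<in>I. \<Sum>j\<in>I. x i * x j * of_int (a i j) / cK i) = (\<Sum>i\<in>I. \<Sum>j\<in>I. y i * y j * of_int (Kt i j))"
  proof (intro sum.cong refl)
    fix i j assume ij: "i \<in> I" "j \<in> I"
    show "x i * x j * of_int (a i j) / cK i = y i * y j * of_int (Kt i j)"
      using cK_pos[OF ij(2)] Kt_a[OF ij(2,1)] by (simp add: y_def Kt_sym[of i j])
  qed
  also have "\<dots> = (\<Sum>i\<in>I. \<Sum>j\<in>I. \<Sum>b\<in>adB. (y i * of_int (rho_pair I a (adwt b) i)) * (y j * of_int (rho_pair I a (adwt b) j)))"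
    by (simp add: Kt_def sum_distrib_left mult.assoc mult.left_commute)
  also have "\<dots> = (\<Sum>b\<in>adB. \<Sum>i\<in>I. \<Sum>j\<in>I. (y i * of_int (rho_pair I a (adwt b) i)) * (y j * of_int (rho_pair I a (adwt b) j)))"
    by (subst sum.swap[of _ adB I, symmetric], intro sum.cong refl) (rule sum.swap)
  also have "\<dots> = (\<Sum>b\<in>adB. (w b)\<^sup>2)"
    by (simp add: w_def power2_eq_square sum_product)
  finally have eq: "(\<Sum>i\<in>I. \<Sum>j\<in>I. x i * x j * of_int (a i j) / cK i) = (\<Sum>b\<in>adB. (w b)\<^sup>2)" .
  have "(\<Sum>b\<in>adB. (w b)\<^sup>2) \<noteq> 0"
  proof
    assume "(\<Sum>b\<in>adB. (w b)\<^sup>2) = 0"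
    then have w0: "w b = 0" if "b \<in> adB" for b
      using that adw.finB by (subst (asm) sum_nonneg_eq_0_iff) auto
    define h where "h = (\<Sum>i\<in>I. sg (of_real (y i)) (t i))"
    have "br h b = 0" if b: "b \<in> adB" for b
    proof -
      have "br h b = (\<Sum>i\<in>I. sg (of_real (y i * of_int (rho_pair I a (adwt b) i))) b)"
        by (simp add: h_def ad.ac_sum_left br_scale_left br_t_adB b)
      also have "\<dots> = sg (of_real (w b)) b"
        by (simp only: w_def of_real_sum vg.scale_sum_left)
      finally show ?thesis using w0[OF b] by simp
    qed
    then have "br h x = 0" if "x \<in> C" for x
      by (subst adw.expand[OF that]) (simp add: ad.ac_sum_right br_scale_right)
    moreover have "h \<in> C" unfolding h_def
      using subC tC by (intro vg.subspace_sum vg.subspace_scale) auto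
    ultimately have "h = 0" using central_zero by blast
    then have "complex_of_real (y i) = 0" using t_indep[of "\<lambda>i. of_real (y i)" i] assms(1) h_def by simp
    then show False using assms cK_pos[of i] by (simp add: y_def)
  qed
  moreover have "(\<Sum>b\<in>adB. (w b)\<^sup>2) \<ge> 0" by (simp add: sum_nonneg)
  ultimately show ?thesis unfolding eq by linarith
qed

text \<open>A nonzero bracket would have \<open>t i\<close>-eigenvalue 2 and be killed by
  \<open>f i\<close>, but on such a vector the square of \<open>f i\<close> does not vanish.\<close>

lemma comm_ee: assumes "i \<in> I" "j \<in> I" "i \<noteq> j" "a i j = 0" shows "br (e i) (e j) = 0"
proof (rule ccontr)
  assume nz: "br (e i) (e j) \<noteq> 0"
  have t: "br (t i) (br (e i) (e j)) = sg (of_nat 2) (br (e i) (e j))"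
    using assms by (subst ad.ac_swap) (simp add: br_te a_diag br_scale_left)
  have "br (f i) (br (e i) (e j)) = br (br (f i) (e i)) (e j) + br (e i) (br (f i) (e j))"
    by (simp add: jacobi)
  also have "br (f i) (e i) = - t i" using br_anti[of "f i" "e i"] assms by (simp add: br_ef)
  also have "br (f i) (e j) = 0" using br_anti[of "f i" "e j"] assms by (simp add: br_ef)
  finally have "br (f i) (br (e i) (e j)) = 0" using assms by (simp add: br_minus_left br_te)
  moreover have "(br (f i) ^^ 2) (br (e i) (e j)) \<noteq> 0"
    by (rule adw.f_pow_nonzero) (use assms t nz br_C in auto)
  ultimately show False by (simp add: numeral_2_eq_2)
qed

lemma comm_ff: assumes "i \<in> I" "j \<in> I" "i \<noteq> j" "a i j = 0" shows "br (f i) (f j) = 0"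
proof -
  interpret opp: chev sg br C I a f e "\<lambda>i. - t i" by (rule chev_opp)
  show ?thesis by (rule opp.comm_ee) fact+
qed

text \<open>The centraliser of the generators outside \<open>K\<close> is an ideal.\<close>

lemma connected:
  assumes "K \<subseteq> I" "K \<noteq> {}" "\<And>i j. i \<in> K \<Longrightarrow> j \<in> I - K \<Longrightarrow> a i j = 0"
  shows "K = I"
proof (rule ccontr)
  assume "K \<noteq> I"
  then obtain j where j: "j \<in> I" "j \<notin> K" using assms by auto
  obtain i where i: "i \<in> K" "i \<in> I" using assms by auto
  define Z where "Z = {x \<in> C. \<forall>j\<in>I - K. br (e j) x = 0 \<and> br (f j) x = 0}"
  have sub: "vg.subspace Z" using subC
    by (auto simp: Z_def vg.subspace_def br_add_right br_scale_right)
  have eZ: "e i \<in> Z" and fZ: "f i \<in> Z" if "i \<in> K" for i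
  proof -
    have i: "i \<in> I" using that assms by auto
    have "br (e j) (e i) = 0 \<and> br (f j) (e i) = 0 \<and> br (e j) (f i) = 0 \<and> br (f j) (f i) = 0" if j: "j \<in> I - K" for j
    proof -
      have "i \<noteq> j" "a i j = 0" using j \<open>i \<in> K\<close> assms by auto
      then show ?thesis using i j comm_ee[of i j] comm_ff[of i j]
        by (simp add: br_ef br_anti[of "e i" "e j"] br_anti[of "f i" "f j"] br_anti[of "f j" "e i"])
    qed
    then show "e i \<in> Z" "f i \<in> Z" using i eC fC by (auto simp: Z_def)
  qed
  have bZ: "br x y \<in> Z" if "x \<in> Z" "y \<in> Z" for x y
    using that by (auto simp: Z_def br_C ad.ac_swap[of _ x])
  have ideal: "br x y \<in> Z" if "x \<in> C" "y \<in> Z" for x y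
  proof (rule ad.stable_gen[OF sub _ _ _ that])
    fix k v assume k: "k \<in> I" and v: "v \<in> Z"
    show "br (e k) v \<in> Z" using k v eZ bZ vg.subspace_0[OF sub] by (cases "k \<in> K") (auto simp: Z_def)
    show "br (f k) v \<in> Z" using k v fZ bZ vg.subspace_0[OF sub] by (cases "k \<in> K") (auto simp: Z_def)
  qed (auto simp: Z_def)
  have "Z = {0} \<or> Z = C" by (rule simple[OF sub]) (auto simp: ideal, auto simp: Z_def)
  moreover have "Z \<noteq> {0}" using eZ[OF i(1)] e_nonzero[OF i(2)] by auto
  ultimately have "f j \<in> Z" using fC j by auto
  then have "br (e j) (f j) = 0" using j by (auto simp: Z_def)
  then show False using br_ef[of j j] t_nonzero[of j] j by simp
qed

text \<open>Since the Dynkin diagram is connected, every positive symmetrizer is proportional to 1 /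
  cK. This allows the Killing form to be exchanged for combinatorial weights \<open>D\<close> at the
  price of one scalar.\<close>

lemma symmetrizer_unique:
  assumes D: "\<And>i j. i \<in> I \<Longrightarrow> j \<in> I \<Longrightarrow> D i * of_int (a i j) = D j * of_int (a j i)"
    and pos: "\<And>i. i \<in> I \<Longrightarrow> D i > (0::real)"
  obtains l where "l > 0" "\<And>i. i \<in> I \<Longrightarrow> D i * cK i = l"
proof -
  obtain i0 where i0: "i0 \<in> I" using neI by auto
  define K where "K = {i \<in> I. D i * cK i = D i0 * cK i0}"
  have "K = I"
  proof (rule connected)
    show "K \<subseteq> I" "K \<noteq> {}" using i0 by (auto simp: K_def)
    fix i j assume ij: "i \<in> K" "j \<in> I - K"
    then have "i \<in> I" "j \<in> I" by (auto simp: K_def)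
    then have "D i * of_int (a i j) * (cK i * cK j) = D j * of_int (a j i) * (cK i * cK j)"
      using D[of i j] by simp
    also have "\<dots> = D j * cK j * (of_int (a j i) * cK i)" by simp
    also have "of_int (a j i) * cK i = of_int (a i j) * cK j"
      by (rule a_cK_sym) fact+
    finally have "(D i * cK i - D j * cK j) * (of_int (a i j) * cK j) = 0"
      by (simp add: algebra_simps)
    moreover have "D i * cK i - D j * cK j \<noteq> 0" using ij by (auto simp: K_def)
    ultimately show "a i j = 0" using cK_pos[OF \<open>j \<in> I\<close>] by simp
  qed
  then have "D i * cK i = D i0 * cK i0" if "i \<in> I" for i
    using that unfolding K_def by blast
  moreover have "D i0 * cK i0 > 0" using pos[OF i0] cK_pos[OF i0] by simp
  ultimately show thesis using that by blast
qed

text \<open>Positive definiteness makes the Cartan matrix nondegenerate, so the eigenvalues of the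
  coroots determine a label.\<close>

lemma weight_separation:
  assumes "n \<in> lattice I" "m \<in> lattice I" "\<And>i. i \<in> I \<Longrightarrow> rho_pair I a n i = rho_pair I a m i"
  shows "n = m"
proof (rule ccontr)
  assume "n \<noteq> m"
  then obtain k where k: "n k \<noteq> m k" by auto
  then have kI: "k \<in> I" using assms by (force simp: lattice_def)
  have "(\<Sum>i\<in>I. \<Sum>j\<in>I. of_int (n i - m i) * of_int (n j - m j) * of_int (a i j) / cK i) > 0"
    by (rule posdef_cK[OF kI]) (use k in simp)
  moreover have "(\<Sum>j\<in>I. of_int (n i - m i) * of_int (n j - m j) * of_int (a i j) / cK i) = 0" if i: "i \<in> I" for i
  proof -
    have "(\<Sum>j\<in>I. of_int (n i - m i) * of_int (n j - m j) * of_int (a i j) / cK i) =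
        of_int (n i - m i) / cK i * of_int (\<Sum>j\<in>I. a i j * (n j - m j))"
      by (simp add: sum_distrib_left sum_divide_distrib mult_ac)
    also have "(\<Sum>j\<in>I. a i j * (n j - m j)) = rho_pair I a n i - rho_pair I a m i"
      by (simp add: rho_pair_def algebra_simps sum_subtractf)
    finally show ?thesis using assms(3)[OF i] by simp
  qed
  ultimately show False by simp
qed

end

section \<open>Positive roots\<close>

definition srefl :: "'i set \<Rightarrow> ('i \<Rightarrow> 'i \<Rightarrow> int) \<Rightarrow> 'i \<Rightarrow> ('i \<Rightarrow> int) \<Rightarrow> 'i \<Rightarrow> int" where
  "srefl I a i r = (\<lambda>j. r j - rho_pair I a r i * alp i j)"

text \<open>Positive roots described by the Cartan matrix alone, so that the roots of two algebras
  can be compared combinatorially. The exception \<open>r \<noteq> alp i\<close> keeps the set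
  positive: a simple reflection permutes the positive roots other than its own simple root.\<close>

inductive_set Rp :: "'i set \<Rightarrow> ('i \<Rightarrow> 'i \<Rightarrow> int) \<Rightarrow> ('i \<Rightarrow> int) set" for I a where
  Rp_simple: "i \<in> I \<Longrightarrow> alp i \<in> Rp I a"
| Rp_refl: "r \<in> Rp I a \<Longrightarrow> i \<in> I \<Longrightarrow> r \<noteq> alp i \<Longrightarrow> srefl I a i r \<in> Rp I a"

definition height :: "'i set \<Rightarrow> ('i \<Rightarrow> int) \<Rightarrow> int" where
  "height I n = (\<Sum>i\<in>I. n i)"

definition bil :: "'i set \<Rightarrow> ('i \<Rightarrow> 'i \<Rightarrow> int) \<Rightarrow> ('i \<Rightarrow> real) \<Rightarrow> ('i \<Rightarrow> int) \<Rightarrow> ('i \<Rightarrow> int) \<Rightarrow> real" where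
  "bil I a D n m = (\<Sum>i\<in>I. D i * of_int (n i) * of_int (rho_pair I a m i))"

lemma rho_pair_line:
  assumes "finite I" "i \<in> I"
  shows "rho_pair I a (\<lambda>j. r j - c * alp i j) k = rho_pair I a r k - c * a k i"
proof -
  have "rho_pair I a (\<lambda>j. r j - c * alp i j) k = rho_pair I a r k - c * rho_pair I a (alp i) k"
    by (simp add: rho_pair_def right_diff_distrib sum_subtractf sum_distrib_left mult.left_commute)
  then show ?thesis using assms by (simp add: rho_pair_alp)
qed

lemma rho_pair_srefl:
  "finite I \<Longrightarrow> i \<in> I \<Longrightarrow> rho_pair I a (srefl I a i r) j = rho_pair I a r j - rho_pair I a r i * a j i"
  unfolding srefl_def by (rule rho_pair_line)

lemma srefl_lattice: "i \<in> I \<Longrightarrow> r \<in> lattice I \<Longrightarrow> srefl I a i r \<in> lattice I"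
  by (auto simp: lattice_def srefl_def alp_def)

lemma srefl_srefl: "finite I \<Longrightarrow> i \<in> I \<Longrightarrow> a i i = 2 \<Longrightarrow> srefl I a i (srefl I a i r) = r"
  by (simp add: srefl_def[of I a i "srefl I a i r"] rho_pair_srefl) (simp add: srefl_def fun_eq_iff algebra_simps)

lemma srefl_alp: "finite I \<Longrightarrow> i \<in> I \<Longrightarrow> a i i = 2 \<Longrightarrow> srefl I a i (alp i) = - alp i"
  by (simp add: srefl_def rho_pair_alp fun_eq_iff)

lemma height_srefl: "finite I \<Longrightarrow> i \<in> I \<Longrightarrow> height I (srefl I a i r) = height I r - rho_pair I a r i"
  by (simp add: height_def srefl_def sum_subtractf alp_def flip: sum_distrib_left)

context chev_mod begin

text \<open>Stands in for a lift of the simple reflection: on a weight space where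
  \<open>t i\<close> has eigenvalue \<open>m\<close> it maps injectively to the reflected weight
  space, without exponentials.\<close>

definition refl_op :: "'i \<Rightarrow> int \<Rightarrow> 'v \<Rightarrow> 'v" where
  "refl_op i m = (if m \<ge> 0 then ac (f i) ^^ nat m else ac (e i) ^^ nat (- m))"

lemma lin_refl_op: "lin sv (refl_op i m)"
  by (simp add: refl_op_def lin_pow lin_ac)

end

context wmod begin

lemma coord_wsp:
  assumes "v \<in> wsp n" "n \<in> lattice I" "b \<in> B" "coord b v \<noteq> 0"
  shows "wt b = n"
proof (rule weight_separation)
  fix i assume i: "i \<in> I"
  have "ev (wt b) i * coord b v = ev n i * coord b v"
    using coord_t[OF wsp_M[OF assms(1)] i assms(3)] by (simp only: wspD[OF assms(1) i] coord_scale)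
  then have "of_int (rho_pair I a (wt b) i) = (of_int (rho_pair I a n i) :: complex)"
    using assms(4) by (simp add: ev_def)
  then show "rho_pair I a (wt b) i = rho_pair I a n i" by (simp only: of_int_eq_iff)
qed (use assms wt_lattice in auto)

lemma wsp_wt: assumes "v \<in> wsp n" "v \<noteq> 0" "n \<in> lattice I" shows "n \<in> wt ` B"
proof -
  obtain b where "b \<in> B" "coord b v \<noteq> 0" using eigen_exists[OF wsp_M[OF assms(1)] assms(2)] .
  then show ?thesis using coord_wsp[OF assms(1,3)] by auto
qed

lemma wsp_unique:
  assumes "v \<in> wsp n" "v \<in> wsp m" "v \<noteq> 0" "n \<in> lattice I" "m \<in> lattice I"
  shows "n = m"
proof -
  obtain b where "b \<in> B" "coord b v \<noteq> 0" using eigen_exists[OF wsp_M[OF assms(1)] assms(3)] .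
  then show ?thesis using coord_wsp[OF assms(1,4)] coord_wsp[OF assms(2,5)] by metis
qed

lemma refl_op:
  assumes "i \<in> I" "ev n i = of_int m" "v \<in> wsp n"
  shows "refl_op i m v \<in> wsp (\<lambda>j. n j - m * alp i j)" "v \<noteq> 0 \<Longrightarrow> refl_op i m v \<noteq> 0"
proof (atomize(full), cases "m \<ge> 0")
  case True
  define k where "k = nat m"
  have eq: "n + (\<lambda>j. int k * (- alp i) j) = (\<lambda>j. n j - m * alp i j)"
    using True by (simp add: k_def fun_eq_iff)
  have "(ac (f i) ^^ k) v \<in> wsp (\<lambda>j. n j - m * alp i j)"
    using ac_pow_wsp[OF f_rsp[OF assms(1)] assms(3), of k] by (simp only: eq)
  moreover have "ac (t i) v = sv (of_nat k) v" using wspD[OF assms(3,1)] assms(2) True by (simp add: k_def)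
  then have "v \<noteq> 0 \<Longrightarrow> (ac (f i) ^^ k) v \<noteq> 0"
    using f_pow_nonzero[OF wsp_M[OF assms(3)] _ assms(1)] by blast
  ultimately show "refl_op i m v \<in> wsp (\<lambda>j. n j - m * alp i j) \<and> (v \<noteq> 0 \<longrightarrow> refl_op i m v \<noteq> 0)"
    using True by (simp add: refl_op_def k_def)
next
  case False
  define k where "k = nat (- m)"
  have eq: "n + (\<lambda>j. int k * alp i j) = (\<lambda>j. n j - m * alp i j)"
    using False by (simp add: k_def fun_eq_iff)
  have "(ac (e i) ^^ k) v \<in> wsp (\<lambda>j. n j - m * alp i j)"
    using ac_pow_wsp[OF e_rsp[OF assms(1)] assms(3), of k] by (simp only: eq)
  moreover have "ac (t i) v = sv (- of_nat k) v" using wspD[OF assms(3,1)] assms(2) False by (simp add: k_def)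
  then have "v \<noteq> 0 \<Longrightarrow> (ac (e i) ^^ k) v \<noteq> 0"
    using e_pow_nonzero[OF wsp_M[OF assms(3)] _ assms(1)] by blast
  ultimately show "refl_op i m v \<in> wsp (\<lambda>j. n j - m * alp i j) \<and> (v \<noteq> 0 \<longrightarrow> refl_op i m v \<noteq> 0)"
    using False by (simp add: refl_op_def k_def)
qed

end

context chev begin

lemma posdef:
  assumes D: "\<And>i j. i \<in> I \<Longrightarrow> j \<in> I \<Longrightarrow> D i * of_int (a i j) = D j * of_int (a j i)"
    and pos: "\<And>i. i \<in> I \<Longrightarrow> D i > (0::real)"
    and n: "n \<in> lattice I" "n \<noteq> 0"
  shows "bil I a D n n > 0"
proof -
  obtain l where l: "l > 0" "\<And>i. i \<in> I \<Longrightarrow> D i * cK i = l" using symmetrizer_unique[OF D pos] by metis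
  obtain k where k: "k \<in> I" "n k \<noteq> 0" using n by (force simp: lattice_def fun_eq_iff)
  have "bil I a D n n = (\<Sum>i\<in>I. \<Sum>j\<in>I. l * (of_int (n i) * of_int (n j) * of_int (a i j) / cK i))"
    unfolding bil_def
  proof (intro sum.cong refl)
    fix i assume i: "i \<in> I"
    have "D i = l / cK i" using l(2)[OF i] cK_pos[OF i] by (simp add: field_simps)
    then show "D i * of_int (n i) * of_int (rho_pair I a n i) =
        (\<Sum>j\<in>I. l * (of_int (n i) * of_int (n j) * of_int (a i j) / cK i))"
      by (simp add: rho_pair_def sum_distrib_left mult_ac sum_divide_distrib)
  qed
  also have "\<dots> = l * (\<Sum>i\<in>I. \<Sum>j\<in>I. of_int (n i) * of_int (n j) * of_int (a i j) / cK i)"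
    by (simp add: sum_distrib_left)
  also have "\<dots> > 0" using posdef_cK[OF k(1), of "\<lambda>i. of_int (n i)"] k l by simp
  finally show ?thesis .
qed

lemma rsp_unique: "x \<in> rsp n \<Longrightarrow> x \<in> rsp m \<Longrightarrow> x \<noteq> 0 \<Longrightarrow> n \<in> lattice I \<Longrightarrow> m \<in> lattice I \<Longrightarrow> n = m"
  using adw.wsp_unique by (simp add: ad_wsp)

lemma adB_nonzero: "b \<in> adB \<Longrightarrow> b \<noteq> 0"
  using adw.indB vg.dependent_zero by metis

lemma adB_rsp_cases:
  assumes "b \<in> adB" "b \<in> rsp r" "r \<in> lattice I"
  shows "(\<exists>w. set w \<subseteq> I \<and> w \<noteq> [] \<and> r = cnt w \<and> b = bw br e w) \<or>
      (\<exists>w. set w \<subseteq> I \<and> w \<noteq> [] \<and> r = - cnt w \<and> b = bw br f w) \<or> r = 0 \<and> b \<in> t ` I"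
proof -
  have "b \<in> gens" using assms adB by auto
  from gens_rsp[OF this] obtain n where n: "n \<in> lattice I" "b \<in> rsp n"
    and c: "(\<exists>w. set w \<subseteq> I \<and> w \<noteq> [] \<and> n = cnt w \<and> b = bw br e w) \<or>
      (\<exists>w. set w \<subseteq> I \<and> w \<noteq> [] \<and> n = - cnt w \<and> b = bw br f w) \<or> n = 0 \<and> (b \<in> t ` I \<or> b = 0)" by blast
  have "n = r" using rsp_unique[OF n(2) assms(2) adB_nonzero[OF assms(1)] n(1) assms(3)] .
  then show ?thesis using c adB_nonzero[OF assms(1)] by blast
qed

lemma rsp_span: "x \<in> rsp r \<Longrightarrow> x \<in> vg.span (adB \<inter> rsp r)"
  using ad.wsp_in_span[OF adB(1), of x r] adwt rsp_C by (auto simp: ad_wsp)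

lemma rsp_nonzero_cases:
  assumes "x \<in> rsp r" "x \<noteq> 0" "r \<in> lattice I"
  obtains b where "b \<in> adB" "b \<in> rsp r"
proof -
  have "adB \<inter> rsp r \<noteq> {}" using rsp_span[OF assms(1)] assms(2) by auto
  then show thesis using that by auto
qed

lemma cnt_nonneg: "cnt w j \<ge> 0"
  by (simp add: cnt_def)

lemma cnt_zero: "w \<noteq> [] \<Longrightarrow> cnt w \<noteq> 0"
  by (cases w) (auto simp: cnt_def fun_eq_iff split: if_splits)

lemma root_sign:
  assumes "x \<in> rsp r" "x \<noteq> 0" "r \<in> lattice I"
  shows "(\<forall>j. r j \<ge> 0) \<or> (\<forall>j. r j \<le> 0)"
proof -
  obtain b where b: "b \<in> adB" "b \<in> rsp r" by (rule rsp_nonzero_cases[OF assms])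
  show ?thesis using adB_rsp_cases[OF b assms(3)] by (elim disjE exE conjE) (simp_all add: cnt_nonneg)
qed

lemma rsp_0: "rsp 0 \<subseteq> vg.span (t ` I)"
proof
  fix x assume "x \<in> rsp 0"
  moreover have "adB \<inter> rsp 0 \<subseteq> t ` I"
  proof
    fix b assume "b \<in> adB \<inter> rsp 0"
    then have "(\<exists>w. w \<noteq> [] \<and> cnt w = (0 :: 'i \<Rightarrow> int)) \<or> b \<in> t ` I"
      using adB_rsp_cases[of b 0] by (metis IntD1 IntD2 lattice_zero neg_equal_0_iff_equal)
    then show "b \<in> t ` I" using cnt_zero by blast
  qed
  ultimately show "x \<in> vg.span (t ` I)" using rsp_span vg.span_mono by blast
qed

lemma cnt_multiple: assumes "cnt w = (\<lambda>j. k * alp i j)" shows "w = replicate (length w) i"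
proof -
  have "j = i" if "j \<in> set w" for j
  proof (rule ccontr)
    assume "j \<noteq> i"
    then have "cnt w j = 0" using assms by (simp add: alp_def)
    then show False using that by (simp add: cnt_def count_list_0_iff)
  qed
  then show ?thesis by (metis replicate_length_same)
qed

lemma bw_replicate: "bw br x (replicate (Suc (Suc k)) i) = 0"
  by (induction k) (simp_all add: br_self)

text \<open>A word with such a label repeats the single letter \<open>i\<close>, and from length two
  on the innermost bracket of \<open>e i\<close> with itself makes it vanish.\<close>

lemma adB_multiple:
  assumes "i \<in> I" "b \<in> adB" "b \<in> rsp (\<lambda>j. k * alp i j)" "k > 0"
  shows "k = 1 \<and> b = e i"
proof -
  have L: "(\<lambda>j. k * alp i j) \<in> lattice I" using assms by (auto simp: lattice_def alp_def)
  have "\<not> (\<exists>w. (\<lambda>j. k * alp i j) = - cnt w)"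
  proof
    assume "\<exists>w. (\<lambda>j. k * alp i j) = - cnt w"
    then obtain w where "(\<lambda>j. k * alp i j) = - cnt w" by blast
    then have "k * alp i i = - cnt w i" by (simp add: fun_eq_iff)
    then show False using assms(4) cnt_nonneg[of w i] by (simp add: alp_def)
  qed
  moreover have "(\<lambda>j. k * alp i j) \<noteq> 0" using assms(4) by (auto simp: fun_eq_iff alp_def)
  ultimately obtain w where w: "w \<noteq> []" "cnt w = (\<lambda>j. k * alp i j)" "b = bw br e w"
    using adB_rsp_cases[OF assms(2,3) L] by metis
  have rep: "w = replicate (length w) i" using cnt_multiple[OF w(2)] .
  have "length w = 1"
  proof (rule ccontr)
    assume "length w \<noteq> 1"
    then obtain m where "length w = Suc (Suc m)" using w(1) by (cases w; cases "tl w") auto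
    then have "b = 0" using w(3) rep bw_replicate by metis
    then show False using adB_nonzero assms by blast
  qed
  then have "w = [i]" using rep by simp
  moreover have "k = cnt [i] i" using w(2) \<open>w = [i]\<close> by (simp add: alp_def)
  ultimately show ?thesis using w by (simp add: cnt_def)
qed

definition dim1 :: "('i \<Rightarrow> int) \<Rightarrow> bool" where
  "dim1 r \<longleftrightarrow> (\<exists>x\<in>rsp r. x \<noteq> 0) \<and> (\<forall>x\<in>rsp r. \<forall>y\<in>rsp r. x \<noteq> 0 \<longrightarrow> (\<exists>c. y = sg c x))"

lemma dim1_simple: assumes "i \<in> I" shows "dim1 (alp i)"
proof -
  have eq: "(\<lambda>j. 1 * alp i j) = alp i" by simp
  have "adB \<inter> rsp (alp i) \<subseteq> {e i}" using adB_multiple[OF assms, of _ 1, unfolded eq] by auto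
  then have "rsp (alp i) \<subseteq> vg.span {e i}" using rsp_span vg.span_mono by blast
  then have *: "\<exists>c. x = sg c (e i)" if "x \<in> rsp (alp i)" for x
    using that by (auto simp: vg.span_singleton)
  have "\<exists>c. y = sg c x" if x: "x \<in> rsp (alp i)" and y: "y \<in> rsp (alp i)" and nz: "x \<noteq> 0" for x y
  proof -
    obtain c d where "x = sg c (e i)" "y = sg d (e i)" using *[OF x] *[OF y] by metis
    then show ?thesis using nz by (intro exI[of _ "d / c"]) auto
  qed
  then show ?thesis unfolding dim1_def using e_rsp[OF assms] e_nonzero[OF assms] by blast
qed

lemma multiple_root:
  assumes "i \<in> I" "x \<in> rsp (\<lambda>j. k * alp i j)" "x \<noteq> 0" "k > 0"
  shows "k = 1"
proof -
  have L: "(\<lambda>j. k * alp i j) \<in> lattice I" using assms by (auto simp: lattice_def alp_def)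
  show ?thesis using rsp_nonzero_cases[OF assms(2,3) L] adB_multiple[OF assms(1) _ _ assms(4)] by metis
qed

lemma rsp_refl_op:
  assumes "i \<in> I" "x \<in> rsp r"
  shows "ad.refl_op i (rho_pair I a r i) x \<in> rsp (srefl I a i r)"
    "x \<noteq> 0 \<Longrightarrow> ad.refl_op i (rho_pair I a r i) x \<noteq> 0"
  using adw.refl_op[OF assms(1), of r "rho_pair I a r i" x] assms(2)
  by (auto simp: ad_wsp ad.ev_def srefl_def)

lemma rsp_reflect:
  assumes "i \<in> I"
  obtains P where "lin sg P" "\<And>x. x \<in> rsp r \<Longrightarrow> P x \<in> rsp (srefl I a i r)"
    "\<And>x. x \<in> rsp r \<Longrightarrow> x \<noteq> 0 \<Longrightarrow> P x \<noteq> 0"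
  using that[OF ad.lin_refl_op rsp_refl_op[OF assms]] by blast

lemma subspace_rsp: "vg.subspace (rsp r)"
  using ad.subspace_wsp by (simp add: ad_wsp)

text \<open>The reflection operator back from the reflected space is injective and linear, so
  proportionality of the images gives proportionality of the vectors.\<close>

lemma dim1_reflect:
  assumes "i \<in> I" "r \<in> lattice I" "dim1 r"
  shows "dim1 (srefl I a i r)"
proof -
  let ?r = "srefl I a i r"
  obtain P where P: "\<And>x. x \<in> rsp r \<Longrightarrow> P x \<in> rsp ?r" "\<And>x. x \<in> rsp r \<Longrightarrow> x \<noteq> 0 \<Longrightarrow> P x \<noteq> 0"
    using rsp_reflect[OF assms(1)] by metis
  obtain Q where Q: "lin sg Q" "\<And>x. x \<in> rsp ?r \<Longrightarrow> Q x \<in> rsp r" "\<And>x. x \<in> rsp ?r \<Longrightarrow> x \<noteq> 0 \<Longrightarrow> Q x \<noteq> 0"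
    using rsp_reflect[OF assms(1), of "srefl I a i r"]
    unfolding srefl_srefl[of I i a r, OF finI assms(1) a_diag[OF assms(1)]] by metis
  have "\<exists>x\<in>rsp ?r. x \<noteq> 0" using assms(3) P unfolding dim1_def by blast
  moreover have "\<exists>c. y = sg c x" if x: "x \<in> rsp ?r" and y: "y \<in> rsp ?r" and nz: "x \<noteq> 0" for x y
  proof -
    obtain c where c: "Q y = sg c (Q x)" using assms(3) Q x y nz unfolding dim1_def by metis
    have "y - sg c x \<in> rsp ?r" using x y subspace_rsp by (intro vg.subspace_diff vg.subspace_scale)
    moreover have "Q y = Q (y - sg c x) + sg c (Q x)"
      using Q(1) by (metis lin_def diff_add_cancel)
    then have "Q (y - sg c x) = 0" using c by simp
    ultimately have "y - sg c x = 0" using Q(3) by blast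
    then show ?thesis by (intro exI[of _ c]) simp
  qed
  ultimately show ?thesis unfolding dim1_def by blast
qed

lemma multiple_or_positive:
  assumes "\<And>j. r j \<ge> (0::int)"
  shows "r = (\<lambda>j. r i * alp i j) \<or> (\<exists>j. j \<noteq> i \<and> r j > 0)"
proof (rule disjCI)
  assume neg: "\<not> (\<exists>j. j \<noteq> i \<and> r j > 0)"
  show "r = (\<lambda>j. r i * alp i j)"
  proof
    fix j show "r j = r i * alp i j"
      using neg assms[of j] by (cases "j = i") (force simp: alp_def)+
  qed
qed

text \<open>A positive root other than \<open>alp i\<close> is not a multiple of
  \<open>alp i\<close>, so some other coefficient is positive. The reflection leaves that
  coefficient alone, and \<open>root_sign\<close> makes the remaining ones nonnegative.\<close>

lemma positive_root_reflect:
  assumes "i \<in> I" "x \<in> rsp r" "x \<noteq> 0" "r \<in> lattice I" "\<And>j. r j \<ge> 0" "r \<noteq> 0" "r \<noteq> alp i"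
  shows "srefl I a i r \<in> lattice I" "\<And>j. srefl I a i r j \<ge> 0" "srefl I a i r \<noteq> 0"
    "\<exists>y\<in>rsp (srefl I a i r). y \<noteq> 0" "srefl I a i r \<noteq> alp i"
proof -
  let ?r = "srefl I a i r"
  show L: "?r \<in> lattice I" by (rule srefl_lattice) fact+
  have "r \<noteq> (\<lambda>j. r i * alp i j)"
  proof
    assume "r = (\<lambda>j. r i * alp i j)"
    then obtain k where eq: "r = (\<lambda>j. k * alp i j)" by blast
    have "k \<noteq> 0" using eq assms(6) by (auto simp: fun_eq_iff)
    moreover have "k \<ge> 0" using assms(5)[of i] eq by (simp add: alp_def)
    ultimately have "k = 1" using multiple_root[OF assms(1), of x k] assms(2,3) unfolding eq by simp
    then show False using eq assms(7) by (simp add: fun_eq_iff)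
  qed
  then obtain j where j: "j \<noteq> i" "r j > 0" using multiple_or_positive[of r i] assms(5) by blast
  then have rj: "?r j > 0" by (simp add: srefl_def alp_def)
  then show "?r \<noteq> 0" "?r \<noteq> alp i" using j by (auto simp: alp_def)
  show ex: "\<exists>y\<in>rsp ?r. y \<noteq> 0" using rsp_reflect[OF assms(1)] assms(2,3) by metis
  then obtain y where "y \<in> rsp ?r" "y \<noteq> 0" by blast
  then have "(\<forall>j. ?r j \<ge> 0) \<or> (\<forall>j. ?r j \<le> 0)" using root_sign L by blast
  then show "?r j \<ge> 0" for j using rj by (meson not_less)
qed

lemma Rp_props: "r \<in> Rp I a \<Longrightarrow> r \<in> lattice I \<and> (\<forall>j. r j \<ge> 0) \<and> r \<noteq> 0 \<and> dim1 r"
proof (induction rule: Rp.induct)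
  case (Rp_simple i)
  then show ?case using lattice_alp dim1_simple by (auto simp: alp_def fun_eq_iff)
next
  case (Rp_refl r i)
  then obtain x where "x \<in> rsp r" "x \<noteq> 0" by (auto simp: dim1_def)
  then show ?case using positive_root_reflect[of i x r] Rp_refl dim1_reflect[of i r] by blast
qed

text \<open>The square length of \<open>r\<close> is a sum of terms D_i r_i \<langle>r,
  t_i\<rangle>, one of which must be positive.\<close>

lemma positive_pairing:
  assumes "r \<in> lattice I" "\<And>j. r j \<ge> 0" "bil I a D r r > 0" "\<And>i. i \<in> I \<Longrightarrow> D i > (0::real)"
  obtains i where "i \<in> I" "r i > 0" "rho_pair I a r i > 0"
proof -
  have "\<exists>i\<in>I. D i * of_int (r i) * of_int (rho_pair I a r i) > 0"
    using assms(3) unfolding bil_def by (meson not_less sum_nonpos)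
  then obtain i where i: "i \<in> I" "D i * of_int (r i) * of_int (rho_pair I a r i) > 0" by blast
  then have "of_int (r i) * of_int (rho_pair I a r i) > (0::real)"
    using assms(4)[OF i(1)] by (simp add: zero_less_mult_iff mult.assoc)
  then show thesis using that[OF i(1)] assms(2)[of i] by (auto simp: zero_less_mult_iff)
qed

lemma bilK_pos: "r \<in> lattice I \<Longrightarrow> r \<noteq> 0 \<Longrightarrow> bil I a (\<lambda>i. 1 / cK i) r r > 0"
proof (rule posdef)
  fix i j assume ij: "i \<in> I" "j \<in> I"
  show "1 / cK i * of_int (a i j) = 1 / cK j * of_int (a j i)"
    using a_cK_sym[OF ij] cK_pos[OF ij(1)] cK_pos[OF ij(2)] by (simp add: field_simps)
qed (simp_all add: cK_pos)

lemma height_nonneg: "(\<And>j. r j \<ge> 0) \<Longrightarrow> height I r \<ge> 0"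
  by (simp add: height_def sum_nonneg)

text \<open>Induction on the height: a positive root that is not simple pairs positively with some
  simple coroot, and reflecting there gives a lower positive root.\<close>

lemma root_in_Rp:
  assumes "x \<in> rsp r" "x \<noteq> 0" "r \<in> lattice I" "\<And>j. r j \<ge> 0" "r \<noteq> 0"
  shows "r \<in> Rp I a"
  using assms
proof (induction "nat (height I r)" arbitrary: r x rule: less_induct)
  case less
  obtain i where i: "i \<in> I" "r i > 0" "rho_pair I a r i > 0"
    using positive_pairing[OF less.prems(3,4) bilK_pos[OF less.prems(3,5)]] cK_pos by auto
  show ?case
  proof (cases "r = alp i")
    case True
    then show ?thesis using i by (simp add: Rp_simple)
  next
    case False
    note p = positive_root_reflect[OF i(1) less.prems False]
    obtain y where y: "y \<in> rsp (srefl I a i r)" "y \<noteq> 0" using p(4) by blast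
    have "nat (height I (srefl I a i r)) < nat (height I r)"
      using height_srefl[OF finI i(1), of a r] i(3) height_nonneg[of "srefl I a i r"] p(2) by simp
    then have "srefl I a i r \<in> Rp I a" using less.hyps y p by blast
    from Rp_refl[OF this i(1) p(5)] show ?thesis
      using srefl_srefl[of I i a r, OF finI i(1) a_diag[OF i(1)]] by simp
  qed
qed

lemma opp_rsp: "chev.rsp sg br C I a (\<lambda>i. - t i) r = rsp (- r)"
proof -
  interpret opp: chev sg br C I a f e "\<lambda>i. - t i" by (rule chev_opp)
  have "- x = sg c y \<longleftrightarrow> x = - sg c y" for x y c by (metis minus_minus)
  then show ?thesis by (simp add: opp.rsp_def rsp_def br_minus_left rho_pair_minus)
qed

definition roots :: "('i \<Rightarrow> int) set" where
  "roots = Rp I a \<union> uminus ` Rp I a"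

lemma root_in_roots:
  assumes "x \<in> rsp r" "x \<noteq> 0" "r \<in> lattice I" "r \<noteq> 0"
  shows "r \<in> roots"
proof -
  from root_sign[OF assms(1-3)] show ?thesis
  proof
    assume "\<forall>j. r j \<ge> 0"
    then show ?thesis using root_in_Rp[OF assms(1-3) _ assms(4)] by (simp add: roots_def)
  next
    assume neg: "\<forall>j. r j \<le> 0"
    interpret opp: chev sg br C I a f e "\<lambda>i. - t i" by (rule chev_opp)
    have "- r \<in> Rp I a"
      by (rule opp.root_in_Rp[of x]) (use assms neg in \<open>auto simp: opp_rsp lattice_minus\<close>)
    then show ?thesis unfolding roots_def by (metis UnI2 image_eqI minus_minus)
  qed
qed

lemma roots_uminus: "r \<in> roots \<Longrightarrow> - r \<in> roots"
  by (auto simp: roots_def)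

lemma roots_props: assumes "r \<in> roots" shows "r \<in> lattice I" "r \<noteq> 0" "dim1 r"
proof -
  interpret opp: chev sg br C I a f e "\<lambda>i. - t i" by (rule chev_opp)
  have "opp.dim1 s \<longleftrightarrow> dim1 (- s)" for s by (simp add: opp.dim1_def dim1_def opp_rsp)
  moreover have "r \<in> Rp I a \<or> - r \<in> Rp I a" using assms by (auto simp: roots_def)
  ultimately show "r \<in> lattice I" "r \<noteq> 0" "dim1 r"
    using Rp_props[of r] opp.Rp_props[of "- r"] lattice_minus[of "- r" I] by auto
qed

lemma finite_Rp: "finite (Rp I a)"
proof (rule finite_subset)
  show "Rp I a \<subseteq> adwt ` adB"
    using Rp_props adw.wsp_wt unfolding dim1_def ad_wsp by blast
qed (simp add: adw.finB)

lemma Rp_uminus_disjoint: "Rp I a \<inter> uminus ` Rp I a = {}"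
proof -
  have "False" if "r \<in> Rp I a" "- r \<in> Rp I a" for r
  proof -
    have "r j = 0" for j using Rp_props[OF that(1)] Rp_props[OF that(2)] by (metis uminus_apply neg_0_le_iff_le antisym)
    then show False using Rp_props[OF that(1)] by (auto simp: fun_eq_iff)
  qed
  then show ?thesis by auto
qed

end

lemma rho_pair_const_zero [simp]: "rho_pair I a (\<lambda>_. 0) i = 0"
  by (simp add: rho_pair_def)

context fbasis begin

lemma injective_imp_surjective:
  assumes T: "lin s T" and TM: "\<And>v. v \<in> M \<Longrightarrow> T v \<in> M" and inj: "\<And>v. v \<in> M \<Longrightarrow> T v = 0 \<Longrightarrow> v = 0"
    and w: "w \<in> M"
  obtains v where "v \<in> M" "T v = w"
proof -
  interpret T: Vector_Spaces.linear s s T using T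
    by (simp add: lin_def linear_iff_module_hom module_hom_def module_hom_axioms_def module_axioms)
  have injB: "inj_on T (span B)"
    unfolding spanB by (rule inj_onI) (use inj subspace_diff[OF subspace_M] T.diff in force)
  have ind: "independent (T ` B)" by (rule T.independent_injective_image[OF indB injB])
  have card: "card (T ` B) = card B"
    using injB B_sub span_superset by (intro card_image) (auto intro: inj_on_subset)
  have sub: "T ` B \<subseteq> M" using TM B_sub by auto
  obtain B' where B': "T ` B \<subseteq> B'" "B' \<subseteq> M" "independent B'" "M \<subseteq> span B'"
    using maximal_independent_subset_extend[OF sub ind] by metis
  have "finite B' \<and> card B' \<le> card B" using independent_span_bound[OF finB B'(3)] B'(2) spanB by simp
  then have "T ` B = B'" using B'(1) card by (metis card_seteq)
  then have "w \<in> span (T ` B)" using B' w by auto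
  then have "w \<in> T ` M" unfolding T.span_image spanB .
  then show thesis using that by auto
qed

end

section \<open>Highest weight modules and the Casimir operator\<close>

text \<open>Irreducibility is kept apart because this locale is also applied to the product of a
  module with a twisted copy of itself.\<close>

locale hwm = chev_mod sg br C I a e f t sv ac M lam
  for sg :: "complex \<Rightarrow> 'g::ab_group_add \<Rightarrow> 'g" and br :: "'g \<Rightarrow> 'g \<Rightarrow> 'g" and C :: "'g set"
    and I :: "'i set" and a :: "'i \<Rightarrow> 'i \<Rightarrow> int" and e f t :: "'i \<Rightarrow> 'g"
    and sv :: "complex \<Rightarrow> 'v::ab_group_add \<Rightarrow> 'v" and ac :: "'g \<Rightarrow> 'v \<Rightarrow> 'v" and M :: "'v set"
    and lam :: "'i \<Rightarrow> complex" +
  fixes v0 :: 'v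
  assumes v0M: "v0 \<in> M" and v0_nz: "v0 \<noteq> 0" and v0_e: "i \<in> I \<Longrightarrow> ac (e i) v0 = 0"
    and v0_t: "i \<in> I \<Longrightarrow> ac (t i) v0 = sv (lam i) v0"
    and fdM: "finite_dim sv M"
begin

definition fwd :: "'i list \<Rightarrow> 'v" where
  "fwd w = foldr (\<lambda>i. ac (f i)) w v0"

lemma fwd_simps [simp]: "fwd [] = v0" "fwd (i # w) = ac (f i) (fwd w)"
  by (simp_all add: fwd_def)

definition fwords :: "'v set" where
  "fwords = {fwd w | w. set w \<subseteq> I}"

lemma fwd_wsp: "set w \<subseteq> I \<Longrightarrow> fwd w \<in> wsp (- cnt w)"
proof (induction w)
  case Nil
  then show ?case using v0M v0_t by (simp add: wsp_def ev_def)
next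
  case (Cons i w)
  have i: "i \<in> I" and w: "set w \<subseteq> I" using Cons.prems by auto
  have "ac (f i) (fwd w) \<in> wsp (- cnt w + - alp i)" by (rule ac_wsp[OF f_rsp[OF i] Cons.IH[OF w]])
  then show ?case by (simp only: fwd_simps cnt_Cons minus_add_distrib)
qed

lemma fwd_e: "set w \<subseteq> I \<Longrightarrow> i \<in> I \<Longrightarrow> ac (e i) (fwd w) \<in> vv.span fwords"
proof (induction w)
  case Nil
  then show ?case by (simp add: v0_e vv.span_zero)
next
  case (Cons j w)
  have closed: "ac (f j) v \<in> vv.span fwords" if "v \<in> vv.span fwords" for v
    using that
  proof (induction rule: vv.span_induct_alt)
    case base
    then show ?case by (simp add: vv.span_zero)
  next
    case (step c x y)
    then obtain w' where "x = fwd w'" "set w' \<subseteq> I" by (auto simp: fwords_def)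
    then have "ac (f j) x = fwd (j # w')" "set (j # w') \<subseteq> I" using Cons.prems by auto
    then have "ac (f j) x \<in> fwords" unfolding fwords_def by blast
    then show ?case using step by (simp add: ac_add_right ac_scale_right vv.span_add vv.span_scale vv.span_base)
  qed
  have w: "fwd w \<in> vv.span fwords" using Cons.prems by (auto simp: fwords_def intro!: vv.span_base)
  have "ac (e i) (fwd (j # w)) = ac (f j) (ac (e i) (fwd w)) + ac (br (e i) (f j)) (fwd w)"
    by (simp add: ac_swap[of "e i"])
  moreover have "ac (br (e i) (f j)) (fwd w) \<in> vv.span fwords"
    using Cons.prems wspD[OF fwd_wsp, of w i] w by (cases "i = j") (simp_all add: br_ef vv.span_scale vv.span_zero)
  ultimately show ?case using closed Cons by (simp add: vv.span_add)
qed

lemma fwords_M: "fwords \<subseteq> M"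
  using fwd_wsp wsp_M by (auto simp: fwords_def)

lemma fwords_stable:
  assumes "x \<in> C" "v \<in> vv.span fwords"
  shows "ac x v \<in> vv.span fwords"
proof (rule stable_gen[OF vv.subspace_span _ _ _ assms])
  show "vv.span fwords \<subseteq> M" using fwords_M subM by (rule vv.span_minimal)
  fix i v assume i: "i \<in> I" and v: "v \<in> vv.span fwords"
  show "ac (e i) v \<in> vv.span fwords" using v
  proof (induction rule: vv.span_induct_alt)
    case (step c x y)
    then have "ac (e i) x \<in> vv.span fwords" using fwd_e[OF _ i] by (auto simp: fwords_def)
    then show ?case using step by (simp add: ac_add_right ac_scale_right vv.span_add vv.span_scale)
  qed (simp add: vv.span_zero)
  show "ac (f i) v \<in> vv.span fwords" using v
  proof (induction rule: vv.span_induct_alt)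
    case (step c x y)
    then obtain w' where "x = fwd w'" "set w' \<subseteq> I" by (auto simp: fwords_def)
    then have "ac (f i) x = fwd (i # w')" "set (i # w') \<subseteq> I" using i by auto
    then have "ac (f i) x \<in> fwords" unfolding fwords_def by blast
    then show ?case using step by (simp add: ac_add_right ac_scale_right vv.span_add vv.span_scale vv.span_base)
  qed (simp add: vv.span_zero)
qed

lemma fwords_basis:
  obtains B where "fbasis sv B (vv.span fwords)" "B \<subseteq> fwords"
proof -
  obtain F where F: "finite F" "vv.span F = M" using fdM unfolding finite_dim_def by auto
  have "vv.span fwords \<subseteq> vv.span F" unfolding F by (rule vv.span_minimal[OF fwords_M subM])
  then show thesis using fbasis_subset[OF vsv F(1), of "vv.span fwords" fwords] that vv.span_superset by metis
qed

text \<open>A nonempty lowering word has a nonzero label, so label 0 is reached only by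
  \<open>v0\<close>. The statement concerns the cyclic submodule, because it must later tell
  \<open>(0, v0)\<close> from the vectors of \<open>\<Gamma>\<close>.\<close>

lemma fwords_top: assumes "v \<in> vv.span fwords" "v \<in> wsp 0" shows "v \<in> vv.span {v0}"
proof -
  obtain B where B: "fbasis sv B (vv.span fwords)" "B \<subseteq> fwords" by (rule fwords_basis)
  interpret B: fbasis sv B "vv.span fwords" by fact
  have eq: "b = fwd w \<Longrightarrow> set w \<subseteq> I \<Longrightarrow> b \<in> wsp 0 \<Longrightarrow> b \<noteq> 0 \<Longrightarrow> b = v0" for b w
  proof -
    assume b: "b = fwd w" "set w \<subseteq> I" "b \<in> wsp 0" "b \<noteq> 0"
    have "- cnt w = (0 :: 'i \<Rightarrow> int)"
    proof (rule weight_separation)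
      fix i assume i: "i \<in> I"
      have "sv (ev (- cnt w) i) b = sv (ev 0 i) b"
        using wspD[OF fwd_wsp[OF b(2)] i] wspD[OF b(3) i] b(1) by simp
      then have "of_int (rho_pair I a (- cnt w) i) = (of_int (rho_pair I a 0 i) :: complex)"
        using b(4) by (simp add: ev_def)
      then show "rho_pair I a (- cnt w) i = rho_pair I a 0 i" by (simp only: of_int_eq_iff)
    qed (simp_all add: lattice_minus[OF cnt_lattice[OF b(2)]])
    then have "w = []" using cnt_zero[of w] by (metis neg_equal_0_iff_equal)
    then show "b = v0" using b by simp
  qed
  have "B \<inter> wsp 0 \<subseteq> {v0}"
  proof
    fix b assume b: "b \<in> B \<inter> wsp 0"
    then have "b \<noteq> 0" using B.indB vv.dependent_zero by auto
    then show "b \<in> {v0}" using eq b B(2) by (auto simp: fwords_def)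
  qed
  moreover have "v \<in> vv.span (B \<inter> wsp 0)"
    by (rule wsp_in_span[OF B(1) _ assms(2,1)]) (use B(2) fwd_wsp in \<open>unfold fwords_def, blast\<close>)
  ultimately show ?thesis using vv.span_mono by blast
qed

lemma v0_wsp: "v0 \<in> wsp 0"
  using fwd_wsp[of "[]"] by simp

end

locale irr = hwm sg br C I a e f t sv ac M lam v0
  for sg :: "complex \<Rightarrow> 'g::ab_group_add \<Rightarrow> 'g" and br :: "'g \<Rightarrow> 'g \<Rightarrow> 'g" and C :: "'g set"
    and I :: "'i set" and a :: "'i \<Rightarrow> 'i \<Rightarrow> int" and e f t :: "'i \<Rightarrow> 'g"
    and sv :: "complex \<Rightarrow> 'v::ab_group_add \<Rightarrow> 'v" and ac :: "'g \<Rightarrow> 'v \<Rightarrow> 'v" and M :: "'v set"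
    and lam :: "'i \<Rightarrow> complex" and v0 :: 'v +
  assumes irreducible: "vv.subspace W \<Longrightarrow> W \<subseteq> M \<Longrightarrow> (\<And>x w. x \<in> C \<Longrightarrow> w \<in> W \<Longrightarrow> ac x w \<in> W) \<Longrightarrow>
    W = {0} \<or> W = M"
begin

lemma span_fwords: "vv.span fwords = M"
proof -
  have v0: "v0 \<in> vv.span fwords"
    unfolding fwords_def by (rule vv.span_base) (auto intro: exI[of _ "[]"])
  have "vv.span fwords = {0} \<or> vv.span fwords = M"
    by (rule irreducible[OF vv.subspace_span]) (use fwords_M subM fwords_stable in \<open>auto simp: vv.span_minimal\<close>)
  then show ?thesis using v0 v0_nz by auto
qed

lemma wsp_0: "wsp 0 = vv.span {v0}"
proof
  show "wsp 0 \<subseteq> vv.span {v0}" using fwords_top span_fwords wsp_M by auto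
  show "vv.span {v0} \<subseteq> wsp 0" using v0_wsp subspace_wsp by (intro vv.span_minimal) auto
qed

lemma weight_basis:
  assumes "W \<subseteq> M" "vv.span W = M" "\<And>w. w \<in> W \<Longrightarrow> \<exists>n\<in>lattice I. w \<in> wsp n"
  obtains B wt where "wmod sg br C I a e f t sv ac M lam B wt" "B \<subseteq> W"
proof -
  obtain F where F: "finite F" "vv.span F = M" using fdM unfolding finite_dim_def by auto
  obtain B where B: "fbasis sv B M" "B \<subseteq> W"
    using fbasis_subset[OF vsv F(1) _ assms(1,2)] F(2) by auto
  interpret fbasis sv B M by fact
  obtain wt where "\<And>w. w \<in> W \<Longrightarrow> wt w \<in> lattice I \<and> w \<in> wsp (wt w)" using assms(3) by metis
  then have "wmod sg br C I a e f t sv ac M lam B wt"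
    using B(2) by unfold_locales auto
  then show thesis using that B by blast
qed

lemma fwords_weight: "w \<in> fwords \<Longrightarrow> \<exists>n\<in>lattice I. w \<in> wsp n"
  using fwd_wsp cnt_lattice lattice_minus unfolding fwords_def by blast

lemma weight_nonpos:
  assumes "v \<in> wsp n" "v \<noteq> 0" "n \<in> lattice I"
  shows "n j \<le> 0"
proof -
  obtain B wt where B: "wmod sg br C I a e f t sv ac M lam B wt" "B \<subseteq> fwords"
    using weight_basis[OF fwords_M span_fwords fwords_weight] by metis
  interpret wmod sg br C I a e f t sv ac M lam B wt by fact
  obtain b where b: "b \<in> B" "wt b = n" using wsp_wt[OF assms] by auto
  then obtain w where w: "b = fwd w" "set w \<subseteq> I" using B(2) by (auto simp: fwords_def)
  have "b \<noteq> 0" using indB vv.dependent_zero b by metis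
  then have "n = - cnt w"
    using wsp_unique[of b n "- cnt w"] wt_wsp[OF b(1)] b(2) fwd_wsp[OF w(2)] w(1) assms(3)
      cnt_lattice[OF w(2)] lattice_minus by auto
  then show ?thesis by (simp add: cnt_nonneg)
qed

end

section \<open>Dual bases for the Killing form and the Casimir operator\<close>

context chev begin

lemma kf_zero_left: "kf 0 y = 0" and kf_zero_right: "kf y 0 = 0"
  using kf_scale_left[of 0 0 y] kf_scale_right[of y 0 0] by simp_all

lemma kf_sum_left: "kf (\<Sum>i\<in>A. g i) y = (\<Sum>i\<in>A. kf (g i) y)"
  by (induction A rule: infinite_finite_induct) (simp_all add: kf_add_left kf_zero_left)

lemma kf_sum_right: "kf y (\<Sum>i\<in>A. g i) = (\<Sum>i\<in>A. kf y (g i))"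
  by (induction A rule: infinite_finite_induct) (simp_all add: kf_add_right kf_zero_right)

lemma kf_diff_left: "kf (x - y) z = kf x z - kf y z"
  using kf_add_left[of "x - y" y z] by simp

lemma kf_minus_left: "kf (- x) z = - kf x z"
  using kf_scale_left[of "-1" x z] by simp

text \<open>The radical is an ideal, and it misses \<open>e i\<close> because
  \<open>kf (e i) (f i)\<close> is positive.\<close>

lemma kf_nondegenerate:
  assumes "x \<in> C" "\<And>y. y \<in> C \<Longrightarrow> kf x y = 0"
  shows "x = 0"
proof -
  let ?R = "{x \<in> C. \<forall>y\<in>C. kf x y = 0}"
  have "?R = {0} \<or> ?R = C"
  proof (rule simple)
    show "vg.subspace ?R" using subC
      by (auto simp: vg.subspace_def kf_add_left kf_scale_left kf_zero_left)
    show "br x y \<in> ?R" if "x \<in> C" "y \<in> ?R" for x y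
    proof -
      have "kf (br x y) z = - kf y (br x z)" for z
        by (simp only: br_anti[of x y] kf_minus_left kf_invariant)
      then show ?thesis using that by (simp add: br_C)
    qed
  qed auto
  moreover obtain i where i: "i \<in> I" using neI by auto
  then have "e i \<notin> ?R" using fC[OF i] kf_ef[OF i] cK_pos[OF i] by (auto intro!: bexI[of _ "f i"])
  ultimately have "?R = {0}" using eC[OF i] by blast
  then show ?thesis using assms by blast
qed

lemma kf_eqI:
  assumes "x \<in> C" "y \<in> C" "\<And>b. b \<in> adB \<Longrightarrow> kf x b = kf y b"
  shows "x = y"
proof -
  have "kf (x - y) z = 0" if "z \<in> C" for z
    by (subst adw.expand[OF that]) (simp add: kf_sum_right kf_scale_right kf_diff_left assms(3))
  then have "x - y = 0" using assms subC by (intro kf_nondegenerate) (auto intro: vg.subspace_diff)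
  then show ?thesis by simp
qed

text \<open>The map \<open>T\<close> that records the pairings with \<open>adB\<close> is injective
  by nondegeneracy, hence onto; the dual vector is a preimage of \<open>b\<close>.\<close>

lemma dual_exists: assumes "b \<in> adB" shows "\<exists>x\<in>C. \<forall>c\<in>adB. kf x c = (if b = c then 1 else 0)"
proof -
  define T where "T = (\<lambda>x. \<Sum>c\<in>adB. sg (kf x c) c)"
  have coord: "adw.coord c (T x) = kf x c" if "c \<in> adB" for c x
    using that adw.finB by (simp add: T_def adw.coord_sum adw.coord_scale adw.coord_basis if_distrib cong: if_cong)
  obtain x where x: "x \<in> C" "T x = b"
  proof (rule adw.injective_imp_surjective[of T b])
    show "lin sg T" by (simp add: lin_def T_def kf_add_left kf_scale_left vg.scale_left_distrib
          sum.distrib vg.scale_sum_right)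
    show "T v \<in> C" for v unfolding T_def using subC adw.B_sub
      by (intro vg.subspace_sum vg.subspace_scale) auto
    show "v = 0" if "v \<in> C" "T v = 0" for v
      by (rule kf_eqI[OF that(1)]) (use coord[of _ v] that(2) subC in \<open>auto simp: vg.subspace_0 kf_zero_left adw.coord_zero\<close>)
    show "b \<in> C" using assms adw.B_sub by auto
  qed
  show ?thesis
  proof (rule bexI[OF _ x(1)], rule ballI)
    fix c assume c: "c \<in> adB"
    show "kf x c = (if b = c then 1 else 0)"
      using coord[OF c, of x] x(2) adw.coord_basis[OF assms, of c] by auto
  qed
qed

definition dual :: "'g \<Rightarrow> 'g" where
  "dual b = (SOME x. x \<in> C \<and> (\<forall>c\<in>adB. kf x c = (if b = c then 1 else 0)))"

lemma dual: assumes "b \<in> adB" shows "dual b \<in> C" "\<And>c. c \<in> adB \<Longrightarrow> kf (dual b) c = (if b = c then 1 else 0)"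
proof -
  have "\<exists>x. x \<in> C \<and> (\<forall>c\<in>adB. kf x c = (if b = c then 1 else 0))" using dual_exists[OF assms] by blast
  from someI_ex[OF this] show "dual b \<in> C" "\<And>c. c \<in> adB \<Longrightarrow> kf (dual b) c = (if b = c then 1 else 0)"
    unfolding dual_def by auto
qed

lemma coord_dual: assumes "y \<in> C" "b \<in> adB" shows "kf (dual b) y = adw.coord b y"
proof -
  have "kf (dual b) y = (\<Sum>c\<in>adB. adw.coord c y * kf (dual b) c)"
    by (subst adw.expand[OF assms(1)]) (simp add: kf_sum_right kf_scale_right)
  also have "\<dots> = (\<Sum>c\<in>adB. if c = b then adw.coord c y else 0)"
    using dual[OF assms(2)] by (intro sum.cong) auto
  finally show ?thesis using adw.finB assms(2) by simp
qed

lemma expand_dual: assumes "y \<in> C" shows "y = (\<Sum>b\<in>adB. sg (kf y b) (dual b))"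
proof (rule kf_eqI[OF assms])
  show "(\<Sum>b\<in>adB. sg (kf y b) (dual b)) \<in> C"
    using subC dual by (intro vg.subspace_sum vg.subspace_scale) auto
  fix c assume c: "c \<in> adB"
  have "kf (\<Sum>b\<in>adB. sg (kf y b) (dual b)) c = (\<Sum>b\<in>adB. if b = c then kf y b else 0)"
    unfolding kf_sum_left using dual c by (intro sum.cong) (auto simp: kf_scale_left)
  then show "kf y c = kf (\<Sum>b\<in>adB. sg (kf y b) (dual b)) c" using adw.finB c by simp
qed

lemma dual_rsp: assumes "b \<in> adB" shows "dual b \<in> rsp (- adwt b)"
proof -
  have "br (t i) (dual b) = sg (- of_int (rho_pair I a (adwt b) i)) (dual b)" if i: "i \<in> I" for i
  proof (rule kf_eqI)
    show "sg (- of_int (rho_pair I a (adwt b) i)) (dual b) \<in> C"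
      using subC dual[OF assms] by (intro vg.subspace_scale)
    fix c assume c: "c \<in> adB"
    have "kf (br (t i) (dual b)) c = - kf (dual b) (br (t i) c)"
      by (simp add: br_anti[of "t i" "dual b"] kf_minus_left kf_invariant)
    then show "kf (br (t i) (dual b)) c = kf (sg (- of_int (rho_pair I a (adwt b) i)) (dual b)) c"
      using br_t_adB[OF i c] dual(2)[OF assms c] by (simp add: kf_scale_right kf_scale_left kf_minus_left)
  qed (rule br_C)
  then show ?thesis using dual[OF assms] by (simp add: rsp_def rho_pair_minus)
qed

end

context chev_mod begin

definition casimir :: "'v \<Rightarrow> 'v" where
  "casimir v = (\<Sum>b\<in>adB. ac (dual b) (ac b v))"

text \<open>By invariance the matrices of \<open>br x\<close> on the basis and on the dual basis are
  negative transposes of each other, so the two double sums cancel.\<close>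

lemma casimir_comm: assumes x: "x \<in> C" shows "ac x (casimir v) = casimir (ac x v)"
proof -
  have 1: "ac (br x (dual b)) u = (\<Sum>c\<in>adB. sv (- kf (dual b) (br x c)) (ac (dual c) u))" if "b \<in> adB" for b u
  proof -
    have "br x (dual b) = (\<Sum>c\<in>adB. sg (kf (br x (dual b)) c) (dual c))" by (rule expand_dual[OF br_C])
    also have "\<dots> = (\<Sum>c\<in>adB. sg (- kf (dual b) (br x c)) (dual c))"
      by (simp add: br_anti[of x "dual b"] kf_minus_left kf_invariant)
    finally have "br x (dual b) = \<dots>" .
    then show ?thesis by (simp only: ac_sum_left ac_scale_left)
  qed
  have 2: "ac (br x b) u = (\<Sum>c\<in>adB. sv (kf (dual c) (br x b)) (ac c u))" for b u
  proof -
    have "br x b = (\<Sum>c\<in>adB. sg (adw.coord c (br x b)) c)" by (rule adw.expand[OF br_C])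
    also have "\<dots> = (\<Sum>c\<in>adB. sg (kf (dual c) (br x b)) c)"
      by (intro sum.cong) (simp_all add: coord_dual br_C)
    finally have "ac (br x b) u = ac \<dots> u" by (rule arg_cong)
    then show ?thesis by (simp only: ac_sum_left ac_scale_left)
  qed
  have "ac x (casimir v) - casimir (ac x v) =
      (\<Sum>b\<in>adB. ac (br x (dual b)) (ac b v)) + (\<Sum>b\<in>adB. ac (dual b) (ac (br x b) v))"
    by (simp add: casimir_def ac_sum_right ac_swap[of x] ac_add_right sum.distrib)
  also have "(\<Sum>b\<in>adB. ac (br x (dual b)) (ac b v)) =
      (\<Sum>b\<in>adB. \<Sum>c\<in>adB. sv (- kf (dual b) (br x c)) (ac (dual c) (ac b v)))"
    by (intro sum.cong refl 1)
  also have "\<dots> = (\<Sum>c\<in>adB. \<Sum>b\<in>adB. sv (- kf (dual b) (br x c)) (ac (dual c) (ac b v)))"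
    by (rule sum.swap)
  also have "(\<Sum>b\<in>adB. ac (dual b) (ac (br x b) v)) =
      (\<Sum>b\<in>adB. \<Sum>c\<in>adB. sv (kf (dual c) (br x b)) (ac (dual b) (ac c v)))"
    by (simp add: 2 ac_sum_right ac_scale_right)
  finally show ?thesis by (simp add: sum_negf)
qed

lemma lin_casimir: "lin sv casimir"
  by (simp add: lin_def casimir_def ac_add_right ac_scale_right sum.distrib vv.scale_sum_right)

lemma casimir_wsp: assumes "v \<in> wsp n" shows "casimir v \<in> wsp n"
  unfolding casimir_def
proof (rule vv.subspace_sum[OF subspace_wsp])
  fix b assume b: "b \<in> adB"
  have "ac (dual b) (ac b v) \<in> wsp (n + adwt b + - adwt b)"
    using b adwt assms by (intro ac_wsp dual_rsp) auto
  then show "ac (dual b) (ac b v) \<in> wsp n" by simp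
qed

end

context irr begin

text \<open>The operator preserves the one-dimensional top weight space; the eigenspace of the
  resulting eigenvalue is a submodule containing \<open>v0\<close>.\<close>

lemma casimir_scalar: obtains c where "\<And>v. v \<in> M \<Longrightarrow> casimir v = sv c v"
proof -
  have "casimir v0 \<in> wsp 0" using casimir_wsp v0_wsp by blast
  then obtain c where c: "casimir v0 = sv c v0" unfolding wsp_0 by (auto simp: vv.span_singleton)
  let ?W = "{v \<in> M. casimir v = sv c v}"
  have lin: "casimir (v + w) = casimir v + casimir w" "casimir (sv k v) = sv k (casimir v)" for v w k
    using lin_casimir by (auto simp: lin_def)
  have "?W = {0} \<or> ?W = M"
  proof (rule irreducible)
    show "vv.subspace ?W" using subM lin(2)[of 0 0]
      by (auto simp: vv.subspace_def lin vv.scale_right_distrib mult.commute)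
    show "ac x w \<in> ?W" if "x \<in> C" "w \<in> ?W" for x w
      using that casimir_comm[of x w] by (auto simp: ac_M ac_scale_right)
  qed auto
  moreover have "v0 \<in> ?W" using v0M c by simp
  ultimately have "?W = M" using v0_nz by blast
  then show thesis using that by blast
qed

end

text \<open>By Bezout, a point fixed by two coprime powers is fixed by \<open>g\<close>. Thus orbits
  of a cyclic group of prime order have one element or full length.\<close>

lemma funpow_prime_fixed:
  assumes "prime d" "0 < m" "m < d" "(g ^^ d) x = x" "(g ^^ m) x = x"
  shows "g x = x"
proof -
  have mult: "(g ^^ (k * n)) x = x" if "(g ^^ n) x = x" for k n
    using that by (induction k) (simp_all add: funpow_add)
  have "coprime m d"
    using assms prime_imp_coprime[of d m] by (metis coprime_commute nat_dvd_not_less)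
  then obtain u v where uv: "u * m = v * d + 1"
    using coprime_bezout_strong[of m d] assms by (metis mult.commute prime_nat_iff less_irrefl)
  have "x = (g ^^ (u * m)) x" using mult[OF assms(5)] by simp
  also have "\<dots> = g x" unfolding uv using mult[OF assms(4)] by simp
  finally show ?thesis by simp
qed

section \<open>Diagram automorphisms\<close>

text \<open>The symmetrizer \<open>D\<close> is kept abstract because it is 1 for the simply-laced
  algebra and the orbit size for the dual of the folded one. The assumption \<open>orth\<close> says
  that distinct vertices of an orbit are not linked.\<close>

locale twist = chev sg br C I a e f t
  for sg :: "complex \<Rightarrow> 'g::ab_group_add \<Rightarrow> 'g" and br :: "'g \<Rightarrow> 'g \<Rightarrow> 'g" and C :: "'g set"
    and I :: "'i set" and a :: "'i \<Rightarrow> 'i \<Rightarrow> int" and e f t :: "'i \<Rightarrow> 'g" +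
  fixes p :: "'i \<Rightarrow> 'i" and \<sigma> :: "'g \<Rightarrow> 'g" and d :: nat and D :: "'i \<Rightarrow> real"
  assumes p_perm: "p permutes I" and a_p: "i \<in> I \<Longrightarrow> j \<in> I \<Longrightarrow> a (p i) (p j) = a i j"
    and lin_\<sigma>: "lin sg \<sigma>" and \<sigma>_C: "x \<in> C \<Longrightarrow> \<sigma> x \<in> C" and \<sigma>_br: "\<sigma> (br x y) = br (\<sigma> x) (\<sigma> y)"
    and \<sigma>_e: "i \<in> I \<Longrightarrow> \<sigma> (e i) = e (p i)" and \<sigma>_f: "i \<in> I \<Longrightarrow> \<sigma> (f i) = f (p i)"
    and prime_d: "prime d" and \<sigma>_d: "x \<in> C \<Longrightarrow> (\<sigma> ^^ d) x = x"
    and D_pos: "i \<in> I \<Longrightarrow> D i > 0" and D_sym: "i \<in> I \<Longrightarrow> j \<in> I \<Longrightarrow> D i * of_int (a i j) = D j * of_int (a j i)"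
    and D_p: "i \<in> I \<Longrightarrow> D (p i) = D i"
    and orth: "i \<in> I \<Longrightarrow> (inv p ^^ k) i \<noteq> i \<Longrightarrow> a i ((inv p ^^ k) i) = 0"
begin

abbreviation q :: "'i \<Rightarrow> 'i" where "q \<equiv> inv p"

abbreviation ar :: "('i \<Rightarrow> int) \<Rightarrow> 'i \<Rightarrow> int" where "ar \<equiv> rho_pair I a"

lemma p_I: "i \<in> I \<Longrightarrow> p i \<in> I" and q_I: "i \<in> I \<Longrightarrow> q i \<in> I"
  using permutes_in_image[OF p_perm] permutes_in_image[OF permutes_inv[OF p_perm]] by auto

lemma pq [simp]: "p (q i) = i" and qp [simp]: "q (p i) = i"
  using permutes_inverses[OF p_perm] by auto

lemma q_pow_I: "i \<in> I \<Longrightarrow> (q ^^ k) i \<in> I"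
  by (induction k) (auto intro: q_I)

definition pact :: "('i \<Rightarrow> int) \<Rightarrow> 'i \<Rightarrow> int" where
  "pact r = (\<lambda>j. r (q j))"

lemma pact_pow: "(pact ^^ k) r = (\<lambda>j. r ((q ^^ k) j))"
  by (induction k) (simp_all add: pact_def funpow_swap1)

lemma pact_add: "pact (r + s) = pact r + pact s"
  and pact_diff: "pact (r - s) = pact r - pact s"
  and pact_minus: "pact (- r) = - pact r"
  and pact_zero: "pact 0 = 0"
  by (simp_all add: pact_def fun_eq_iff)

lemma pact_alp: "pact (alp i) = alp (p i)"
  by (auto simp: pact_def alp_def fun_eq_iff)

lemma pact_lattice: "r \<in> lattice I \<Longrightarrow> pact r \<in> lattice I"
  using p_I by (force simp: lattice_def pact_def)

lemma pact_pow_lattice: "r \<in> lattice I \<Longrightarrow> (pact ^^ k) r \<in> lattice I"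
  by (induction k) (auto intro: pact_lattice)

lemma rho_pact: assumes "i \<in> I" shows "ar (pact r) i = ar r (q i)"
proof -
  have "ar (pact r) i = (\<Sum>j\<in>I. a i (p j) * pact r (p j))"
    unfolding rho_pair_def using sum.permute[OF p_perm, of "\<lambda>j. a i j * pact r j"] by (simp add: o_def)
  also have "\<dots> = (\<Sum>j\<in>I. a (q i) j * r j)"
    using a_p[of "q i"] assms q_I by (intro sum.cong) (auto simp: pact_def)
  finally show ?thesis by (simp add: rho_pair_def)
qed

lemma rho_pact_pow: "i \<in> I \<Longrightarrow> ar ((pact ^^ k) r) i = ar r ((q ^^ k) i)"
proof (induction k arbitrary: i)
  case (Suc k)
  have "ar ((pact ^^ Suc k) r) i = ar ((pact ^^ k) r) (q i)" using rho_pact[OF Suc.prems] by simp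
  also have "\<dots> = ar r ((q ^^ k) (q i))" by (rule Suc.IH[OF q_I[OF Suc.prems]])
  finally show ?case by (simp only: funpow_Suc_right o_apply)
qed simp

lemma \<sigma>_scale: "\<sigma> (sg c x) = sg c (\<sigma> x)" and \<sigma>_add: "\<sigma> (x + y) = \<sigma> x + \<sigma> y"
  using lin_\<sigma> by (auto simp: lin_def)

lemma \<sigma>_t: "i \<in> I \<Longrightarrow> \<sigma> (t i) = t (p i)"
  using \<sigma>_br[of "e i" "f i"] by (simp add: br_ef \<sigma>_e \<sigma>_f p_I)

lemma \<sigma>_rsp: assumes "x \<in> rsp r" shows "\<sigma> x \<in> rsp (pact r)"
proof -
  have "br (t i) (\<sigma> x) = sg (of_int (ar (pact r) i)) (\<sigma> x)" if i: "i \<in> I" for i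
  proof -
    have "br (t i) (\<sigma> x) = \<sigma> (br (t (q i)) x)" using i by (simp add: \<sigma>_br \<sigma>_t q_I)
    also have "\<dots> = sg (of_int (ar r (q i))) (\<sigma> x)" using rspD[OF assms q_I[OF i]] by (simp add: \<sigma>_scale)
    finally show ?thesis using i by (simp add: rho_pact)
  qed
  then show ?thesis using rsp_C[OF assms] by (simp add: rsp_def \<sigma>_C)
qed

lemma \<sigma>_pow_rsp: "x \<in> rsp r \<Longrightarrow> (\<sigma> ^^ k) x \<in> rsp ((pact ^^ k) r)"
  by (induction k) (auto intro: \<sigma>_rsp)

lemma p_pow_e: "i \<in> I \<Longrightarrow> (p ^^ k) i \<in> I \<and> (\<sigma> ^^ k) (e i) = e ((p ^^ k) i)"
  by (induction k) (auto simp: \<sigma>_e p_I)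

lemma p_d: "(p ^^ d) i = i"
proof (cases "i \<in> I")
  case True
  have "e i = e ((p ^^ d) i)" using p_pow_e[OF True, of d] \<sigma>_d[OF eC[OF True]] by simp
  moreover have I: "(p ^^ d) i \<in> I" using p_pow_e[OF True] by simp
  ultimately have "alp i = (alp ((p ^^ d) i) :: 'i \<Rightarrow> int)"
    using rsp_unique[of "e i"] e_rsp[OF True] e_rsp[OF I] e_nonzero[OF True] lattice_alp True by metis
  then have "alp i i = (alp ((p ^^ d) i) i :: int)" by simp
  then show ?thesis by (simp add: alp_def split: if_splits)
next
  case False
  then have "p i = i" using p_perm by (simp add: permutes_def)
  then have "(p ^^ k) i = i" for k by (induction k) simp_all
  then show ?thesis by simp
qed

lemma q_d: "(q ^^ d) i = i"
proof -
  have "(p ^^ k) ((q ^^ k) i) = i" for k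
  proof (induction k arbitrary: i)
    case (Suc k)
    have "(p ^^ Suc k) ((q ^^ Suc k) i) = p ((p ^^ k) ((q ^^ k) (q i)))" by (simp add: funpow_swap1)
    then show ?case using Suc by simp
  qed simp
  then show ?thesis using p_d by metis
qed

lemma pact_d: "(pact ^^ d) r = r"
  by (simp add: pact_pow q_d)

lemma d_pos: "d > 0"
  using prime_d prime_gt_0_nat by blast

definition orb :: "'i \<Rightarrow> 'i set" where
  "orb i = (\<lambda>k. (q ^^ k) i) ` {..<d}"

lemma q_pow_mod: "(q ^^ k) i = (q ^^ (k mod d)) i"
proof -
  have *: "(q ^^ (d * m)) j = j" for m j by (induction m) (simp_all add: funpow_add q_d)
  have "(q ^^ k) i = (q ^^ (d * (k div d) + k mod d)) i" by simp
  also have "\<dots> = (q ^^ (k mod d)) i" unfolding funpow_add o_apply * ..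
  finally show ?thesis .
qed

lemma orb_pow: "(q ^^ k) i \<in> orb i"
  unfolding orb_def by (rule image_eqI[where x = "k mod d"]) (use q_pow_mod d_pos in auto)

lemma orb_self: "i \<in> orb i"
  using orb_pow[of 0 i] by simp

lemma orb_I: "i \<in> I \<Longrightarrow> orb i \<subseteq> I"
  using q_pow_I by (auto simp: orb_def)

lemma orbE: assumes "j \<in> orb i" obtains k where "k < d" "j = (q ^^ k) i"
  using assms unfolding orb_def by blast

lemma orb_q: assumes "j \<in> orb i" shows "(q ^^ k) j \<in> orb i"
proof -
  obtain l where "j = (q ^^ l) i" by (rule orbE[OF assms])
  then have "(q ^^ k) j = (q ^^ (k + l)) i" by (simp only: funpow_add o_apply)
  then show ?thesis using orb_pow by metis
qed

lemma orb_connected: assumes "j \<in> orb i" shows "\<exists>k. i = (q ^^ k) j"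
proof -
  obtain k where k: "k < d" "j = (q ^^ k) i" using orbE[OF assms] by metis
  have "(q ^^ (d - k)) j = (q ^^ (d - k + k)) i" using k by (simp only: funpow_add o_apply)
  then have "(q ^^ (d - k)) j = i" using k q_d by simp
  then show ?thesis by metis
qed

lemma orb_eq: assumes "j \<in> orb i" shows "orb j = orb i"
proof -
  obtain k where "i = (q ^^ k) j" using orb_connected[OF assms] by blast
  then have ij: "i \<in> orb j" using orb_pow by simp
  have "orb k \<subseteq> orb l" if "k \<in> orb l" for k l
    using orb_q[OF that] by (auto elim!: orbE)
  then show ?thesis using ij assms by blast
qed

lemma orb_orth: assumes "i \<in> I" "j \<in> orb i" "k \<in> orb i" "j \<noteq> k" shows "a j k = 0"
proof -
  have "k \<in> orb j" using orb_eq[OF assms(2)] assms(3) by simp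
  then obtain m where m: "k = (q ^^ m) j" by (auto elim: orbE)
  have "j \<in> I" using assms orb_I by blast
  then show ?thesis using orth[of j m] assms(4) m by simp
qed

lemma finite_orb: "finite (orb i)"
  by (simp add: orb_def)

text \<open>For vertices \<open>A\<close> inside one orbit this is the product of their simple
  reflections, in closed form because they are orthogonal. Over a whole orbit it commutes with
  \<open>pact\<close> and plays the role of a simple reflection of the folded root system.\<close>

definition sO :: "'i set \<Rightarrow> ('i \<Rightarrow> int) \<Rightarrow> 'i \<Rightarrow> int" where
  "sO A r = (\<lambda>j. r j - (if j \<in> A then ar r j else 0))"

lemma sO_insert:
  assumes "i \<in> I" "insert j A \<subseteq> orb i" "j \<notin> A"
  shows "sO (insert j A) r = srefl I a j (sO A r)" "ar (sO A r) j = ar r j"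
proof -
  have "ar (sO A r) j = (\<Sum>k\<in>I. a j k * r k - (if k \<in> A then a j k * ar r k else 0))"
    unfolding rho_pair_def[of I a "sO A r"] by (intro sum.cong) (auto simp: sO_def algebra_simps)
  also have "\<dots> = ar r j - (\<Sum>k\<in>I. if k \<in> A then a j k * ar r k else 0)"
    by (simp add: sum_subtractf rho_pair_def)
  also have "(\<Sum>k\<in>I. if k \<in> A then a j k * ar r k else 0) = 0"
    using assms orb_orth[OF assms(1), of j] by (intro sum.neutral) auto
  finally show eq: "ar (sO A r) j = ar r j" by simp
  show "sO (insert j A) r = srefl I a j (sO A r)"
    using assms(3) unfolding srefl_def eq by (auto simp: sO_def alp_def fun_eq_iff)
qed

lemma sO_minus: "sO A (- r) = - sO A r" and sO_diff: "sO A (r - s) = sO A r - sO A s"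
  and sO_add: "sO A (r + s) = sO A r + sO A s" and sO_empty: "sO {} r = r"
  by (auto simp: sO_def fun_eq_iff rho_pair_minus rho_pair_diff rho_pair_add)

lemma q_orb_iff: "q j \<in> orb i \<longleftrightarrow> j \<in> orb i"
proof
  assume "q j \<in> orb i"
  moreover have "(q ^^ (d - 1)) (q j) = j"
    using q_d[of j] d_pos by (cases d) (simp_all add: funpow_swap1)
  ultimately show "j \<in> orb i" using orb_q[of "q j" i "d - 1"] by simp
next
  assume "j \<in> orb i"
  then show "q j \<in> orb i" using orb_q[of j i 1] by simp
qed

lemma sO_pact: assumes "i \<in> I" shows "pact (sO (orb i) r) = sO (orb i) (pact r)"
proof
  fix j show "pact (sO (orb i) r) j = sO (orb i) (pact r) j"
    using q_orb_iff[of j i] orb_I[OF assms] rho_pact[of j r] by (auto simp: pact_def sO_def)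
qed

lemma sO_pact_pow: "i \<in> I \<Longrightarrow> (pact ^^ k) (sO (orb i) r) = sO (orb i) ((pact ^^ k) r)"
  by (induction k) (simp_all add: sO_pact)

lemma rho_sO_orb: assumes "i \<in> I" "j \<in> orb i" shows "ar (sO (orb i) r) j = - ar r j"
proof -
  have eq: "sO (orb i) r = srefl I a j (sO (orb i - {j}) r)" "ar (sO (orb i - {j}) r) j = ar r j"
    using sO_insert[of i j "orb i - {j}" r] assms by (auto simp: insert_absorb)
  have j: "j \<in> I" using assms orb_I by auto
  show ?thesis unfolding eq(1) by (simp add: rho_pair_srefl finI j eq(2) a_diag)
qed

lemma sO_sO: "i \<in> I \<Longrightarrow> sO (orb i) (sO (orb i) r) = r"
proof
  fix j assume "i \<in> I"
  then show "sO (orb i) (sO (orb i) r) j = r j"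
    using rho_sO_orb[of i j r] by (subst sO_def) (auto simp: sO_def)
qed

text \<open>The reflections are applied one at a time. The intermediate root never becomes a simple
  root of the orbit: such a root is fixed by the orthogonal reflections, and its own reflection
  sends it to a negative root.\<close>

lemma sO_Rp: assumes "i \<in> I" "r \<in> Rp I a" "r \<notin> alp ` orb i" shows "sO (orb i) r \<in> Rp I a"
proof -
  have "sO A r \<in> Rp I a \<and> sO A r \<notin> alp ` orb i" if "A \<subseteq> orb i" for A
    using finite_subset[OF that finite_orb] that
  proof (induction A rule: finite_induct)
    case empty
    then show ?case using assms by (simp add: sO_empty)
  next
    case (insert j A)
    let ?s = "sO A r"
    have j: "j \<in> I" "j \<in> orb i" using insert.prems orb_I[OF assms(1)] by auto
    have s: "?s \<in> Rp I a" "?s \<notin> alp ` orb i" using insert by auto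
    have eq: "sO (insert j A) r = srefl I a j ?s" using sO_insert[OF assms(1)] insert by auto
    have R: "srefl I a j ?s \<in> Rp I a" using s j by (intro Rp_refl) auto
    moreover have "srefl I a j ?s \<noteq> alp k" if k: "k \<in> orb i" for k
    proof
      assume "srefl I a j ?s = alp k"
      then have *: "?s = srefl I a j (alp k)" using srefl_srefl[of I j a ?s] finI j a_diag by metis
      have kI: "k \<in> I" using k orb_I[OF assms(1)] by auto
      show False
      proof (cases "j = k")
        case True
        then have "?s = - alp k" using * srefl_alp[of I k a] finI kI a_diag by simp
        then have "?s k < 0" by (simp add: alp_def)
        moreover have "?s k \<ge> 0" using Rp_props[OF s(1)] by blast
        ultimately show False by simp
      next
        case False
        then have "a j k = 0" using orb_orth[OF assms(1) j(2) k] by simp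
        then have "?s = alp k" using * finI kI by (simp add: srefl_def rho_pair_alp)
        then show False using s(2) k by blast
      qed
    qed
    ultimately show ?case unfolding eq by blast
  qed
  then show ?thesis by blast
qed

lemma sO_alp: assumes "i \<in> I" "j \<in> orb i" shows "sO (orb i) (alp j) = - alp j"
proof
  fix k
  have j: "j \<in> I" using assms orb_I by auto
  have r: "ar (alp j) k = a k j" for k using rho_pair_alp[OF finI j] .
  have "alp j k = (if k = j then 1 else 0 :: int)" by (simp add: alp_def)
  then show "sO (orb i) (alp j) k = (- alp j) k"
    using assms orb_orth[OF assms(1), of k j] a_diag[OF j] unfolding sO_def r by auto
qed

lemma sO_roots: assumes "i \<in> I" "r \<in> roots" shows "sO (orb i) r \<in> roots"
proof -
  have pos: "sO (orb i) s \<in> roots" if s: "s \<in> Rp I a" for s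
  proof (cases "s \<in> alp ` orb i")
    case True
    then obtain j where j: "j \<in> orb i" "s = alp j" by auto
    have "sO (orb i) s = - s" using sO_alp[OF assms(1) j(1)] j(2) by simp
    then show ?thesis using s roots_uminus by (auto simp: roots_def)
  next
    case False
    then show ?thesis using sO_Rp[OF assms(1) s] by (simp add: roots_def)
  qed
  show ?thesis
  proof (cases "r \<in> Rp I a")
    case False
    then have "- r \<in> Rp I a" using assms(2) by (auto simp: roots_def)
    from roots_uminus[OF pos[OF this]] show ?thesis by (simp add: sO_minus)
  qed (rule pos)
qed

lemma pact_Rp: "r \<in> Rp I a \<Longrightarrow> pact r \<in> Rp I a"
proof (induction rule: Rp.induct)
  case (Rp_simple i)
  then show ?case by (simp add: pact_alp p_I Rp.Rp_simple)
next
  case (Rp_refl r i)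
  have "pact (srefl I a i r) = srefl I a (p i) (pact r)"
    using Rp_refl p_I by (auto simp: pact_def srefl_def alp_def fun_eq_iff rho_pact[unfolded pact_def])
  moreover have "pact r \<noteq> alp (p i)"
  proof
    assume "pact r = alp (p i)"
    then have "pact r = pact (alp i)" by (simp add: pact_alp)
    then have "r (q (p j)) = alp i (q (p j))" for j unfolding pact_def by (rule fun_cong)
    then show False using Rp_refl by (simp add: fun_eq_iff)
  qed
  ultimately show ?case using Rp_refl p_I by (simp add: Rp.Rp_refl)
qed

lemma pact_pow_Rp: "r \<in> Rp I a \<Longrightarrow> (pact ^^ k) r \<in> Rp I a"
  by (induction k) (auto intro: pact_Rp)

lemma roots_iff: "r \<in> roots \<longleftrightarrow> r \<in> Rp I a \<or> - r \<in> Rp I a"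
  unfolding roots_def by (metis UnCI UnE image_iff minus_minus)

definition psum :: "('i \<Rightarrow> int) \<Rightarrow> 'i \<Rightarrow> int" where
  "psum r = (\<lambda>j. \<Sum>k<d. r ((q ^^ k) j))"

lemma sum_orb: assumes "q i \<noteq> i" shows "(\<Sum>k<d. g ((q ^^ k) i)) = (\<Sum>j\<in>orb i. g j)"
proof -
  have ne: "(q ^^ k) i \<noteq> (q ^^ l) i" if kl: "k < l" "l < d" for k l
  proof
    assume "(q ^^ k) i = (q ^^ l) i"
    then have "(q ^^ (d - k)) ((q ^^ k) i) = (q ^^ (d - k)) ((q ^^ l) i)" by (rule arg_cong)
    then have "(q ^^ (d - k + k)) i = (q ^^ (d - k + l)) i" by (simp only: funpow_add o_apply)
    moreover have "d - k + l = (l - k) + d" "d - k + k = d" using kl by auto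
    ultimately have "(q ^^ d) i = (q ^^ (l - k)) ((q ^^ d) i)" by (simp only: funpow_add o_apply)
    then have "(q ^^ (l - k)) i = i" unfolding q_d by (rule sym)
    then have "q i = i" using funpow_prime_fixed[OF prime_d, of "l - k" q i] q_d[of i] kl by linarith
    then show False using assms by contradiction
  qed
  have "inj_on (\<lambda>k. (q ^^ k) i) {..<d}"
  proof (rule inj_onI)
    fix k l assume "k \<in> {..<d}" "l \<in> {..<d}" "(q ^^ k) i = (q ^^ l) i"
    then show "k = l" using ne[of k l] ne[of l k] by (cases k l rule: linorder_cases) auto
  qed
  then show ?thesis unfolding orb_def by (subst sum.reindex) auto
qed

lemma orb_fixed: assumes "q i = i" shows "orb i = {i}" "(q ^^ k) i = i"
proof -
  have "(q ^^ k) i = i" for k using assms by (induction k) simp_all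
  then show "orb i = {i}" "(q ^^ k) i = i" using d_pos by (auto simp: orb_def)
qed

text \<open>The sum of the images of \<open>r\<close> has positive square length, so it pairs
  positively with some coroot \<open>t i\<close>. That pairing is a positive multiple of the sum of
  the pairings of \<open>r\<close> over the orbit of \<open>i\<close>, which is exactly the loss of
  height under \<open>sO\<close>.\<close>

lemma Rp_reduce:
  assumes "r \<in> Rp I a" "r \<notin> alp ` I"
  obtains i where "i \<in> I" "sO (orb i) r \<in> Rp I a" "height I (sO (orb i) r) < height I r"
proof -
  note R = Rp_props[OF assms(1)]
  have L: "psum r \<in> lattice I" using R q_pow_I pact_pow_lattice[of r]
    by (auto simp: lattice_def psum_def pact_pow intro!: sum.neutral)
  have pos: "psum r j \<ge> 0" for j using R by (simp add: psum_def sum_nonneg)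
  have "psum r \<noteq> 0"
  proof -
    obtain j where j: "r j \<noteq> 0" using R by (auto simp: fun_eq_iff)
    then have "r ((q ^^ 0) j) > 0" using R by (simp add: order_less_le)
    then have "psum r j > 0" unfolding psum_def
      using R d_pos by (intro sum_pos2[of _ 0]) auto
    then show ?thesis by (metis less_irrefl zero_fun_apply)
  qed
  then have "bil I a D (psum r) (psum r) > 0" using posdef[of D "psum r"] D_sym D_pos L by blast
  then obtain i where i: "i \<in> I" "ar (psum r) i > 0"
    using positive_pairing[OF L pos] D_pos by metis
  have "ar (psum r) i = (\<Sum>k<d. ar ((pact ^^ k) r) i)"
    by (simp add: rho_pair_def psum_def pact_pow sum_distrib_left) (rule sum.swap)
  also have "\<dots> = (\<Sum>k<d. ar r ((q ^^ k) i))" using i by (simp add: rho_pact_pow)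
  finally have "(\<Sum>k<d. ar r ((q ^^ k) i)) > 0" using i by simp
  then have s: "(\<Sum>j\<in>orb i. ar r j) > 0"
    by (cases "q i = i") (simp_all add: sum_orb orb_fixed zero_less_mult_iff)
  have "height I (sO (orb i) r) = height I r - (\<Sum>j\<in>I. if j \<in> orb i then ar r j else 0)"
    by (simp add: height_def sO_def sum_subtractf)
  also have "(\<Sum>j\<in>I. if j \<in> orb i then ar r j else 0) = (\<Sum>j\<in>orb i. ar r j)"
    using orb_I[OF i(1)] finI by (simp add: sum.inter_restrict[symmetric] Int_absorb1)
  finally have "height I (sO (orb i) r) < height I r" using s by simp
  moreover have "sO (orb i) r \<in> Rp I a"
    using assms orb_I[OF i(1)] by (intro sO_Rp i) auto
  ultimately show thesis using that i by blast
qed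

text \<open>The induction reflects in whole orbits rather than single vertices, so that each step
  commutes with \<open>pact\<close> and preserves statements about a root together with its
  images.\<close>

lemma Rp_orbit_induct [consumes 1, case_names simple reduce]:
  assumes "r \<in> Rp I a" "\<And>i. i \<in> I \<Longrightarrow> P (alp i)"
    "\<And>i r. i \<in> I \<Longrightarrow> r \<in> Rp I a \<Longrightarrow> r \<notin> alp ` I \<Longrightarrow> sO (orb i) r \<in> Rp I a \<Longrightarrow> P (sO (orb i) r) \<Longrightarrow> P r"
  shows "P r"
  using assms(1)
proof (induction "nat (height I r)" arbitrary: r rule: less_induct)
  case less
  show ?case
  proof (cases "r \<in> alp ` I")
    case True
    then show ?thesis using assms(2) by auto
  next
    case False
    obtain i where i: "i \<in> I" "sO (orb i) r \<in> Rp I a" "height I (sO (orb i) r) < height I r"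
      using Rp_reduce[OF less.prems False] .
    have "nat (height I (sO (orb i) r)) < nat (height I r)"
      using i(3) height_nonneg[of "sO (orb i) r"] Rp_props[OF i(2)] by simp
    then show ?thesis using less.hyps[OF _ i(2)] assms(3)[OF i(1) less.prems False i(2)] by blast
  qed
qed

text \<open>For simple roots the difference has coefficients of both signs. Otherwise
  \<open>sO\<close> preserves roots and commutes with \<open>pact\<close>, which transports the
  claim. Consequently root vectors for \<open>r\<close> and for the negative of another root in its
  orbit commute.\<close>

lemma orbit_diff_not_root:
  assumes "r \<in> Rp I a" "(pact ^^ k) r \<noteq> r"
  shows "r - (pact ^^ k) r \<notin> roots"
  using assms
proof (induction rule: Rp_orbit_induct)
  case (simple i)
  have P: "(pact ^^ k) (alp i) = alp ((p ^^ k) i)" by (induction k) (simp_all add: pact_alp)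
  have ne: "(p ^^ k) i \<noteq> i" using simple P by auto
  let ?x = "alp i - alp ((p ^^ k) i) :: 'i \<Rightarrow> int"
  have "?x i > 0" "?x ((p ^^ k) i) < 0" using ne by (auto simp: alp_def)
  then have "?x \<notin> Rp I a" "- ?x \<notin> Rp I a" using Rp_props by (force simp: not_le[symmetric])+
  then show ?case unfolding P roots_iff by blast
next
  case (reduce i r)
  have "(pact ^^ k) (sO (orb i) r) \<noteq> sO (orb i) r"
    using reduce.prems sO_sO[OF reduce.hyps(1)] by (metis sO_pact_pow[OF reduce.hyps(1)])
  then have "sO (orb i) (r - (pact ^^ k) r) \<notin> roots"
    using reduce.IH by (simp only: sO_diff sO_pact_pow[OF reduce.hyps(1)] simp_thms)
  then show ?case using sO_roots[OF reduce.hyps(1)] by blast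
qed

lemma commuting_orbit:
  assumes "r \<in> roots" "(pact ^^ k) r \<noteq> r" "x \<in> rsp r" "y \<in> rsp (- (pact ^^ k) r)"
  shows "br x y = 0"
proof (rule ccontr)
  assume nz: "br x y \<noteq> 0"
  have "br x y \<in> rsp (- (pact ^^ k) r + r)"
    using ad.ac_wsp[of x r y "- (pact ^^ k) r"] assms by (simp only: ad_wsp)
  moreover have L: "- (pact ^^ k) r + r \<in> lattice I"
    using roots_props[OF assms(1)] by (intro lattice_add lattice_minus pact_pow_lattice)
  moreover have "- (pact ^^ k) r + r \<noteq> 0" using assms(2) by (metis add.commute diff_conv_add_uminus right_minus_eq)
  ultimately have "- (pact ^^ k) r + r \<in> roots" using root_in_roots nz by blast
  then have R: "r - (pact ^^ k) r \<in> roots" by (simp only: diff_conv_add_uminus add.commute)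
  have minus: "(pact ^^ k) (- r) = - (pact ^^ k) r" for r by (simp add: pact_pow fun_eq_iff)
  show False
  proof (cases "r \<in> Rp I a")
    case True
    then show False using orbit_diff_not_root[OF True assms(2)] R by blast
  next
    case False
    then have r: "- r \<in> Rp I a" using assms(1) by (auto simp: roots_def)
    have "(pact ^^ k) (- r) \<noteq> - r" using assms(2) by (simp add: minus)
    then have "- r - (pact ^^ k) (- r) \<notin> roots" using orbit_diff_not_root[OF r] by blast
    moreover have "- r - (pact ^^ k) (- r) = - (r - (pact ^^ k) r)" by (simp add: minus)
    ultimately show False using roots_uminus[OF R] by simp
  qed
qed

lemma \<sigma>_refl_op:
  assumes "j \<in> I"
  shows "\<sigma> (ad.refl_op j m x) = ad.refl_op (p j) m (\<sigma> x)"
proof -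
  have "\<sigma> ((br (f j) ^^ k) x) = (br (f (p j)) ^^ k) (\<sigma> x)"
    "\<sigma> ((br (e j) ^^ k) x) = (br (e (p j)) ^^ k) (\<sigma> x)" for k
    by (induction k) (simp_all add: \<sigma>_br \<sigma>_e \<sigma>_f assms)
  then show ?thesis by (simp add: ad.refl_op_def)
qed

lemma funpow_commute:
  assumes "\<And>x. F (G x) = G (F x)"
  shows "(F ^^ k) ((G ^^ l) x) = (G ^^ l) ((F ^^ k) x)"
proof -
  have *: "F ((G ^^ l) x) = (G ^^ l) (F x)" for x by (induction l) (simp_all add: assms)
  show ?thesis by (induction k) (simp_all add: *)
qed

lemma refl_op_commute:
  assumes "i \<in> I" "j \<in> orb i" "k \<in> orb i"
  shows "ad.refl_op j m \<circ> ad.refl_op k m = ad.refl_op k m \<circ> ad.refl_op j m"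
proof (cases "j = k")
  case False
  have I: "j \<in> I" "k \<in> I" using assms orb_I by auto
  have "a j k = 0" using orb_orth assms False by blast
  then have "br (e j) (e k) = 0" "br (f j) (f k) = 0" using comm_ee comm_ff I False by auto
  then have "br (e j) (br (e k) x) = br (e k) (br (e j) x)" "br (f j) (br (f k) x) = br (f k) (br (f j) x)" for x
    using ad.ac_swap[of "e j" "e k" x] ad.ac_swap[of "f j" "f k" x] by simp_all
  then show ?thesis
    using funpow_commute[of "br (e j)" "br (e k)"] funpow_commute[of "br (f j)" "br (f k)"]
    by (simp add: ad.refl_op_def fun_eq_iff)
qed simp

text \<open>On the root space of an invariant root \<open>\<sigma>\<close> is a scalar, and the
  point is that it is 1. For two linked simple roots exchanged by \<open>\<sigma>\<close> the
  bracket of their root vectors would change sign; \<open>orth\<close> rules this out. The product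
  of the reflection operators over an orbit commutes with \<open>\<sigma>\<close> and transports the
  claim.\<close>

lemma fixed_root_vector:
  assumes "r \<in> Rp I a" "pact r = r" "x \<in> rsp r"
  shows "\<sigma> x = x"
  using assms
proof (induction arbitrary: x rule: Rp_orbit_induct)
  case (simple i)
  have "alp i i = (alp (p i) i :: int)" using simple.prems(1) by (simp add: pact_alp)
  then have "p i = i" by (simp add: alp_def split: if_splits)
  moreover obtain c where "x = sg c (e i)"
    using dim1_simple[OF simple.hyps] e_rsp[OF simple.hyps] e_nonzero[OF simple.hyps] simple.prems(2)
    unfolding dim1_def by blast
  ultimately show ?case using simple.hyps by (simp add: \<sigma>_scale \<sigma>_e)
next
  case (reduce i r)
  let ?r = "sO (orb i) r"
  \<comment> \<open>An invariant root has the same pairing with all coroots of an orbit, so one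
    exponent serves every factor.\<close>
  define m where "m = ar ?r i"
  define Y where "Y = (\<lambda>js. foldr (\<lambda>j. ad.refl_op j m) js)"
  have inv: "pact ?r = ?r" using reduce by (simp add: sO_pact)
  then have inv_pow: "(pact ^^ k) ?r = ?r" for k by (induction k) simp_all
  have m: "ar ?r j = m" if "j \<in> orb i" for j
    using that rho_pact_pow[OF reduce.hyps(1), of _ ?r] inv_pow by (auto simp: m_def elim!: orbE)
  have Y: "Y js x \<in> rsp (sO (set js) ?r) \<and> (x \<noteq> 0 \<longrightarrow> Y js x \<noteq> 0)"
    if "distinct js" "set js \<subseteq> orb i" "x \<in> rsp ?r" for js x
    using that
  proof (induction js)
    case Nil
    then show ?case by (simp add: Y_def sO_empty)
  next
    case (Cons j js)
    have j: "j \<in> orb i" "j \<in> I" using Cons.prems orb_I[OF reduce.hyps(1)] by auto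
    have s: "sO (insert j (set js)) ?r = srefl I a j (sO (set js) ?r)" "ar (sO (set js) ?r) j = m"
      using sO_insert[OF reduce.hyps(1), of j "set js" ?r] Cons.prems m[OF j(1)] by auto
    have "Y (j # js) x = ad.refl_op j (ar (sO (set js) ?r) j) (Y js x)"
      unfolding s(2) by (simp add: Y_def)
    then show ?case
      using rsp_refl_op[OF j(2), of "Y js x" "sO (set js) ?r"] Cons by (simp add: s(1))
  qed
  obtain js where js: "set js = orb i" "distinct js" using finite_distinct_list[OF finite_orb] by blast
  have "set (map p js) = set js"
  proof -
    have "p ` orb i = orb i" using q_orb_iff by (force simp: image_iff)
    then show ?thesis using js by simp
  qed
  moreover have "distinct (map p js)"
    using js(2) p_perm by (simp add: distinct_map permutes_inj_on)
  ultimately have "mset (map p js) = mset js" using js(2) set_eq_iff_mset_eq_distinct by blast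
  \<comment> \<open>The factors over an orbit commute, so the reordering by \<open>p\<close> is
    harmless; hence \<open>Y js\<close> commutes with \<open>\<sigma>\<close>.\<close>
  then have Yp: "Y (map p js) = Y js"
    unfolding Y_def foldr_conv_fold
    using js(1) refl_op_commute[OF reduce.hyps(1)] \<open>set (map p js) = set js\<close>
    by (intro fold_multiset_equiv) (auto simp: fun_eq_iff)
  have \<sigma>Y: "\<sigma> (Y ks x) = Y (map p ks) (\<sigma> x)" if "set ks \<subseteq> I" for ks x
    using that by (induction ks) (simp_all add: Y_def \<sigma>_refl_op)
  obtain z where z: "z \<in> rsp ?r" "z \<noteq> 0" using Rp_props[OF reduce.hyps(4)] by (auto simp: dim1_def)
  have Yz: "Y js z \<in> rsp r" "Y js z \<noteq> 0"
    using Y[of js z] z js sO_sO[OF reduce.hyps(1), of r] by auto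
  obtain c where c: "x = sg c (Y js z)"
    using Rp_props[OF reduce.hyps(2)] Yz reduce.prems(2) unfolding dim1_def by blast
  have "\<sigma> (Y js z) = Y js z"
    using \<sigma>Y[of js z] orb_I[OF reduce.hyps(1)] reduce.IH[OF inv z(1)] by (simp add: js Yp)
  then show ?case by (simp add: c \<sigma>_scale)
qed

lemma twist_opp: "twist sg br C I a f e (\<lambda>i. - t i) p \<sigma> d D"
proof -
  interpret opp: chev sg br C I a f e "\<lambda>i. - t i" by (rule chev_opp)
  show ?thesis
    by unfold_locales (simp_all add: p_perm a_p lin_\<sigma> \<sigma>_C \<sigma>_br \<sigma>_e \<sigma>_f prime_d \<sigma>_d D_pos D_sym D_p orth)
qed

lemma fixed_root_vector_all:
  assumes "r \<in> roots" "pact r = r" "x \<in> rsp r"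
  shows "\<sigma> x = x"
proof (cases "r \<in> Rp I a")
  case True
  then show ?thesis using fixed_root_vector assms by blast
next
  case False
  interpret opp: twist sg br C I a f e "\<lambda>i. - t i" p \<sigma> d D by (rule twist_opp)
  have "opp.pact (- r) = - r" using assms(2) by (simp add: opp.pact_def pact_def fun_eq_iff)
  moreover have "x \<in> opp.rsp (- r)" using assms(3) by (simp add: opp_rsp)
  ultimately show ?thesis using opp.fixed_root_vector False assms(1) roots_iff by blast
qed

end

section \<open>Cartan elements attached to roots, and the root basis\<close>

context chev begin

text \<open>The element of the Cartan subalgebra that represents \<open>r\<close> under the Killing
  form; dividing by \<open>cK i\<close> turns the coroot \<open>t i\<close> into the representative
  of \<open>alp i\<close>.\<close>

definition zr :: "('i \<Rightarrow> int) \<Rightarrow> 'g" where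
  "zr r = (\<Sum>i\<in>I. sg (of_int (r i) / of_real (cK i)) (t i))"

lemma zr_rsp: "zr r \<in> rsp 0"
  unfolding zr_def by (intro vg.subspace_sum[OF subspace_rsp] vg.subspace_scale[OF subspace_rsp] t_rsp)

lemma kf_zr_t: assumes "j \<in> I" shows "kf (zr r) (t j) = of_int (rho_pair I a r j)"
proof -
  have "kf (zr r) (t j) = (\<Sum>i\<in>I. of_int (a j i * r i))"
    unfolding zr_def kf_sum_left kf_scale_left
  proof (intro sum.cong refl)
    fix i assume i: "i \<in> I"
    have "kf (t i) (t j) = of_int (a j i) * of_real (cK i)"
      using kf_tt_ef[OF i assms] kf_tt[OF i assms] kf_ef[OF i] by simp
    then show "of_int (r i) / of_real (cK i) * kf (t i) (t j) = (of_int (a j i * r i) :: complex)"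
      using cK_pos[OF i] by simp
  qed
  then show ?thesis by (simp add: rho_pair_def)
qed

lemma kf_orth:
  assumes "x \<in> rsp r" "y \<in> rsp s" "r \<in> lattice I" "s \<in> lattice I" "r + s \<noteq> 0"
  shows "kf x y = 0"
proof -
  have "\<exists>i\<in>I. rho_pair I a (r + s) i \<noteq> rho_pair I a 0 i"
    using weight_separation[of "r + s" 0] assms lattice_add[of r I s] by auto
  then obtain i where i: "i \<in> I" "rho_pair I a r i + rho_pair I a s i \<noteq> 0"
    by (auto simp: rho_pair_add)
  have "kf (br (t i) x) y = - kf x (br (t i) y)"
    by (simp only: br_anti[of "t i" x] kf_minus_left kf_invariant)
  then have "of_int (rho_pair I a r i) * kf x y = - (of_int (rho_pair I a s i) * kf x y)"
    using rspD[OF assms(1) i(1)] rspD[OF assms(2) i(1)] by (simp add: kf_scale_left kf_scale_right)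
  then have "of_int (rho_pair I a r i + rho_pair I a s i) * kf x y = 0"
    by (simp add: distrib_right eq_neg_iff_add_eq_0)
  then show ?thesis using i(2) by (simp only: mult_eq_0_iff of_int_eq_0_iff) simp
qed

lemma span_t_expand: assumes "y \<in> vg.span (t ` I)" shows "\<exists>u. y = (\<Sum>i\<in>I. sg (u i) (t i))"
  using assms
proof (induction rule: vg.span_induct_alt)
  case base
  show ?case by (rule exI[of _ "\<lambda>_. 0"]) simp
next
  case (step c x y)
  then obtain u i where u: "y = (\<Sum>i\<in>I. sg (u i) (t i))" and i: "i \<in> I" "x = t i" by auto
  have "sg c x = (\<Sum>j\<in>I. sg (if j = i then c else 0) (t j))"
    using i finI by (simp add: if_distrib[of "\<lambda>c. sg c _"] cong: if_cong)
  then have "sg c x + y = (\<Sum>j\<in>I. sg ((if j = i then c else 0) + u j) (t j))"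
    using u by (simp add: vg.scale_left_distrib sum.distrib)
  then show ?case by (rule exI[of _ "\<lambda>j. (if j = i then c else 0) + u j"])
qed

lemma rsp0_eqI:
  assumes "x \<in> rsp 0" "y \<in> rsp 0" "\<And>j. j \<in> I \<Longrightarrow> kf x (t j) = kf y (t j)"
  shows "x = y"
proof (rule kf_eqI)
  show "x \<in> C" "y \<in> C" using assms rsp_C by auto
  fix b assume b: "b \<in> adB"
  show "kf x b = kf y b"
  proof (cases "adwt b = 0")
    case True
    then have "b \<in> rsp 0" using adwt[OF b] by metis
    then have "b \<in> vg.span (t ` I)" using rsp_0 by blast
    then obtain u where u: "b = (\<Sum>i\<in>I. sg (u i) (t i))" using span_t_expand by blast
    then show ?thesis unfolding u kf_sum_right kf_scale_right by (intro sum.cong refl arg_cong2[of _ _ _ _ "(*)"] assms(3))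
  next
    case False
    have *: "kf z b = 0" if "z \<in> rsp 0" for z
      by (rule kf_orth[OF that, of b "adwt b"]) (simp_all add: adwt[OF b] False)
    show ?thesis unfolding *[OF assms(1)] *[OF assms(2)] ..
  qed
qed

text \<open>Both sides have label 0, where an element is determined by its pairings with the
  coroots. Invariance turns the pairing with \<open>t j\<close> into an eigenvalue.\<close>

lemma bracket_dual: assumes "b \<in> adB" shows "br b (dual b) = zr (adwt b)"
proof (rule rsp0_eqI)
  have "br b (dual b) \<in> ad.wsp (- adwt b + adwt b)"
    using ad.ac_wsp[of b "adwt b" "dual b" "- adwt b"] adwt[OF assms] dual_rsp[OF assms] by (simp only: ad_wsp)
  then show "br b (dual b) \<in> rsp 0" by (simp add: ad_wsp)
  show "zr (adwt b) \<in> rsp 0" by (rule zr_rsp)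
  fix j assume j: "j \<in> I"
  have "kf (br b (dual b)) (t j) = kf b (- br (t j) (dual b))"
    by (simp only: kf_invariant br_anti[of "dual b" "t j"])
  also have "\<dots> = of_int (rho_pair I a (adwt b) j) * kf b (dual b)"
    using rspD[OF dual_rsp[OF assms] j] by (simp add: kf_scale_right rho_pair_minus)
  also have "kf b (dual b) = 1" using dual(2)[OF assms assms] kf_comm by simp
  finally show "kf (br b (dual b)) (t j) = kf (zr (adwt b)) (t j)" using kf_zr_t[OF j] by simp
qed

definition tco :: "'g \<Rightarrow> 'i \<Rightarrow> complex" where
  "tco y = (SOME u. y = (\<Sum>i\<in>I. sg (u i) (t i)))"

lemma tco: assumes "y \<in> rsp 0" shows "y = (\<Sum>i\<in>I. sg (tco y i) (t i))"
proof -
  have "y \<in> vg.span (t ` I)" using assms rsp_0 by blast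
  from someI_ex[OF span_t_expand[OF this]] show ?thesis unfolding tco_def .
qed

lemma tco_unique:
  assumes "y \<in> rsp 0" "y = (\<Sum>i\<in>I. sg (u i) (t i))" "i \<in> I"
  shows "tco y i = u i"
proof -
  have "(\<Sum>i\<in>I. sg (tco y i - u i) (t i)) = (\<Sum>i\<in>I. sg (tco y i) (t i)) - (\<Sum>i\<in>I. sg (u i) (t i))"
    by (simp add: vg.scale_left_diff_distrib sum_subtractf)
  also have "\<dots> = y - y" unfolding tco[OF assms(1), symmetric] assms(2)[symmetric] ..
  finally have "(\<Sum>i\<in>I. sg (tco y i - u i) (t i)) = 0" by simp
  then show ?thesis using t_indep[of "\<lambda>i. tco y i - u i" i] assms(3) by simp
qed

text \<open>Root spaces are one-dimensional, so basis vectors with equal nonzero labels are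
  proportional and hence equal.\<close>

lemma root_basis_inj: "inj_on adwt {b \<in> adB. adwt b \<noteq> 0}"
proof (rule inj_onI)
  fix b c assume b: "b \<in> {b \<in> adB. adwt b \<noteq> 0}" and c: "c \<in> {b \<in> adB. adwt b \<noteq> 0}" and eq: "adwt b = adwt c"
  have "b \<in> rsp (adwt b)" "adwt b \<in> lattice I" "b \<noteq> 0"
    using adwt[of b] b adB_nonzero by auto
  moreover have "c \<in> rsp (adwt b)" using adwt[of c] c unfolding eq by auto
  ultimately have rb: "b \<in> rsp (adwt b)" "adwt b \<in> lattice I" "b \<noteq> 0" "c \<in> rsp (adwt b)" by auto
  then have "adwt b \<in> roots" using root_in_roots b by blast
  then obtain k where k: "c = sg k b" using roots_props(3) rb unfolding dim1_def by blast
  show "b = c"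
  proof (rule ccontr)
    assume "b \<noteq> c"
    then have "adw.coord c c = 0" using adw.coord_basis[of b c] b by (subst (2) k) (simp add: adw.coord_scale)
    then show False using adw.coord_basis[of c c] c by simp
  qed
qed

lemma root_basis_image: "adwt ` {b \<in> adB. adwt b \<noteq> 0} = roots"
proof
  show "adwt ` {b \<in> adB. adwt b \<noteq> 0} \<subseteq> roots"
    using adwt adB_nonzero root_in_roots by blast
  show "roots \<subseteq> adwt ` {b \<in> adB. adwt b \<noteq> 0}"
  proof
    fix r assume r: "r \<in> roots"
    obtain x where "x \<in> rsp r" "x \<noteq> 0" using roots_props(3)[OF r] unfolding dim1_def by blast
    then have "r \<in> adwt ` adB" using adw.wsp_wt[of x r] roots_props[OF r] by (simp add: ad_wsp)
    then show "r \<in> adwt ` {b \<in> adB. adwt b \<noteq> 0}" using roots_props(2)[OF r] by blast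
  qed
qed

definition rb :: "('i \<Rightarrow> int) \<Rightarrow> 'g" where
  "rb = inv_into {b \<in> adB. adwt b \<noteq> 0} adwt"

lemma rb: "r \<in> roots \<Longrightarrow> rb r \<in> adB \<and> adwt (rb r) = r"
  using inv_into_into[of r adwt "{b \<in> adB. adwt b \<noteq> 0}"] f_inv_into_f[of r adwt "{b \<in> adB. adwt b \<noteq> 0}"]
  unfolding root_basis_image rb_def by auto

lemma sum_root_basis: "(\<Sum>b\<in>{b \<in> adB. adwt b \<noteq> 0}. g b) = (\<Sum>r\<in>roots. g (rb r))"
  by (rule sum.reindex_bij_betw[symmetric])
     (auto simp: rb_def root_basis_image[symmetric] intro!: bij_betw_inv_into inj_on_imp_bij_betw root_basis_inj)

text \<open>The sum of the positive roots takes the value 2 on simple coroots, because \<open>s\<^sub>i\<close>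
  permutes the positive roots other than \<open>\<alpha>\<^sub>i\<close>.\<close>

lemma sum_Rp: assumes "i \<in> I" shows "(\<Sum>r\<in>Rp I a. rho_pair I a r i) = 2"
proof -
  let ?R = "Rp I a - {alp i}"
  have ss: "srefl I a i (srefl I a i r) = r" for r by (rule srefl_srefl[of I i a, OF finI assms a_diag[OF assms]])
  have s: "srefl I a i r \<in> ?R" if "r \<in> ?R" for r
  proof -
    have R: "r \<in> Rp I a" "r \<noteq> alp i" using that by auto
    have "srefl I a i r \<noteq> alp i"
    proof
      assume "srefl I a i r = alp i"
      then have "r = srefl I a i (alp i)" using ss[of r] by simp
      also have "\<dots> = - alp i" by (rule srefl_alp[of I i a, OF finI assms a_diag[OF assms]])
      finally have "r i < 0" by (simp add: alp_def)
      moreover have "r i \<ge> 0" using Rp_props[OF R(1)] by blast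
      ultimately show False by simp
    qed
    then show ?thesis using Rp_refl[OF R(1) assms R(2)] by simp
  qed
  have "(\<Sum>r\<in>?R. rho_pair I a r i) = (\<Sum>r\<in>?R. rho_pair I a (srefl I a i r) i)"
    by (rule sum.reindex_bij_witness[of _ "srefl I a i" "srefl I a i"]) (simp_all only: ss s)
  also have "\<dots> = - (\<Sum>r\<in>?R. rho_pair I a r i)"
    by (simp add: rho_pair_srefl finI assms a_diag sum_negf)
  finally have "(\<Sum>r\<in>?R. rho_pair I a r i) = 0" by simp
  moreover have "(\<Sum>r\<in>Rp I a. rho_pair I a r i) = rho_pair I a (alp i) i + (\<Sum>r\<in>?R. rho_pair I a r i)"
    using finite_Rp Rp_simple[OF assms] by (rule sum.remove)
  ultimately show ?thesis by (simp add: rho_pair_alp finI assms a_diag)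
qed

end

context twist begin

text \<open>Because \<open>d\<close> is prime, an orbit of roots has either one or \<open>d\<close>
  elements.\<close>

definition period :: "('i \<Rightarrow> int) \<Rightarrow> nat" where
  "period r = (if pact r = r then 1 else d)"

text \<open>The sum over the orbit with each root counted once. The exponents run from 1 to the
  period, not from 0, to match the successive shifts of the label in \<open>F_step\<close>.\<close>

definition beta :: "('i \<Rightarrow> int) \<Rightarrow> 'i \<Rightarrow> int" where
  "beta r = (\<Sum>k\<in>{1..period r}. (pact ^^ k) r)"

lemma period_pos: "period r > 0"
  using d_pos by (simp add: period_def)

lemma period_not_fixed: assumes "0 < k" "k < period r" shows "(pact ^^ k) r \<noteq> r"
proof
  assume "(pact ^^ k) r = r"
  moreover have "pact r \<noteq> r" "period r = d" using assms by (auto simp: period_def split: if_splits)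
  ultimately show False using funpow_prime_fixed[OF prime_d assms(1), of pact r] assms pact_d by simp
qed

lemma pact_sum: "pact (\<Sum>k\<in>A. g k) = (\<Sum>k\<in>A. pact (g k))"
  by (induction A rule: infinite_finite_induct)
     (simp_all only: sum.infinite sum.empty sum.insert pact_add pact_zero simp_thms)

lemma lattice_sum: "(\<And>k. k \<in> A \<Longrightarrow> g k \<in> lattice I) \<Longrightarrow> (\<Sum>k\<in>A. g k) \<in> lattice I"
  by (induction A rule: infinite_finite_induct) (simp_all add: lattice_add)

lemma shift_sum: "(\<Sum>j\<in>{1..k}. (pact ^^ Suc j) r) + pact r = (\<Sum>j\<in>{1..Suc k}. (pact ^^ j) r)"
proof (induction k)
  case (Suc k)
  have "(\<Sum>j\<in>{1..Suc k}. (pact ^^ Suc j) r) + pact r =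
      ((\<Sum>j\<in>{1..k}. (pact ^^ Suc j) r) + pact r) + (pact ^^ Suc (Suc k)) r"
    by (simp only: sum.cl_ivl_Suc add_ac) simp
  then show ?case unfolding Suc by (simp only: sum.cl_ivl_Suc[of _ 1 "Suc k"]) simp
qed simp

lemma period_pow: "(pact ^^ period r) r = r"
  by (simp add: period_def pact_d)

lemma pact_beta: "pact (beta r) = beta r"
proof -
  have "pact (beta r) + pact r = (\<Sum>j\<in>{1..period r}. (pact ^^ Suc j) r) + pact r"
    by (simp add: beta_def pact_sum)
  also have "\<dots> = (\<Sum>j\<in>{1..Suc (period r)}. (pact ^^ j) r)" by (rule shift_sum)
  also have "\<dots> = beta r + (pact ^^ Suc (period r)) r" by (simp add: beta_def)
  also have "(pact ^^ Suc (period r)) r = pact r" using period_pow[of r] by simp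
  finally show ?thesis by (rule add_right_imp_eq)
qed

lemma beta_lattice: "r \<in> lattice I \<Longrightarrow> beta r \<in> lattice I"
  unfolding beta_def by (intro lattice_sum pact_pow_lattice)

lemma beta_minus: "beta (- r) = - beta r"
proof -
  have "(pact ^^ k) (- r) = - (pact ^^ k) r" for k by (simp add: pact_pow fun_eq_iff)
  then show ?thesis unfolding beta_def by (simp only: period_def pact_minus neg_equal_iff_equal sum_negf)
qed

lemma beta_positive: assumes "r \<in> Rp I a" obtains j where "beta r j > 0"
proof -
  have "\<exists>j. r j \<noteq> 0" using Rp_props[OF assms] by (auto simp: fun_eq_iff)
  then obtain j where "r j > 0" using Rp_props[OF assms] by (metis order_less_le)
  then have "(pact ^^ period r) r j > 0" by (simp only: period_pow)
  moreover have "(pact ^^ k) r j \<ge> 0" for k using Rp_props[OF pact_pow_Rp[OF assms]] by blast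
  ultimately have "(\<Sum>k\<in>{1..period r}. (pact ^^ k) r j) > 0"
    using period_pos[of r] by (intro sum_pos2[of _ "period r"]) auto
  then show thesis using that by (simp add: beta_def sum_fun_apply)
qed

end

section \<open>The twisted Freudenthal recursion\<close>

locale twirr = twist sg br C I a e f t p \<sigma> d D + irr sg br C I a e f t sv ac M lam v0
  for sg :: "complex \<Rightarrow> 'g::ab_group_add \<Rightarrow> 'g" and br :: "'g \<Rightarrow> 'g \<Rightarrow> 'g" and C :: "'g set"
    and I :: "'i set" and a :: "'i \<Rightarrow> 'i \<Rightarrow> int" and e f t :: "'i \<Rightarrow> 'g"
    and p :: "'i \<Rightarrow> 'i" and \<sigma> :: "'g \<Rightarrow> 'g" and d :: nat and D :: "'i \<Rightarrow> real"
    and sv :: "complex \<Rightarrow> 'v::ab_group_add \<Rightarrow> 'v" and ac :: "'g \<Rightarrow> 'v \<Rightarrow> 'v" and M :: "'v set"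
    and lam :: "'i \<Rightarrow> complex" and v0 :: 'v +
  assumes lam_p: "i \<in> I \<Longrightarrow> lam (p i) = lam i"
begin

text \<open>In the form given by \<open>D\<close>, this is |lam + \<rho>|^2 - |lam + \<rho> + n|^2,
  where \<rho> has value 1 on every simple coroot; \<open>nuD n r\<close> below is the product of
  the weight lam + n with \<open>r\<close>.\<close>

definition qD :: "('i \<Rightarrow> int) \<Rightarrow> complex" where
  "qD n = - (\<Sum>i\<in>I. of_real (D i) * of_int (n i) * (2 * lam i + of_int (ar n i) + 2))"

definition nuD :: "('i \<Rightarrow> int) \<Rightarrow> ('i \<Rightarrow> int) \<Rightarrow> complex" where
  "nuD n r = (\<Sum>i\<in>I. of_real (D i) * of_int (r i) * ev n i)"

end

locale twmod = twirr sg br C I a e f t p \<sigma> d D sv ac M lam v0 + wmod sg br C I a e f t sv ac M lam B wt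
  for sg :: "complex \<Rightarrow> 'g::ab_group_add \<Rightarrow> 'g" and br :: "'g \<Rightarrow> 'g \<Rightarrow> 'g" and C :: "'g set"
    and I :: "'i set" and a :: "'i \<Rightarrow> 'i \<Rightarrow> int" and e f t :: "'i \<Rightarrow> 'g"
    and p :: "'i \<Rightarrow> 'i" and \<sigma> :: "'g \<Rightarrow> 'g" and d :: nat and D :: "'i \<Rightarrow> real"
    and sv :: "complex \<Rightarrow> 'v::ab_group_add \<Rightarrow> 'v" and ac :: "'g \<Rightarrow> 'v \<Rightarrow> 'v" and M :: "'v set"
    and lam :: "'i \<Rightarrow> complex" and v0 :: 'v and B :: "'v set" and wt :: "'v \<Rightarrow> 'i \<Rightarrow> int" +
  fixes S :: "'v \<Rightarrow> 'v"
  assumes lin_S: "lin sv S" and S_M: "v \<in> M \<Longrightarrow> S v \<in> M" and S_ac: "x \<in> C \<Longrightarrow> v \<in> M \<Longrightarrow> S (ac x v) = ac (\<sigma> x) (S v)"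
    and S_v0: "S v0 = v0"
begin

definition trn :: "('i \<Rightarrow> int) \<Rightarrow> ('v \<Rightarrow> 'v) \<Rightarrow> complex" where
  "trn n F = (\<Sum>b\<in>{b \<in> B. wt b = n}. coord b (F b))"

lemma wt_n: "b \<in> {b \<in> B. wt b = n} \<Longrightarrow> b \<in> wsp n"
  using wt_wsp by auto

lemma trn_expand:
  assumes "lin sv F" "v \<in> wsp n" "n \<in> lattice I"
  shows "coord b (F v) = (\<Sum>c\<in>{c \<in> B. wt c = n}. coord c v * coord b (F c))"
proof -
  have "coord b (F v) = (\<Sum>c\<in>B. coord c v * coord b (F c))"
    by (rule coord_lin_expand[OF assms(1) wsp_M[OF assms(2)]])
  also have "\<dots> = (\<Sum>c\<in>{c \<in> B. wt c = n}. coord c v * coord b (F c))"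
    using finB coord_wsp[OF assms(2,3)] by (intro sum.mono_neutral_right) auto
  finally show ?thesis .
qed

text \<open>Cyclicity of the trace for maps between two different weight spaces: this is the move
  that changes the label.\<close>

lemma trn_comm:
  assumes "lin sv F" "lin sv G" "n \<in> lattice I" "m \<in> lattice I"
    "\<And>v. v \<in> wsp n \<Longrightarrow> G v \<in> wsp m" "\<And>v. v \<in> wsp m \<Longrightarrow> F v \<in> wsp n"
  shows "trn n (\<lambda>v. F (G v)) = trn m (\<lambda>v. G (F v))"
proof -
  have "trn n (\<lambda>v. F (G v)) = (\<Sum>b\<in>{b \<in> B. wt b = n}. \<Sum>c\<in>{c \<in> B. wt c = m}. coord c (G b) * coord b (F c))"
    unfolding trn_def using assms wt_n by (intro sum.cong refl trn_expand) auto
  also have "\<dots> = (\<Sum>c\<in>{c \<in> B. wt c = m}. \<Sum>b\<in>{b \<in> B. wt b = n}. coord b (F c) * coord c (G b))"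
    by (subst sum.swap) (simp add: mult.commute)
  also have "\<dots> = trn m (\<lambda>v. G (F v))"
    unfolding trn_def using assms wt_n by (intro sum.cong refl trn_expand[symmetric]) auto
  finally show ?thesis .
qed

lemma trn_cong: "(\<And>v. v \<in> wsp n \<Longrightarrow> F v = G v) \<Longrightarrow> trn n F = trn n G"
  unfolding trn_def using wt_n by (intro sum.cong) auto

lemma trn_add: "trn n (\<lambda>v. F v + G v) = trn n F + trn n G"
  and trn_scale: "trn n (\<lambda>v. sv k (F v)) = k * trn n F"
  by (simp_all add: trn_def coord_add coord_scale sum.distrib sum_distrib_left)

lemma trn_sum: "trn n (\<lambda>v. \<Sum>x\<in>A. F x v) = (\<Sum>x\<in>A. trn n (F x))"
  unfolding trn_def coord_sum by (rule sum.swap)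

lemma trn_positive: assumes "n j > 0" shows "trn n F = 0"
proof -
  have "{b \<in> B. wt b = n} = {}"
  proof -
    have False if b: "b \<in> B" "wt b = n" for b
    proof -
      have "b \<noteq> 0" using b indB vv.dependent_zero by metis
      then have "n j \<le> 0" using weight_nonpos[of b n j] wt_wsp[OF b(1)] wt_lattice[OF b(1)] b(2) by simp
      then show False using assms by simp
    qed
    then show ?thesis by blast
  qed
  then show ?thesis unfolding trn_def by (simp only: sum.empty)
qed

lemma S_scale: "S (sv c v) = sv c (S v)" and S_add: "S (v + w) = S v + S w"
  using lin_S by (auto simp: lin_def)

lemma ev_p: "i \<in> I \<Longrightarrow> ev (pact n) (p i) = ev n i"
  by (simp add: ev_def lam_p rho_pact p_I)

lemma S_wsp: assumes "v \<in> wsp n" shows "S v \<in> wsp (pact n)"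
proof -
  have "ac (t i) (S v) = sv (ev (pact n) i) (S v)" if i: "i \<in> I" for i
  proof -
    have "ac (t i) (S v) = S (ac (t (q i)) v)" using i wsp_M[OF assms] by (simp add: S_ac tC \<sigma>_t q_I)
    also have "\<dots> = sv (ev n (q i)) (S v)" using wspD[OF assms q_I[OF i]] by (simp add: S_scale)
    also have "ev n (q i) = ev (pact n) i" using ev_p[OF q_I[OF i], of n] by simp
    finally show ?thesis .
  qed
  then show ?thesis using wsp_M[OF assms] by (simp add: wsp_def S_M)
qed

definition T :: "('i \<Rightarrow> int) \<Rightarrow> complex" where
  "T n = trn n S"

lemma T_0: "T 0 = 1"
proof -
  obtain b where b: "b \<in> B" "wt b = 0" using wsp_wt[OF v0_wsp v0_nz] by auto
  have bw: "b \<in> wsp 0" using wt_wsp[OF b(1)] b(2) by simp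
  then obtain k where k: "b = sv k v0" unfolding wsp_0 by (auto simp: vv.span_singleton)
  have b0: "b \<noteq> 0" using b indB vv.dependent_zero by metis
  have "c = b" if c: "c \<in> B" "wt c = 0" for c
  proof (rule ccontr)
    assume ne: "c \<noteq> b"
    have "c \<in> wsp 0" using wt_wsp[OF c(1)] c(2) by simp
    then obtain l where l: "c = sv l v0" unfolding wsp_0 by (auto simp: vv.span_singleton)
    have "k \<noteq> 0" using b0 k by auto
    then have "c = sv (l / k) b" using k l by simp
    then have "coord c c = l / k * coord c b" using coord_scale by metis
    then show False using coord_basis[OF b(1), of c] coord_basis[OF c(1), of c] ne by simp
  qed
  then have "{b \<in> B. wt b = 0} = {b}" using b by blast
  moreover have "S b = b" using k by (simp add: S_scale S_v0)
  ultimately show ?thesis using coord_basis[OF b(1), of b] by (simp add: T_def trn_def)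
qed

definition F :: "'g \<Rightarrow> ('i \<Rightarrow> int) \<Rightarrow> complex" where
  "F b n = trn n (\<lambda>v. S (ac (dual b) (ac b v)))"

definition cas :: complex where
  "cas = (SOME c. \<forall>v\<in>M. casimir v = sv c v)"

lemma cas: "v \<in> M \<Longrightarrow> casimir v = sv cas v"
proof -
  have "\<exists>c. \<forall>v\<in>M. casimir v = sv c v" using casimir_scalar by metis
  from someI_ex[OF this] show "v \<in> M \<Longrightarrow> casimir v = sv cas v" unfolding cas_def by blast
qed

lemma S_sum: "S (\<Sum>x\<in>A. g x) = (\<Sum>x\<in>A. S (g x))"
  by (rule lin_sum[OF vsv lin_S])

lemma sum_F: "(\<Sum>b\<in>adB. F b n) = cas * T n"
proof -
  have "(\<Sum>b\<in>adB. F b n) = trn n (\<lambda>v. S (casimir v))"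
    by (simp add: F_def casimir_def S_sum trn_sum)
  also have "\<dots> = trn n (\<lambda>v. sv cas (S v))"
    by (rule trn_cong) (simp add: cas wsp_M S_scale)
  finally show ?thesis by (simp add: trn_scale T_def)
qed

definition phi :: "('i \<Rightarrow> int) \<Rightarrow> 'g \<Rightarrow> complex" where
  "phi n y = (\<Sum>i\<in>I. tco y i * ev n i)"

lemma phi_ac: assumes "y \<in> rsp 0" "v \<in> wsp n" shows "ac y v = sv (phi n y) v"
proof -
  have "ac y v = (\<Sum>i\<in>I. sv (tco y i) (ac (t i) v))"
    using arg_cong[OF tco[OF assms(1)], of "\<lambda>y. ac y v"] by (simp add: ac_sum_left ac_scale_left)
  also have "\<dots> = (\<Sum>i\<in>I. sv (tco y i * ev n i) v)" using wspD[OF assms(2)] by simp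
  finally show ?thesis by (simp add: phi_def vv.scale_sum_left)
qed

lemma phi_eq: assumes "y \<in> rsp 0" "y = (\<Sum>i\<in>I. sg (u i) (t i))" shows "phi n y = (\<Sum>i\<in>I. u i * ev n i)"
  unfolding phi_def using tco_unique[OF assms] by (intro sum.cong) auto

lemma phi_add: "x \<in> rsp 0 \<Longrightarrow> y \<in> rsp 0 \<Longrightarrow> phi n (x + y) = phi n x + phi n y"
proof -
  assume xy: "x \<in> rsp 0" "y \<in> rsp 0"
  have "x + y = (\<Sum>i\<in>I. sg (tco x i) (t i)) + (\<Sum>i\<in>I. sg (tco y i) (t i))"
    by (rule arg_cong2[of _ _ _ _ "(+)", OF tco[OF xy(1)] tco[OF xy(2)]])
  also have "\<dots> = (\<Sum>i\<in>I. sg (tco x i + tco y i) (t i))"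
    by (simp add: vg.scale_left_distrib sum.distrib)
  finally have "phi n (x + y) = (\<Sum>i\<in>I. (tco x i + tco y i) * ev n i)"
    by (rule phi_eq[OF vg.subspace_add[OF subspace_rsp xy]])
  then show ?thesis by (simp add: phi_def distrib_right sum.distrib)
qed

lemma phi_scale: "x \<in> rsp 0 \<Longrightarrow> phi n (sg c x) = c * phi n x"
proof -
  assume x: "x \<in> rsp 0"
  have "sg c x = (\<Sum>i\<in>I. sg (c * tco x i) (t i))"
    using arg_cong[OF tco[OF x], of "sg c"] by (simp add: vg.scale_sum_right)
  then have "phi n (sg c x) = (\<Sum>i\<in>I. (c * tco x i) * ev n i)"
    by (rule phi_eq[OF vg.subspace_scale[OF subspace_rsp x]])
  then show ?thesis by (simp add: phi_def sum_distrib_left mult.assoc)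
qed

lemma phi_zero: "phi n 0 = 0"
  using phi_scale[OF vg.subspace_0[OF subspace_rsp], of n 0] by simp

lemma phi_sum: "(\<And>b. b \<in> A \<Longrightarrow> g b \<in> rsp 0) \<Longrightarrow> phi n (\<Sum>b\<in>A. g b) = (\<Sum>b\<in>A. phi n (g b))"
proof (induction A rule: infinite_finite_induct)
  case (insert x A)
  have "(\<Sum>b\<in>A. g b) \<in> rsp 0" by (intro vg.subspace_sum[OF subspace_rsp] insert.prems insertI2)
  moreover have "phi n (\<Sum>b\<in>A. g b) = (\<Sum>b\<in>A. phi n (g b))" by (intro insert.IH insert.prems insertI2)
  ultimately show ?case using insert.hyps phi_add[OF insert.prems[OF insertI1]] by simp
qed (simp_all add: phi_zero)

lemma phi_shift: assumes "y \<in> rsp 0" shows "phi n y = phi 0 y + kf (zr n) y"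
proof -
  have "kf (zr n) y = (\<Sum>i\<in>I. tco y i * kf (zr n) (t i))"
    using arg_cong[OF tco[OF assms], of "kf (zr n)"] by (simp add: kf_sum_right kf_scale_right)
  also have "\<dots> = (\<Sum>i\<in>I. tco y i * of_int (ar n i))" using kf_zr_t by simp
  finally show ?thesis
    by (simp add: phi_def ev_def sum.distrib distrib_left)
qed

lemma phi_zr: "phi n (zr r) = (\<Sum>i\<in>I. of_int (r i) / of_real (cK i) * ev n i)"
  by (rule phi_eq[OF zr_rsp zr_def])

definition Q :: "('i \<Rightarrow> int) \<Rightarrow> complex" where
  "Q n = (\<Sum>b\<in>{b \<in> adB. adwt b = 0}. phi n (dual b) * phi n b)"

lemma b0: "b \<in> {b \<in> adB. adwt b = 0} \<Longrightarrow> b \<in> rsp 0 \<and> dual b \<in> rsp 0"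
  using adwt[of b] dual_rsp[of b] by auto

lemma sum_F_0: "(\<Sum>b\<in>{b \<in> adB. adwt b = 0}. F b n) = Q n * T n"
proof -
  have "F b n = phi n (dual b) * phi n b * T n" if b: "b \<in> {b \<in> adB. adwt b = 0}" for b
  proof -
    have "F b n = trn n (\<lambda>v. sv (phi n (dual b) * phi n b) (S v))"
      unfolding F_def by (rule trn_cong) (use b0[OF b] phi_ac in \<open>simp add: ac_scale_right S_scale mult.commute\<close>)
    then show ?thesis by (simp add: trn_scale T_def)
  qed
  then show ?thesis by (simp add: Q_def sum_distrib_right)
qed

lemma zr_expand:
  "zr n = (\<Sum>b\<in>{b \<in> adB. adwt b = 0}. sg (kf (zr n) b) (dual b))"
  "zr n = (\<Sum>b\<in>{b \<in> adB. adwt b = 0}. sg (kf (zr n) (dual b)) b)"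
proof -
  have C: "zr n \<in> C" using zr_rsp rsp_C by blast
  have 0: "kf (zr n) b = 0" "kf (zr n) (dual b) = 0" if b: "b \<in> adB" "adwt b \<noteq> 0" for b
  proof -
    show "kf (zr n) b = 0"
      by (rule kf_orth[OF zr_rsp, of b "adwt b"]) (simp_all add: adwt[OF b(1)] b)
    show "kf (zr n) (dual b) = 0"
      by (rule kf_orth[OF zr_rsp dual_rsp[OF b(1)]]) (simp_all add: adwt[OF b(1)] b lattice_minus)
  qed
  have "zr n = (\<Sum>b\<in>adB. sg (kf (zr n) b) (dual b))" by (rule expand_dual[OF C])
  also have "\<dots> = (\<Sum>b\<in>{b \<in> adB. adwt b = 0}. sg (kf (zr n) b) (dual b))"
    by (rule sum.mono_neutral_right[OF adw.finB]) (simp_all add: 0)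
  finally show "zr n = (\<Sum>b\<in>{b \<in> adB. adwt b = 0}. sg (kf (zr n) b) (dual b))" .
  have "zr n = (\<Sum>b\<in>adB. sg (adw.coord b (zr n)) b)" by (rule adw.expand[OF C])
  also have "\<dots> = (\<Sum>b\<in>adB. sg (kf (zr n) (dual b)) b)"
    by (intro sum.cong refl arg_cong2[of _ _ _ _ sg]) (simp only: coord_dual[OF C] kf_comm[of "zr n"])
  also have "\<dots> = (\<Sum>b\<in>{b \<in> adB. adwt b = 0}. sg (kf (zr n) (dual b)) b)"
    by (rule sum.mono_neutral_right[OF adw.finB]) (simp_all add: 0)
  finally show "zr n = (\<Sum>b\<in>{b \<in> adB. adwt b = 0}. sg (kf (zr n) (dual b)) b)" .
qed

text \<open>\<open>Q n\<close> is the square length of the weight labelled \<open>n\<close>,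
  computed with dual bases of the Cartan subalgebra. This is its polarization, with
  \<open>zr n\<close> representing the shift from label 0.\<close>

lemma Q_shift: "Q n = Q 0 + 2 * phi 0 (zr n) + kf (zr n) (zr n)"
proof -
  let ?A = "{b \<in> adB. adwt b = 0}"
  have 1: "phi 0 (zr n) = (\<Sum>b\<in>?A. kf (zr n) b * phi 0 (dual b))"
  proof -
    have "phi 0 (zr n) = phi 0 (\<Sum>b\<in>?A. sg (kf (zr n) b) (dual b))" by (rule arg_cong[OF zr_expand(1)])
    also have "\<dots> = (\<Sum>b\<in>?A. phi 0 (sg (kf (zr n) b) (dual b)))"
      by (rule phi_sum) (rule vg.subspace_scale[OF subspace_rsp b0[THEN conjunct2]])
    also have "\<dots> = (\<Sum>b\<in>?A. kf (zr n) b * phi 0 (dual b))"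
      by (intro sum.cong refl phi_scale b0[THEN conjunct2])
    finally show ?thesis .
  qed
  have 2: "phi 0 (zr n) = (\<Sum>b\<in>?A. kf (zr n) (dual b) * phi 0 b)"
  proof -
    have "phi 0 (zr n) = phi 0 (\<Sum>b\<in>?A. sg (kf (zr n) (dual b)) b)" by (rule arg_cong[OF zr_expand(2)])
    also have "\<dots> = (\<Sum>b\<in>?A. phi 0 (sg (kf (zr n) (dual b)) b))"
      by (rule phi_sum) (rule vg.subspace_scale[OF subspace_rsp b0[THEN conjunct1]])
    also have "\<dots> = (\<Sum>b\<in>?A. kf (zr n) (dual b) * phi 0 b)"
      by (intro sum.cong refl phi_scale b0[THEN conjunct1])
    finally show ?thesis .
  qed
  have 3: "kf (zr n) (zr n) = (\<Sum>b\<in>?A. kf (zr n) b * kf (zr n) (dual b))"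
    using arg_cong[OF zr_expand(1), of "kf (zr n)" n] by (simp only: kf_sum_right kf_scale_right)
  have "Q n = (\<Sum>b\<in>?A. (phi 0 (dual b) + kf (zr n) (dual b)) * (phi 0 b + kf (zr n) b))"
    unfolding Q_def by (intro sum.cong refl arg_cong2[of _ _ _ _ "(*)"] phi_shift b0[THEN conjunct1] b0[THEN conjunct2])
  also have "\<dots> = Q 0 + phi 0 (zr n) + phi 0 (zr n) + kf (zr n) (zr n)"
    unfolding 3 by (subst 1, subst 2) (simp add: Q_def algebra_simps sum.distrib)
  finally show ?thesis by simp
qed

lemma S_\<sigma>_wsp: "x \<in> rsp r \<Longrightarrow> v \<in> wsp n \<Longrightarrow> S (ac x v) \<in> wsp (pact (n + r))"
  by (intro S_wsp ac_wsp)

text \<open>Pulling \<open>y k\<close> out through \<open>S\<close> turns it into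
  \<open>y (Suc k)\<close>; rotating that around the trace raises the label by
  \<open>(pact ^^ Suc k) r\<close> and puts it to the right of \<open>b\<close>. Before a full
  period it commutes with \<open>b\<close>, so the move can be repeated. After a full period it is
  \<open>dual b\<close> again, and exchanging it with \<open>b\<close> contributes
  \<open>zr r\<close>.\<close>

lemma F_step:
  assumes r: "r \<in> roots" and n: "n \<in> lattice I" "pact n = n"
  defines "b \<equiv> rb r"
  shows "F b n = F b (n + beta r) + phi (n + beta r) (zr r) * T (n + beta r)"
proof -
  have b: "b \<in> adB" "adwt b = r" using rb[OF r] by (auto simp: b_def)
  have bR: "b \<in> rsp r" using adwt[OF b(1)] b(2) by simp
  have rL: "r \<in> lattice I" using roots_props[OF r] by simp
  define y where "y = (\<lambda>k. (\<sigma> ^^ k) (dual b))"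
  \<comment> \<open>The label after \<open>k\<close> moves around the trace.\<close>
  define N where "N = (\<lambda>k. n + (\<Sum>j\<in>{1..k}. (pact ^^ j) r))"
  have minus: "(pact ^^ k) (- r) = - (pact ^^ k) r" for k by (simp add: pact_pow fun_eq_iff)
  have yR: "y k \<in> rsp (- (pact ^^ k) r)" for k
    using \<sigma>_pow_rsp[OF dual_rsp[OF b(1)], of k] by (simp only: y_def b(2) minus)
  have NL: "N k \<in> lattice I" for k
    unfolding N_def by (intro lattice_add n lattice_sum pact_pow_lattice rL)
  have N_Suc: "N (Suc k) = N k + (pact ^^ Suc k) r" for k by (simp add: N_def add.assoc)
  have pN: "pact (N k + r) = N (Suc k)" for k
  proof -
    have "pact (N k + r) = n + (\<Sum>j\<in>{1..k}. (pact ^^ Suc j) r) + pact r"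
      by (simp add: N_def pact_add pact_sum n)
    also have "\<dots> = n + ((\<Sum>j\<in>{1..k}. (pact ^^ Suc j) r) + pact r)" by (simp only: add.assoc)
    also have "(\<Sum>j\<in>{1..k}. (pact ^^ Suc j) r) + pact r = (\<Sum>j\<in>{1..Suc k}. (pact ^^ j) r)"
      by (rule shift_sum)
    finally show ?thesis by (simp only: N_def add.assoc)
  qed
  have step: "trn (N k) (\<lambda>v. S (ac (y k) (ac b v))) = trn (N (Suc k)) (\<lambda>v. S (ac b (ac (y (Suc k)) v)))" for k
  proof -
    have "trn (N k) (\<lambda>v. S (ac (y k) (ac b v))) = trn (N k) (\<lambda>v. ac (y (Suc k)) (S (ac b v)))"
      using rsp_C[OF yR] by (simp add: S_ac ac_M y_def)
    also have "\<dots> = trn (N (Suc k)) (\<lambda>v. S (ac b (ac (y (Suc k)) v)))"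
    proof (rule trn_comm[of "ac (y (Suc k))" "\<lambda>v. S (ac b v)"])
      show "lin sv (\<lambda>v. S (ac b v))" by (rule lin_comp[OF lin_S lin_ac])
      show "S (ac b v) \<in> wsp (N (Suc k))" if "v \<in> wsp (N k)" for v
        using S_\<sigma>_wsp[OF bR that] by (simp only: pN)
      show "ac (y (Suc k)) v \<in> wsp (N k)" if "v \<in> wsp (N (Suc k))" for v
      proof -
        have "N (Suc k) + - (pact ^^ Suc k) r = N k" by (simp add: N_Suc)
        then show ?thesis using ac_wsp[OF yR[of "Suc k"] that] by metis
      qed
    qed (simp_all add: lin_ac NL)
    finally show ?thesis .
  qed
  have comm: "trn m (\<lambda>v. S (ac b (ac (y k) v))) = trn m (\<lambda>v. S (ac (y k) (ac b v)))"
    if "0 < k" "k < period r" for m k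
  proof -
    have "br b (y k) = 0" by (rule commuting_orbit[OF r period_not_fixed[OF that] bR yR])
    then show ?thesis using ac_swap[of b "y k"] by simp
  qed
  have chain: "F b n = trn (N (Suc k)) (\<lambda>v. S (ac b (ac (y (Suc k)) v)))" if "k < period r" for k
    using that
  proof (induction k)
    case 0
    have "N 0 = n" "y 0 = dual b" by (simp_all add: N_def y_def)
    then show ?case using step[of 0] by (simp only: F_def)
  next
    case (Suc k)
    then show ?case using step[of "Suc k"] comm[of "Suc k"] by simp
  qed
  \<comment> \<open>For an invariant root the first move already completes the period, and this is
    where it matters that \<open>\<sigma>\<close> fixes its root vectors; otherwise the order of
    \<open>\<sigma>\<close> closes the circle.\<close>
  have yper: "y (period r) = dual b"
  proof (cases "pact r = r")
    case True
    have "\<sigma> (dual b) = dual b"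
      by (rule fixed_root_vector_all[of "- r"])
         (use r True dual_rsp[OF b(1)] b(2) in \<open>auto simp: roots_uminus pact_minus\<close>)
    then show ?thesis using True by (simp add: y_def period_def)
  next
    case False
    then show ?thesis using \<sigma>_d dual[OF b(1)] by (simp add: y_def period_def)
  qed
  have "F b n = trn (N (period r)) (\<lambda>v. S (ac b (ac (dual b) v)))"
    using chain[of "period r - 1"] period_pos[of r] yper by simp
  also have "N (period r) = n + beta r" by (simp add: N_def beta_def)
  also have "trn (n + beta r) (\<lambda>v. S (ac b (ac (dual b) v))) =
      trn (n + beta r) (\<lambda>v. S (ac (dual b) (ac b v)) + sv (phi (n + beta r) (zr r)) (S v))"
    by (rule trn_cong) (simp add: ac_swap[of b "dual b"] S_add bracket_dual b phi_ac[OF zr_rsp] S_scale)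
  finally show ?thesis by (simp add: trn_add trn_scale F_def T_def)
qed

lemma F_positive: "n j > 0 \<Longrightarrow> F b n = 0" and T_positive: "n j > 0 \<Longrightarrow> T n = 0"
  by (simp_all add: F_def T_def trn_positive)

lemma phi_zr_minus: "phi n (zr (- r)) = - phi n (zr r)"
  by (simp add: phi_zr sum_negf)

text \<open>The recursions for \<open>r\<close> and for \<open>- r\<close> show that the discrepancy
  \<open>G\<close> is unchanged when \<open>beta r\<close> is added to the label. After enough steps
  some coordinate of the label is positive; there are no such weights, so \<open>G\<close>
  vanishes.\<close>

lemma F_minus:
  assumes r: "r \<in> Rp I a" and n: "n \<in> lattice I" "pact n = n"
  shows "F (rb (- r)) n = F (rb r) n + phi n (zr r) * T n"
proof -
  define G where "G = (\<lambda>n. F (rb (- r)) n - F (rb r) n - phi n (zr r) * T n)"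
  have R: "r \<in> roots" "- r \<in> roots" using r roots_uminus by (auto simp: roots_def)
  have rL: "r \<in> lattice I" using roots_props[OF R(1)] by simp
  have step: "G m = G (m + beta r)" if m: "m \<in> lattice I" "pact m = m" for m
  proof -
    have m': "m + beta r \<in> lattice I" "pact (m + beta r) = m + beta r"
      using m beta_lattice[OF rL] by (simp_all only: lattice_add pact_add pact_beta)
    have eq: "m + beta r + beta (- r) = m" by (simp add: beta_minus)
    have "F (rb (- r)) (m + beta r) = F (rb (- r)) m - phi m (zr r) * T m"
      using F_step[OF R(2) m'] unfolding eq phi_zr_minus by simp
    moreover have "F (rb r) m = F (rb r) (m + beta r) + phi (m + beta r) (zr r) * T (m + beta r)"
      by (rule F_step[OF R(1) m])
    ultimately show ?thesis by (simp add: G_def)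
  qed
  have "\<exists>m. m \<in> lattice I \<and> pact m = m \<and> G n = G m \<and> (\<forall>j. m j = n j + int k * beta r j)" for k
  proof (induction k)
    case 0
    show ?case using n by (intro exI[of _ n]) simp
  next
    case (Suc k)
    then obtain m where m: "m \<in> lattice I" "pact m = m" "G n = G m" "\<And>j. m j = n j + int k * beta r j" by blast
    show ?case
    proof (intro exI[of _ "m + beta r"] conjI allI)
      show "m + beta r \<in> lattice I" "pact (m + beta r) = m + beta r"
        using m beta_lattice[OF rL] by (simp_all only: lattice_add pact_add pact_beta)
      show "G n = G (m + beta r)" using m(3) step[OF m(1,2)] by simp
      show "(m + beta r) j = n j + int (Suc k) * beta r j" for j by (simp add: m(4) algebra_simps)
    qed
  qed
  note ex = this
  obtain j where j: "beta r j > 0" by (rule beta_positive[OF r])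
  \<comment> \<open>More steps than the absolute value of \<open>n j\<close>, each raising
    coordinate \<open>j\<close> by at least 1.\<close>
  define k where "k = nat (1 + \<bar>n j\<bar>)"
  obtain m where m: "G n = G m" "m j = n j + int k * beta r j" using ex[of k] by blast
  have "int k \<le> int k * beta r j" using mult_left_mono[of 1 "beta r j" "int k"] j by simp
  then have "m j > 0" using m(2) by (simp add: k_def)
  then have "G n = 0" unfolding m(1) by (simp add: G_def F_positive T_positive)
  then show ?thesis by (simp add: G_def algebra_simps)
qed

lemma F_zero_weight: assumes "r \<in> Rp I a" shows "F (rb r) 0 = 0"
proof -
  have R: "r \<in> roots" using assms by (simp add: roots_def)
  obtain j where j: "beta r j > 0" by (rule beta_positive[OF assms])
  have "F (rb r) 0 = F (rb r) (0 + beta r) + phi (0 + beta r) (zr r) * T (0 + beta r)"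
    by (rule F_step[OF R lattice_zero pact_zero])
  then show ?thesis using j by (simp add: F_positive[of _ j] T_positive[of _ j])
qed

text \<open>The trace of \<open>S\<close> times the Casimir operator, computed once as a scalar and
  once summand by summand; \<open>F_minus\<close> folds the negative roots onto the positive
  ones.\<close>

lemma casimir_identity:
  assumes "n \<in> lattice I" "pact n = n"
  shows "(cas - Q n - (\<Sum>r\<in>Rp I a. phi n (zr r))) * T n = 2 * (\<Sum>r\<in>Rp I a. F (rb r) n)"
proof -
  have "adB = {b \<in> adB. adwt b = 0} \<union> {b \<in> adB. adwt b \<noteq> 0}" by auto
  then have "cas * T n = (\<Sum>b\<in>{b \<in> adB. adwt b = 0} \<union> {b \<in> adB. adwt b \<noteq> 0}. F b n)"
    using sum_F[of n] by simp
  also have "\<dots> = Q n * T n + (\<Sum>r\<in>roots. F (rb r) n)"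
    using adw.finB by (subst sum.union_disjoint) (auto simp: sum_F_0 sum_root_basis)
  also have "(\<Sum>r\<in>roots. F (rb r) n) = (\<Sum>r\<in>Rp I a. F (rb r) n) + (\<Sum>r\<in>uminus ` Rp I a. F (rb r) n)"
    unfolding roots_def using finite_Rp Rp_uminus_disjoint by (intro sum.union_disjoint) auto
  also have "(\<Sum>r\<in>uminus ` Rp I a. F (rb r) n) = (\<Sum>r\<in>Rp I a. F (rb (- r)) n)"
    by (subst sum.reindex) (simp_all add: inj_on_def)
  also have "\<dots> = (\<Sum>r\<in>Rp I a. F (rb r) n + phi n (zr r) * T n)"
    using F_minus assms by (intro sum.cong) auto
  also have "\<dots> = (\<Sum>r\<in>Rp I a. F (rb r) n) + (\<Sum>r\<in>Rp I a. phi n (zr r)) * T n"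
    by (simp add: sum.distrib sum_distrib_right)
  finally show ?thesis by (simp add: algebra_simps)
qed

lemma kf_zr_zr: "kf (zr n) (zr r) = (\<Sum>i\<in>I. of_int (n i) / of_real (cK i) * of_int (ar r i))"
proof -
  have "kf (zr n) (zr r) = kf (zr r) (zr n)" by (rule kf_comm)
  also have "\<dots> = (\<Sum>i\<in>I. of_int (n i) / of_real (cK i) * kf (zr r) (t i))"
    by (simp add: zr_def[of n] kf_sum_right kf_scale_right)
  finally show ?thesis by (simp add: kf_zr_t)
qed

text \<open>The Casimir eigenvalue is found by putting n = 0, where \<open>T\<close> is 1 and the
  root terms vanish. The summand 2 in the coefficient is the value of the sum of the positive roots
  on a simple coroot.\<close>

lemma coefficient_identity:
  "cas - Q n - (\<Sum>r\<in>Rp I a. phi n (zr r)) =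
     - (\<Sum>i\<in>I. of_int (n i) / of_real (cK i) * (2 * lam i + of_int (ar n i) + 2))"
proof -
  have "(cas - Q 0 - (\<Sum>r\<in>Rp I a. phi 0 (zr r))) * T 0 = 0"
    using casimir_identity[OF lattice_zero pact_zero] F_zero_weight by simp
  then have c: "cas = Q 0 + (\<Sum>r\<in>Rp I a. phi 0 (zr r))" by (simp add: T_0 algebra_simps)
  have "(\<Sum>r\<in>Rp I a. phi n (zr r)) = (\<Sum>r\<in>Rp I a. phi 0 (zr r) + kf (zr n) (zr r))"
    by (intro sum.cong refl phi_shift zr_rsp)
  then have "cas - Q n - (\<Sum>r\<in>Rp I a. phi n (zr r)) =
      - (2 * phi 0 (zr n) + kf (zr n) (zr n) + (\<Sum>r\<in>Rp I a. kf (zr n) (zr r)))"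
    by (simp add: c Q_shift[of n] sum.distrib)
  also have "(\<Sum>r\<in>Rp I a. kf (zr n) (zr r)) =
      (\<Sum>i\<in>I. of_int (n i) / of_real (cK i) * of_int (\<Sum>r\<in>Rp I a. ar r i))"
    unfolding kf_zr_zr by (subst sum.swap) (simp add: sum_distrib_left)
  also have "\<dots> = (\<Sum>i\<in>I. of_int (n i) / of_real (cK i) * 2)"
    using sum_Rp by (intro sum.cong) auto
  also have "phi 0 (zr n) = (\<Sum>i\<in>I. of_int (n i) / of_real (cK i) * lam i)"
    by (simp add: phi_zr ev_def)
  finally have "cas - Q n - (\<Sum>r\<in>Rp I a. phi n (zr r)) =
      - (2 * (\<Sum>i\<in>I. of_int (n i) / of_real (cK i) * lam i) +
      (\<Sum>i\<in>I. of_int (n i) / of_real (cK i) * of_int (ar n i)) +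
      (\<Sum>i\<in>I. of_int (n i) / of_real (cK i) * 2))" unfolding kf_zr_zr .
  moreover have "(\<Sum>i\<in>I. of_int (n i) / of_real (cK i) * (2 * lam i + of_int (ar n i) + 2)) =
      2 * (\<Sum>i\<in>I. of_int (n i) / of_real (cK i) * lam i) +
      (\<Sum>i\<in>I. of_int (n i) / of_real (cK i) * of_int (ar n i)) +
      (\<Sum>i\<in>I. of_int (n i) / of_real (cK i) * 2)"
    by (simp only: distrib_left sum.distrib sum_distrib_left mult.left_commute)
  ultimately show ?thesis by simp
qed

text \<open>By uniqueness of symmetrizers \<open>D\<close> is a multiple of 1 / cK. The scalar is
  absorbed into the auxiliary functions, which are existentially bound so that what is exported
  mentions neither root vectors nor the Killing form.\<close>

theorem twisted_freudenthal:
  "\<exists>FF. (\<forall>n. n \<in> lattice I \<longrightarrow> pact n = n \<longrightarrow> qD n * T n = 2 * (\<Sum>r\<in>Rp I a. FF r n)) \<and>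
     (\<forall>r\<in>Rp I a. \<forall>n. n \<in> lattice I \<longrightarrow> pact n = n \<longrightarrow>
        FF r n = FF r (n + beta r) + nuD (n + beta r) r * T (n + beta r)) \<and>
     (\<forall>r n. (\<exists>j. n j > 0) \<longrightarrow> FF r n = (0::complex))"
proof -
  obtain l where l: "\<And>i. i \<in> I \<Longrightarrow> D i * cK i = l"
    using symmetrizer_unique[of D] D_sym D_pos by metis
  have D: "of_real (D i) = of_real l / (of_real (cK i) :: complex)" if "i \<in> I" for i
  proof -
    have "D i = l / cK i" using l[OF that] cK_pos[OF that] by (simp add: field_simps)
    then show ?thesis by simp
  qed
  have q: "qD n = of_real l * (cas - Q n - (\<Sum>r\<in>Rp I a. phi n (zr r)))" for n
  proof -
    have "qD n = - (\<Sum>i\<in>I. of_real l * (of_int (n i) / of_real (cK i) * (2 * lam i + of_int (ar n i) + 2)))"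
      unfolding qD_def using D by (intro arg_cong[of _ _ uminus] sum.cong refl) simp
    then show ?thesis unfolding coefficient_identity by (simp add: sum_distrib_left)
  qed
  have nu: "nuD n r = of_real l * phi n (zr r)" for n r
  proof -
    have "nuD n r = (\<Sum>i\<in>I. of_real l * (of_int (r i) / of_real (cK i) * ev n i))"
      unfolding nuD_def using D by (intro sum.cong refl) simp
    then show ?thesis by (simp add: phi_zr sum_distrib_left)
  qed
  show ?thesis
  proof (intro exI[of _ "\<lambda>r n. of_real l * F (rb r) n"] conjI allI ballI impI)
    fix n assume n: "n \<in> lattice I" "pact n = n"
    show "qD n * T n = 2 * (\<Sum>r\<in>Rp I a. of_real l * F (rb r) n)"
      using arg_cong[OF casimir_identity[OF n], of "\<lambda>x. of_real l * x"]
      by (simp add: q mult.assoc sum_distrib_left[symmetric] mult.left_commute)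
    fix r assume "r \<in> Rp I a"
    then have "r \<in> roots" by (simp add: roots_def)
    from F_step[OF this n] show "of_real l * F (rb r) n =
        of_real l * F (rb r) (n + beta r) + nuD (n + beta r) r * T (n + beta r)"
      by (simp add: nu distrib_left)
  next
    fix r n :: "'i \<Rightarrow> int" assume "\<exists>j. n j > 0"
    then obtain j where "n j > 0" by blast
    then show "of_real l * F (rb r) n = 0" by (simp add: F_positive)
  qed
qed

end

section \<open>The intertwiner\<close>

context irr begin

text \<open>The inequality |lam + \<rho> + n| < |lam + \<rho>| for a weight other than the highest.
  If lam + n is dominant, all summands are nonpositive, because \<open>n\<close> is, and one is
  negative. Otherwise reflecting at a coroot with negative value \<open>m\<close> gives a higher
  weight and increases the sum by -2 m D_i, so induction on the distance from the top
  applies.\<close>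

lemma highest_norm_positive:
  fixes mu :: "'i \<Rightarrow> nat" and D :: "'i \<Rightarrow> real"
  assumes D: "\<And>i j. i \<in> I \<Longrightarrow> j \<in> I \<Longrightarrow> D i * of_int (a i j) = D j * of_int (a j i)"
    and pos: "\<And>i. i \<in> I \<Longrightarrow> D i > 0"
    and mu: "\<And>i. i \<in> I \<Longrightarrow> lam i = complex_of_nat (mu i)"
    and v: "v \<in> wsp n" "v \<noteq> 0" "n \<in> lattice I" "n \<noteq> 0"
  shows "(\<Sum>i\<in>I. D i * of_int (n i) * of_int (2 * int (mu i) + rho_pair I a n i + 2)) < 0"
  using v
proof (induction "nat (- height I n)" arbitrary: n v rule: less_induct)
  case less
  obtain B wt where B: "wmod sg br C I a e f t sv ac M lam B wt"
    using weight_basis[OF fwords_M span_fwords fwords_weight] by metis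
  interpret wmod sg br C I a e f t sv ac M lam B wt by fact
  define q where "q = (\<lambda>n. \<Sum>i\<in>I. D i * of_int (n i) * of_int (2 * int (mu i) + rho_pair I a n i + 2))"
  have le: "n j \<le> 0" for j by (rule weight_nonpos[OF less.prems(1-3)])
  show ?case
  proof (cases "\<exists>i\<in>I. int (mu i) + rho_pair I a n i < 0")
    case False
    obtain k where k: "n k \<noteq> 0" using less.prems(4) by (auto simp: fun_eq_iff)
    then have kI: "k \<in> I" using less.prems(3) by (force simp: lattice_def)
    have nonneg: "D i * of_int (n i) * of_int (2 * int (mu i) + rho_pair I a n i + 2) \<le> 0" if i: "i \<in> I" for i
    proof (rule mult_nonpos_nonneg)
      show "D i * of_int (n i) \<le> 0" using pos[OF i] le[of i] by (simp add: mult_nonneg_nonpos)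
      have "0 \<le> 2 * int (mu i) + rho_pair I a n i + 2" using False i by (auto simp: not_less)
      then show "0 \<le> (of_int (2 * int (mu i) + rho_pair I a n i + 2) :: real)" by (simp only: of_int_0_le_iff)
    qed
    have "D k * of_int (n k) < 0" using pos[OF kI] le[of k] k by (simp add: mult_pos_neg)
    moreover have "2 * int (mu k) + rho_pair I a n k + 2 > 0" using False kI by (auto simp: not_less)
    then have "(of_int (2 * int (mu k) + rho_pair I a n k + 2) :: real) > 0" by (simp only: of_int_0_less_iff)
    ultimately have "D k * of_int (n k) * of_int (2 * int (mu k) + rho_pair I a n k + 2) < 0"
      by (rule mult_neg_pos)
    then have "0 < (\<Sum>i\<in>I. - (D i * of_int (n i) * of_int (2 * int (mu i) + rho_pair I a n i + 2)))"
      using nonneg finI kI by (intro sum_pos2[of _ k]) auto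
    then show ?thesis by (simp add: sum_negf)
  next
    case True
    then obtain i where i: "i \<in> I" "int (mu i) + rho_pair I a n i < 0" by blast
    define m where "m = int (mu i) + rho_pair I a n i"
    define n' where "n' = (\<lambda>j. n j - m * alp i j)"
    have ev: "ev n i = of_int m" using mu[OF i(1)] by (simp add: ev_def m_def)
    have v': "refl_op i m v \<in> wsp n'" "refl_op i m v \<noteq> 0"
      using refl_op[OF i(1) ev less.prems(1)] less.prems(2) by (auto simp: n'_def)
    have L: "n' \<in> lattice I" using less.prems(3) i(1) by (auto simp: n'_def lattice_def alp_def)
    have rho: "rho_pair I a n' j = rho_pair I a n j - m * a j i" for j
      unfolding n'_def by (rule rho_pair_line[OF finI i(1)])
    have sum_alp: "(\<Sum>j\<in>I. g j * of_int (alp i j)) = g i" for g :: "'i \<Rightarrow> real"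
      using finI i(1) by (simp add: alp_def if_distrib cong: if_cong)
    have "q n' = (\<Sum>j\<in>I. D j * of_int (n j) * of_int (2 * int (mu j) + rho_pair I a n j + 2)
        - of_int m * (D j * of_int (a j i)) * of_int (n j)
        - of_int m * D j * of_int (2 * int (mu j) + rho_pair I a n j + 2 - m * a j i) * of_int (alp i j))"
      unfolding q_def rho by (intro sum.cong refl) (simp add: n'_def algebra_simps)
    also have "\<dots> = q n - of_int m * (\<Sum>j\<in>I. D j * of_int (a j i) * of_int (n j))
        - of_int m * D i * of_int (2 * int (mu i) + rho_pair I a n i + 2 - m * a i i)"
      unfolding sum_subtractf q_def sum_alp by (simp add: sum_distrib_left mult.assoc)
    also have "(\<Sum>j\<in>I. D j * of_int (a j i) * of_int (n j)) = D i * of_int (rho_pair I a n i)"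
      using D[OF _ i(1)] by (simp add: rho_pair_def sum_distrib_left mult.assoc[symmetric])
    finally have "q n' = q n - of_int m * D i * of_int (2 * (int (mu i) + rho_pair I a n i) + 2 - 2 * m)"
      by (simp add: a_diag[OF i(1)] algebra_simps)
    then have qn: "q n' = q n - 2 * (of_int m * D i)" by (simp add: m_def[symmetric])
    have mD: "of_int m * D i < 0" using i pos[OF i(1)] by (simp add: m_def mult_neg_pos del: of_int_add)
    have "q n < 0"
    proof (cases "n' = 0")
      case True
      then have "q n' = 0" by (simp add: q_def)
      then show ?thesis using qn mD by linarith
    next
      case False
      have "height I n' = height I n - m"
        using finI i(1) by (simp add: height_def n'_def sum_subtractf alp_def flip: sum_distrib_left)
      moreover have "height I n' \<le> 0"
        unfolding height_def using weight_nonpos[OF v' L] by (intro sum_nonpos) auto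
      ultimately have "nat (- height I n') < nat (- height I n)" using i(2) by (simp add: m_def)
      then have "q n' < 0" unfolding q_def using less.hyps v' L False by blast
      then show ?thesis using qn mD by simp
    qed
    then show ?thesis by (simp add: q_def)
  qed
qed

end

context twirr begin

definition sv2 :: "complex \<Rightarrow> 'v \<times> 'v \<Rightarrow> 'v \<times> 'v" where
  "sv2 c v = (sv c (fst v), sv c (snd v))"

definition ac2 :: "'g \<Rightarrow> 'v \<times> 'v \<Rightarrow> 'v \<times> 'v" where
  "ac2 x v = (ac x (fst v), ac (\<sigma> x) (snd v))"

lemma sv2_pair: "sv2 c (v, w) = (sv c v, sv c w)"
  by (simp add: sv2_def)

lemma vs2: "vector_space sv2"
  by unfold_locales (simp_all add: sv2_def prod_eq_iff vv.scale_right_distrib vv.scale_left_distrib)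

lemma sub2: "module.subspace sv2 (M \<times> M)"
proof -
  interpret v2: vector_space sv2 by (rule vs2)
  show ?thesis using subM by (auto simp: v2.subspace_def sv2_def vv.subspace_def zero_prod_def)
qed

lemma fd2: "finite_dim sv2 (M \<times> M)"
proof -
  interpret v2: vector_space sv2 by (rule vs2)
  obtain F where F: "finite F" "F \<subseteq> M" "vv.span F = M" using fdM unfolding finite_dim_def by auto
  let ?F = "(\<lambda>v. (v, 0)) ` F \<union> (\<lambda>v. (0, v)) ` F"
  have l: "(v, 0) \<in> v2.span ?F" if "v \<in> vv.span F" for v
    using that
  proof (induction rule: vv.span_induct_alt)
    case base
    show ?case using v2.span_zero[of ?F] by (simp add: zero_prod_def)
  next
    case (step c x y)
    have "(x, 0) \<in> v2.span ?F" using step(1) by (intro v2.span_base) auto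
    from v2.span_add[OF v2.span_scale[OF this] step(2)] have "sv2 c (x, 0) + (y, 0) \<in> v2.span ?F" .
    then show ?case by (simp add: sv2_pair)
  qed
  have r: "(0, v) \<in> v2.span ?F" if "v \<in> vv.span F" for v
    using that
  proof (induction rule: vv.span_induct_alt)
    case base
    show ?case using v2.span_zero[of ?F] by (simp add: zero_prod_def)
  next
    case (step c x y)
    have "(0, x) \<in> v2.span ?F" using step(1) by (intro v2.span_base) auto
    from v2.span_add[OF v2.span_scale[OF this] step(2)] have "sv2 c (0, x) + (0, y) \<in> v2.span ?F" .
    then show ?case by (simp add: sv2_pair)
  qed
  have "M \<times> M \<subseteq> v2.span ?F"
  proof
    fix v assume "v \<in> M \<times> M"
    then have "(fst v, 0) + (0, snd v) \<in> v2.span ?F" using l r F by (intro v2.span_add) auto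
    then show "v \<in> v2.span ?F" by simp
  qed
  moreover have "?F \<subseteq> M \<times> M" using F subM vv.subspace_0 by auto
  ultimately have "v2.span ?F = M \<times> M" using sub2 v2.span_minimal by blast
  then show ?thesis unfolding finite_dim_def using F \<open>?F \<subseteq> M \<times> M\<close> by (intro exI[of _ ?F]) auto
qed

sublocale two: hwm sg br C I a e f t sv2 ac2 "M \<times> M" lam "(v0, v0)"
proof -
  interpret v2: vector_space sv2 by (rule vs2)
  show "hwm sg br C I a e f t sv2 ac2 (M \<times> M) lam (v0, v0)"
  proof unfold_locales
    show "i \<in> I \<Longrightarrow> ac2 (e i) (v0, v0) = 0" for i
      by (simp add: ac2_def \<sigma>_e v0_e p_I zero_prod_def)
    show "i \<in> I \<Longrightarrow> ac2 (t i) (v0, v0) = sv2 (lam i) (v0, v0)" for i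
      by (simp add: ac2_def sv2_def \<sigma>_t v0_t p_I lam_p)
  qed (use sub2 fd2 v0M v0_nz in \<open>auto simp: ac2_def sv2_def ac_add_left ac_add_right ac_scale_left ac_scale_right
      ac_br ac_M \<sigma>_add \<sigma>_scale \<sigma>_br zero_prod_def\<close>)
qed

text \<open>The submodule generated by \<open>(v0, v0)\<close>, where \<open>x\<close> acts on the second factor as \<open>\<sigma> x\<close>, is the graph of
  the intertwiner.\<close>

abbreviation \<Gamma> :: "('v \<times> 'v) set" where "\<Gamma> \<equiv> module.span sv2 two.fwords"

lemma \<Gamma>_stable: "x \<in> C \<Longrightarrow> (v, w) \<in> \<Gamma> \<Longrightarrow> (ac x v, ac (\<sigma> x) w) \<in> \<Gamma>"
  using two.fwords_stable[of x "(v, w)"] by (simp add: ac2_def)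

lemma \<Gamma>_add: "(v, w) \<in> \<Gamma> \<Longrightarrow> (v', w') \<in> \<Gamma> \<Longrightarrow> (v + v', w + w') \<in> \<Gamma>"
  using two.vv.span_add[of "(v, w)" _ "(v', w')"] by simp

lemma \<Gamma>_scale: "(v, w) \<in> \<Gamma> \<Longrightarrow> (sv c v, sv c w) \<in> \<Gamma>"
  using two.vv.span_scale[of "(v, w)" _ c] by (simp add: sv2_def)

lemma \<Gamma>_zero: "(0, 0) \<in> \<Gamma>"
  using two.vv.span_zero by (simp add: zero_prod_def)

lemma \<Gamma>_v0: "(v0, v0) \<in> \<Gamma>"
proof (rule two.vv.span_base)
  show "(v0, v0) \<in> two.fwords" unfolding two.fwords_def using two.fwd_simps(1) by (metis (mono_tags, lifting) CollectI empty_set empty_subsetI)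
qed

lemma \<Gamma>_M: "(v, w) \<in> \<Gamma> \<Longrightarrow> v \<in> M \<and> w \<in> M"
  using two.vv.span_minimal[OF two.fwords_M sub2] by auto

text \<open>The vectors \<open>w\<close> with \<open>(0, w)\<close> in \<open>\<Gamma>\<close> form
  a submodule, since \<open>\<sigma>\<close> is onto by its finite order. It does not contain
  \<open>v0\<close>, because the vectors of label 0 in \<open>\<Gamma>\<close> are multiples of
  \<open>(v0, v0)\<close>.\<close>

lemma \<Gamma>_single: assumes "(0, w) \<in> \<Gamma>" shows "w = 0"
proof -
  let ?K = "{w \<in> M. (0, w) \<in> \<Gamma>}"
  have "?K = {0} \<or> ?K = M"
  proof (rule irreducible)
    show "vv.subspace ?K"
      using subM \<Gamma>_add[of 0 _ 0] \<Gamma>_scale[of 0] \<Gamma>_zero by (auto simp: vv.subspace_def)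
    show "ac x w \<in> ?K" if x: "x \<in> C" and w: "w \<in> ?K" for x w
    proof -
      have *: "(\<sigma> ^^ k) x \<in> C" for k using x \<sigma>_C by (induction k) auto
      have "\<sigma> ((\<sigma> ^^ (d - 1)) x) = (\<sigma> ^^ d) x" using d_pos by (cases d) auto
      also have "\<dots> = x" by (rule \<sigma>_d[OF x])
      finally have eq: "\<sigma> ((\<sigma> ^^ (d - 1)) x) = x" .
      have "(ac ((\<sigma> ^^ (d - 1)) x) 0, ac (\<sigma> ((\<sigma> ^^ (d - 1)) x)) w) \<in> \<Gamma>"
        using w by (intro \<Gamma>_stable *) auto
      then have "(0, ac x w) \<in> \<Gamma>" by (simp only: eq ac_zero)
      then show ?thesis by (simp add: ac_M)
    qed
  qed auto
  moreover have "v0 \<notin> ?K"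
  proof
    assume "v0 \<in> ?K"
    then have G: "(0, v0) \<in> \<Gamma>" by simp
    have "(0, v0) \<in> two.wsp 0"
      using v0M subM v0_t p_I lam_p
      by (simp add: two.wsp_def two.ev_def ac2_def sv2_def \<sigma>_t vv.subspace_0)
    then have "(0, v0) \<in> two.vv.span {(v0, v0)}" using two.fwords_top G by blast
    then show False using v0_nz by (auto simp: two.vv.span_singleton sv2_def)
  qed
  ultimately have "?K = {0}" using v0M by blast
  then show ?thesis using assms \<Gamma>_M by blast
qed

lemma \<Gamma>_total: assumes "v \<in> M" shows "\<exists>w. (v, w) \<in> \<Gamma>"
proof -
  let ?P = "{v \<in> M. \<exists>w. (v, w) \<in> \<Gamma>}"
  have "?P = {0} \<or> ?P = M"
  proof (rule irreducible)
    show "vv.subspace ?P"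
      using subM \<Gamma>_add \<Gamma>_scale \<Gamma>_zero unfolding vv.subspace_def by blast
    show "ac x w \<in> ?P" if "x \<in> C" "w \<in> ?P" for x w
      using that \<Gamma>_stable ac_M by blast
  qed auto
  moreover have "v0 \<in> ?P" using \<Gamma>_v0 v0M by blast
  ultimately have "?P = M" using v0_nz by blast
  then show ?thesis using assms by blast
qed

lemma \<Gamma>_unique: assumes "(v, w) \<in> \<Gamma>" "(v, w') \<in> \<Gamma>" shows "w = w'"
proof -
  have "(v + sv (- 1) v, w + sv (- 1) w') \<in> \<Gamma>" by (intro \<Gamma>_add \<Gamma>_scale assms)
  then have "(0, w - w') \<in> \<Gamma>" by simp
  then show ?thesis using \<Gamma>_single by fastforce
qed

text \<open>The graph defines \<open>S\<close> on \<open>M\<close>; reading it at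
  \<open>proj v\<close> extends it linearly to the ambient type. The power \<open>S ^^ d\<close>
  commutes with the action and fixes \<open>v0\<close>, so irreducibility makes it the identity on
  \<open>M\<close>.\<close>

lemma intertwiner:
  obtains S where "lin sv S" "\<And>v. S v \<in> M" "\<And>x v. x \<in> C \<Longrightarrow> v \<in> M \<Longrightarrow> S (ac x v) = ac (\<sigma> x) (S v)"
    "S v0 = v0" "\<And>v. v \<in> M \<Longrightarrow> (S ^^ d) v = v"
proof -
  obtain B where "fbasis sv B M" using fbasis_exists[OF vsv fdM] .
  then interpret fbasis sv B M .
  have "\<exists>w. (proj v, w) \<in> \<Gamma>" for v by (rule \<Gamma>_total[OF proj_in])
  then obtain S where S: "\<And>v. (proj v, S v) \<in> \<Gamma>" by metis
  have lin: "lin sv S" unfolding lin_def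
  proof (intro conjI allI)
    fix v w c
    show "S (v + w) = S v + S w"
      by (rule \<Gamma>_unique[OF S]) (simp only: proj_add \<Gamma>_add S)
    show "S (sv c v) = sv c (S v)"
      by (rule \<Gamma>_unique[OF S]) (simp only: proj_scale \<Gamma>_scale S)
  qed
  have SM: "S v \<in> M" for v using \<Gamma>_M[OF S] by blast
  have Sac: "S (ac x v) = ac (\<sigma> x) (S v)" if x: "x \<in> C" and v: "v \<in> M" for x v
  proof (rule \<Gamma>_unique[OF S])
    show "(proj (ac x v), ac (\<sigma> x) (S v)) \<in> \<Gamma>"
      using \<Gamma>_stable[OF x S[of v]] by (simp only: proj_id[OF v] proj_id[OF ac_M])
  qed
  have S0: "S v0 = v0"
    by (rule \<Gamma>_unique[OF S]) (simp only: proj_id[OF v0M] \<Gamma>_v0)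
  have SkM: "(S ^^ k) v \<in> M" if "v \<in> M" for k v using that SM by (cases k) auto
  have Sk: "(S ^^ k) (ac x v) = ac ((\<sigma> ^^ k) x) ((S ^^ k) v)" if "x \<in> C" "v \<in> M" for k x v
  proof (induction k)
    case (Suc k)
    have "(\<sigma> ^^ k) x \<in> C" using that \<sigma>_C by (induction k) auto
    then show ?case using Suc Sac SkM[OF that(2)] by simp
  qed simp
  have lin_k: "lin sv (S ^^ k)" for k by (rule lin_pow[OF lin])
  have "{v \<in> M. (S ^^ d) v = v} = {0} \<or> {v \<in> M. (S ^^ d) v = v} = M"
  proof (rule irreducible)
    have "(S ^^ d) 0 = 0" using lin_k[of d] unfolding lin_def by (metis vv.scale_zero_left)
    then show "vv.subspace {v \<in> M. (S ^^ d) v = v}"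
      using subM lin_k[of d] by (auto simp: vv.subspace_def lin_def)
    show "ac x w \<in> {v \<in> M. (S ^^ d) v = v}" if "x \<in> C" "w \<in> {v \<in> M. (S ^^ d) v = v}" for x w
      using that Sk[of x w d] \<sigma>_d[of x] by (simp add: ac_M)
  qed auto
  moreover have "(S ^^ k) v0 = v0" for k using S0 by (induction k) auto
  then have "v0 \<in> {v \<in> M. (S ^^ d) v = v}" using v0M by simp
  ultimately have "{v \<in> M. (S ^^ d) v = v} = M" using v0_nz by blast
  then have "(S ^^ d) v = v" if "v \<in> M" for v using that by blast
  then show thesis using that lin SM Sac S0 by blast
qed

end

lemma root_of_unity_sum:
  assumes "0 < k" "k < d"
  shows "(\<Sum>j<d. cis (2 * pi / real d) ^ (j * k)) = 0"
proof -
  let ?z = "cis (2 * pi / real d) ^ k"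
  have "?z \<noteq> 1"
  proof
    assume "?z = 1"
    then have "cis (real k * (2 * pi / real d)) = 1" by (simp add: DeMoivre)
    then have "cos (real k * (2 * pi / real d)) = 1" by (metis cis.simps(1) one_complex.simps(1))
    then obtain m :: int where "real k * (2 * pi / real d) = of_int m * 2 * pi"
      unfolding cos_one_2pi_int by blast
    then have "real k = of_int m * real d" using assms by (simp add: field_simps)
    then have km: "int k = m * int d" by (metis of_int_eq_iff of_int_mult of_int_of_nat_eq)
    then have "m > 0" using assms by (metis of_nat_0_less_iff zero_less_mult_pos2 order.strict_trans)
    then have "int k \<ge> int d" using km by (metis mult_le_cancel_right1 of_nat_0_le_iff mult_right_mono int_one_le_iff_zero_less mult_1)
    then show False using assms by simp
  qed
  moreover have "?z ^ d = 1"
  proof -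
    have "?z ^ d = (cis (2 * pi / real d) ^ d) ^ k" by (simp only: power_mult[symmetric] mult.commute)
    also have "cis (2 * pi / real d) ^ d = 1" using assms by (simp add: DeMoivre cis_2pi)
    finally show ?thesis by simp
  qed
  ultimately have "(\<Sum>j<d. ?z ^ j) = 0" by (simp add: sum_gp_strict)
  then show ?thesis by (simp add: power_mult[symmetric] mult.commute)
qed

context twirr begin

lemma twmod_exists:
  assumes S: "lin sv S" "\<And>v. S v \<in> M" "\<And>x v. x \<in> C \<Longrightarrow> v \<in> M \<Longrightarrow> S (ac x v) = ac (\<sigma> x) (S v)"
      "S v0 = v0"
    and B: "wmod sg br C I a e f t sv ac M lam B wt"
  shows "twmod sg br C I a e f t p \<sigma> d D sv ac M lam v0 B wt S"
proof -
  interpret wmod sg br C I a e f t sv ac M lam B wt by (rule B)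
  show ?thesis by unfold_locales (use S in auto)
qed

text \<open>In a basis of weight vectors which are eigenvectors of \<open>S\<close> on the \<open>p\<close>-invariant weight
  spaces, the diagonal entries of \<open>S\<close> are roots of unity.\<close>

lemma eigenbasis:
  assumes S: "lin sv S" "\<And>v. S v \<in> M" "\<And>x v. x \<in> C \<Longrightarrow> v \<in> M \<Longrightarrow> S (ac x v) = ac (\<sigma> x) (S v)"
      "S v0 = v0" "\<And>v. v \<in> M \<Longrightarrow> (S ^^ d) v = v"
  obtains B wt where "wmod sg br C I a e f t sv ac M lam B wt"
    "\<And>b. b \<in> B \<Longrightarrow> pact (wt b) = wt b \<Longrightarrow> \<exists>z. norm z = 1 \<and> S b = sv z b"
proof -
  define W1 where "W1 = {w. \<exists>n\<in>lattice I. w \<in> wsp n \<and> pact n \<noteq> n}"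
  define W2 where "W2 = {w. \<exists>n\<in>lattice I. w \<in> wsp n \<and> pact n = n \<and> (\<exists>z. norm z = 1 \<and> S w = sv z w)}"
  have Sadd: "S (v + w) = S v + S w" and Sscale: "S (sv c v) = sv c (S v)" for v w c
    using S(1) by (auto simp: lin_def)
  obtain B0 wt0 where B0: "wmod sg br C I a e f t sv ac M lam B0 wt0"
    using weight_basis[OF fwords_M span_fwords fwords_weight] by metis
  interpret B0: twmod sg br C I a e f t p \<sigma> d D sv ac M lam v0 B0 wt0 S
    by (rule twmod_exists[OF S(1-4) B0])
  define z where "z = cis (2 * pi / real d)"
  have nz: "norm (z ^ k) = 1" for k by (simp add: z_def norm_power)
  have zd: "z ^ d = 1" using d_pos by (simp add: z_def DeMoivre cis_2pi)
  have span2: "v \<in> vv.span W2" if v: "v \<in> wsp n" and n: "n \<in> lattice I" "pact n = n" for v n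
  proof -
    have Sk: "(S ^^ k) v \<in> wsp n" for k
    proof (induction k)
      case (Suc k)
      show ?case using B0.S_wsp[OF Suc] by (simp add: n(2))
    qed (simp add: v)
    \<comment> \<open>The Fourier components of \<open>v\<close> under the cyclic group generated by
      \<open>S\<close>: \<open>w j\<close> has eigenvalue z^(-j), and by orthogonality of the powers
      of \<open>z\<close> the components add up to d times \<open>v\<close>.\<close>
    define w where "w = (\<lambda>j. \<Sum>k<d. sv (z ^ (j * k)) ((S ^^ k) v))"
    have wW: "w j \<in> wsp n" for j
      unfolding w_def by (intro vv.subspace_sum[OF subspace_wsp] vv.subspace_scale[OF subspace_wsp] Sk)
    have Sw: "sv (z ^ j) (S (w j)) = w j" for j
    proof -
      have "sv (z ^ j) (S (w j)) = (\<Sum>k<d. sv (z ^ (j * Suc k)) ((S ^^ Suc k) v))"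
        unfolding w_def lin_sum[OF vsv S(1)] vv.scale_sum_right
        by (intro sum.cong refl) (simp add: Sscale power_add)
      also have "\<dots> = (\<Sum>k<d. sv (z ^ (j * k)) ((S ^^ k) v))"
      proof -
        let ?g = "\<lambda>k. sv (z ^ (j * k)) ((S ^^ k) v)"
        have "?g d = ?g 0" using S(5)[OF wsp_M[OF v]] zd by (simp add: mult.commute[of j] power_mult)
        moreover have "(\<Sum>k<d. ?g (Suc k)) + ?g 0 = (\<Sum>k<d. ?g k) + ?g d"
        proof -
          have "(\<Sum>k<d. ?g (Suc k)) + ?g 0 = sum ?g {..<Suc d}"
            by (subst sum.lessThan_Suc_shift) (rule add.commute)
          also have "\<dots> = (\<Sum>k<d. ?g k) + ?g d" by (rule sum.lessThan_Suc)
          finally show ?thesis .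
        qed
        ultimately show ?thesis by simp
      qed
      finally show ?thesis by (simp add: w_def)
    qed
    have "S (w j) = sv (inverse (z ^ j)) (w j)" for j
    proof -
      have "z ^ j \<noteq> 0" using nz[of j] by (metis norm_zero zero_neq_one)
      then have "sv (inverse (z ^ j)) (sv (z ^ j) (S (w j))) = S (w j)" by simp
      then show ?thesis by (simp only: Sw)
    qed
    moreover have "norm (inverse (z ^ j)) = 1" for j by (simp add: norm_inverse nz)
    ultimately have wW2: "w j \<in> W2" for j using wW[of j] n unfolding W2_def mem_Collect_eq by metis
    have "(\<Sum>j<d. w j) = (\<Sum>k<d. sv (\<Sum>j<d. z ^ (j * k)) ((S ^^ k) v))"
      unfolding w_def by (subst sum.swap) (simp add: vv.scale_sum_left)
    also have "\<dots> = (\<Sum>k<d. if k = 0 then sv (of_nat d) v else 0)"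
      using root_of_unity_sum by (intro sum.cong) (auto simp: z_def)
    also have "\<dots> = sv (of_nat d) v" using d_pos by simp
    finally have "sv (1 / of_nat d) (\<Sum>j<d. w j) = v" using d_pos by simp
    moreover have "sv (1 / of_nat d) (\<Sum>j<d. w j) \<in> vv.span W2"
      by (intro vv.span_scale vv.span_sum vv.span_base wW2)
    ultimately show ?thesis by simp
  qed
  have "fwords \<subseteq> vv.span (W1 \<union> W2)"
  proof
    fix v assume "v \<in> fwords"
    then obtain n where n: "n \<in> lattice I" "v \<in> wsp n" using fwords_weight by blast
    show "v \<in> vv.span (W1 \<union> W2)"
    proof (cases "pact n = n")
      case True
      then show ?thesis using span2[OF n(2,1)] vv.span_mono[of W2 "W1 \<union> W2"] by blast
    next
      case False
      then show ?thesis using n by (intro vv.span_base) (auto simp: W1_def)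
    qed
  qed
  then have "M \<subseteq> vv.span (W1 \<union> W2)" using span_fwords vv.span_minimal vv.subspace_span by blast
  moreover have WM: "W1 \<union> W2 \<subseteq> M" using wsp_M by (auto simp: W1_def W2_def)
  ultimately have span: "vv.span (W1 \<union> W2) = M" using vv.span_minimal[OF WM subM] by blast
  have "\<exists>n\<in>lattice I. w \<in> wsp n" if "w \<in> W1 \<union> W2" for w using that unfolding W1_def W2_def by blast
  from weight_basis[OF WM span this] obtain B wt
    where B: "wmod sg br C I a e f t sv ac M lam B wt" "B \<subseteq> W1 \<union> W2" by metis
  interpret B: wmod sg br C I a e f t sv ac M lam B wt by (rule B(1))
  show thesis
  proof (rule that[OF B(1)])
    fix b assume b: "b \<in> B" "pact (wt b) = wt b"
    have "b \<noteq> 0" using b B.indB vv.dependent_zero by metis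
    then have "wt b = n" if "b \<in> wsp n" "n \<in> lattice I" for n
      using B.wsp_unique[OF B.wt_wsp[OF b(1)] that(1)] that(2) B.wt_lattice[OF b(1)] by blast
    then have "b \<notin> W1" using b(2) unfolding W1_def by blast
    then show "\<exists>z. norm z = 1 \<and> S b = sv z b" using B(2) b(1) unfolding W2_def by blast
  qed
qed

text \<open>The intertwiner is eliminated here. In the eigenbasis its diagonal entries on an
  invariant weight space have modulus 1, which bounds the trace by the multiplicity.\<close>

theorem twisted_trace:
  obtains B wt u FF where "wmod sg br C I a e f t sv ac M lam B wt"
    "\<And>n. pact n = n \<Longrightarrow> norm (u n) \<le> real (card {b \<in> B. wt b = n})"
    "u 0 = (1::complex)" "\<And>n. (\<exists>j. n j > 0) \<Longrightarrow> u n = 0"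
    "\<And>n. n \<in> lattice I \<Longrightarrow> pact n = n \<Longrightarrow> qD n * u n = 2 * (\<Sum>r\<in>Rp I a. FF r n)"
    "\<And>r n. r \<in> Rp I a \<Longrightarrow> n \<in> lattice I \<Longrightarrow> pact n = n \<Longrightarrow>
        FF r n = FF r (n + beta r) + nuD (n + beta r) r * u (n + beta r)"
    "\<And>r n. (\<exists>j. n j > 0) \<Longrightarrow> FF r n = (0::complex)"
proof -
  obtain S where S: "lin sv S" "\<And>v. S v \<in> M" "\<And>x v. x \<in> C \<Longrightarrow> v \<in> M \<Longrightarrow> S (ac x v) = ac (\<sigma> x) (S v)"
    "S v0 = v0" "\<And>v. v \<in> M \<Longrightarrow> (S ^^ d) v = v" using intertwiner by blast
  obtain B wt where B: "wmod sg br C I a e f t sv ac M lam B wt"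
    "\<And>b. b \<in> B \<Longrightarrow> pact (wt b) = wt b \<Longrightarrow> \<exists>z. norm z = 1 \<and> S b = sv z b"
    using eigenbasis[OF S] by metis
  interpret twmod sg br C I a e f t p \<sigma> d D sv ac M lam v0 B wt S
    by (rule twmod_exists[OF S(1-4) B(1)])
  have "norm (T n) \<le> real (card {b \<in> B. wt b = n})" if n: "pact n = n" for n
  proof -
    have "norm (coord b (S b)) = 1" if b: "b \<in> {b \<in> B. wt b = n}" for b
    proof -
      obtain z where "norm z = 1" "S b = sv z b" using B(2)[of b] b n by auto
      then show ?thesis using b coord_basis[of b b] by (simp add: coord_scale)
    qed
    then show ?thesis unfolding T_def trn_def using sum_norm_le[of "{b \<in> B. wt b = n}" "\<lambda>b. coord b (S b)" "\<lambda>_. 1"] by simp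
  qed
  moreover obtain FF where "\<forall>n. n \<in> lattice I \<longrightarrow> pact n = n \<longrightarrow> qD n * T n = 2 * (\<Sum>r\<in>Rp I a. FF r n)"
     "\<forall>r\<in>Rp I a. \<forall>n. n \<in> lattice I \<longrightarrow> pact n = n \<longrightarrow>
        FF r n = FF r (n + beta r) + nuD (n + beta r) r * T (n + beta r)"
     "\<forall>r n. (\<exists>j. n j > 0) \<longrightarrow> FF r n = (0::complex)"
    using twisted_freudenthal by blast
  ultimately show thesis using that[of B wt T FF] B(1) T_0 T_positive by blast
qed

end

section \<open>Orbit sums of roots\<close>

lemma Rp_lattice: "r \<in> Rp I a \<Longrightarrow> r \<in> lattice I"
  by (induction rule: Rp.induct) (auto intro: lattice_alp srefl_lattice)

context twist begin

lemma sum_pow_shift: fixes r :: "'i \<Rightarrow> int" shows "(\<Sum>k\<in>{1..d}. r ((q ^^ k) j)) = (\<Sum>k<d. r ((q ^^ k) j))"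
proof -
  have "(\<Sum>k\<in>{1..d}. r ((q ^^ k) j)) + r j = (\<Sum>k<Suc d. r ((q ^^ k) j))"
    by (subst sum.lessThan_Suc_shift)
       (simp add: sum.shift_bounds_cl_Suc_ivl[of _ 0 "d - 1", symmetric] sum.atLeast1_atMost_eq add.commute)
  also have "\<dots> = (\<Sum>k<d. r ((q ^^ k) j)) + r j" by (simp add: q_d)
  finally show ?thesis by (rule add_right_imp_eq)
qed

lemma beta_fixed: "pact r = r \<Longrightarrow> beta r = r"
  by (simp add: beta_def period_def)

lemma beta_moved: assumes "pact r \<noteq> r" shows "beta r = psum r"
proof
  fix j show "beta r j = psum r j"
    unfolding beta_def period_def if_not_P[OF assms] sum_fun_apply pact_pow psum_def by (rule sum_pow_shift)
qed

lemma beta_alp: assumes "i \<in> I" shows "beta (alp i) = (\<lambda>j. if j \<in> orb i then 1 else 0)"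
proof (cases "q i = i")
  case True
  then have "p i = i" using pq[of i] by simp
  then have "beta (alp i) = alp i" by (intro beta_fixed) (simp add: pact_alp)
  then show ?thesis using orb_fixed[OF True] by (auto simp: alp_def)
next
  case False
  have "pact (alp i) \<noteq> alp i"
  proof
    assume "pact (alp i) = (alp i :: 'i \<Rightarrow> int)"
    then have "alp (p i) i = (alp i i :: int)" by (simp add: pact_alp)
    then have "p i = i" by (simp add: alp_def split: if_splits)
    then show False using False qp[of i] by simp
  qed
  then have b: "beta (alp i) j = (\<Sum>k<d. alp i ((q ^^ k) j))" for j
    by (simp add: beta_moved psum_def)
  have "(\<Sum>k<d. alp i ((q ^^ k) j)) = (if j \<in> orb i then 1 else (0::int))" for j
  proof (cases "q j = j")
    case True
    then have "j \<noteq> i" using False by auto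
    moreover have "j \<notin> orb i"
    proof
      assume "j \<in> orb i"
      then have "i \<in> {j}" using orb_eq[of j i] orb_self[of i] orb_fixed(1)[OF True] by metis
      then show False using \<open>j \<noteq> i\<close> by simp
    qed
    ultimately show ?thesis using orb_fixed(2)[OF True] by (simp add: alp_def)
  next
    case False
    have "(\<Sum>k<d. alp i ((q ^^ k) j)) = (\<Sum>m\<in>orb j. alp i m)" by (rule sum_orb[OF False])
    also have "\<dots> = (if i \<in> orb j then 1 else 0)" using finite_orb by (simp add: alp_def)
    also have "i \<in> orb j \<longleftrightarrow> j \<in> orb i" using orb_eq orb_self by metis
    finally show ?thesis by simp
  qed
  then show ?thesis using b by (simp add: fun_eq_iff)
qed

lemma pact_inj: "pact r = pact s \<Longrightarrow> r = s"
proof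
  fix j assume "pact r = pact s"
  then have "pact r (p j) = pact s (p j)" by simp
  then show "r j = s j" by (simp add: pact_def)
qed

lemma pact_pow_inj: "(pact ^^ k) r = (pact ^^ k) s \<Longrightarrow> r = s"
  by (induction k) (auto dest: pact_inj)

lemma pact_sO_fixed: assumes "i \<in> I" shows "pact (sO (orb i) r) = sO (orb i) r \<longleftrightarrow> pact r = r"
  using sO_pact[OF assms] sO_sO[OF assms] by metis

lemma sO_sum: "sO A (\<Sum>k\<in>K. g k) = (\<Sum>k\<in>K. sO A (g k))"
  by (induction K rule: infinite_finite_induct)
     (simp_all only: sum.infinite sum.empty sum.insert sO_add simp_thms, simp_all add: sO_def fun_eq_iff)

lemma beta_sO: assumes "i \<in> I" shows "beta (sO (orb i) r) = sO (orb i) (beta r)"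
proof -
  have "period (sO (orb i) r) = period r" using pact_sO_fixed[OF assms] by (simp add: period_def)
  then show ?thesis unfolding beta_def sO_sum sO_pact_pow[OF assms] by simp
qed

lemma beta_ge: assumes "r \<in> Rp I a" shows "r j \<le> beta r j"
proof -
  have "(pact ^^ period r) r j \<le> (\<Sum>k\<in>{1..period r}. (pact ^^ k) r j)"
    using Rp_props[OF pact_pow_Rp[OF assms]] period_pos[of r] by (intro member_le_sum) auto
  then show ?thesis by (simp add: period_pow beta_def sum_fun_apply)
qed

text \<open>The vertices of an orbit are orthogonal, so a root supported there pairs with
  \<open>t j\<close> to twice its coefficient at \<open>j\<close>; reflecting would negate that
  coefficient unless the root is \<open>alp j\<close>.\<close>

lemma orbit_support:
  assumes i: "i \<in> I" and r: "r \<in> Rp I a" and supp: "\<And>j. j \<notin> orb i \<Longrightarrow> r j \<le> 0"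
  shows "r \<in> alp ` orb i"
proof -
  note R = Rp_props[OF r]
  have 0: "r j = 0" if "j \<notin> orb i" for j using supp[OF that] R by (meson antisym)
  obtain j where j: "r j \<noteq> 0" using R by (auto simp: fun_eq_iff)
  then have jO: "j \<in> orb i" using 0 by blast
  have jI: "j \<in> I" using jO orb_I[OF i] by blast
  have "ar r j = (\<Sum>k\<in>I. if k = j then 2 * r j else 0)" unfolding rho_pair_def
  proof (intro sum.cong refl)
    fix k assume "k \<in> I"
    show "a j k * r k = (if k = j then 2 * r j else 0)"
      using a_diag[OF jI] orb_orth[OF i jO, of k] 0[of k] by (cases "k = j"; cases "k \<in> orb i") auto
  qed
  then have ar: "ar r j = 2 * r j" using finI jI by simp
  have "r = alp j"
  proof (rule ccontr)
    assume "r \<noteq> alp j"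
    then have "srefl I a j r j \<ge> 0" using Rp_props[OF Rp_refl[OF r jI]] by blast
    then have "r j \<le> 0" by (simp add: srefl_def ar alp_def)
    moreover have "r j \<ge> 0" using R by blast
    ultimately show False using j by simp
  qed
  then show ?thesis using jO by blast
qed

lemma beta_simple:
  assumes "i \<in> I" "r \<in> Rp I a" "beta r = beta (alp i)"
  shows "r \<in> alp ` orb i"
proof (rule orbit_support[OF assms(1,2)])
  fix j assume "j \<notin> orb i"
  then have "beta r j = 0" using assms beta_alp by simp
  then show "r j \<le> 0" using beta_ge[OF assms(2), of j] by simp
qed

lemma alp_orbit: assumes "j \<in> orb i" shows "\<exists>k. alp j = (pact ^^ k) (alp i)"
proof -
  obtain m where m: "i = (q ^^ m) j" using orb_connected[OF assms] by blast
  have inj: "(q ^^ m) x = (q ^^ m) y \<Longrightarrow> x = y" for x y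
    by (induction m) (auto dest: arg_cong[of _ _ p])
  have "(pact ^^ m) (alp i) = alp j"
    unfolding pact_pow alp_def fun_eq_iff using m inj by metis
  then show ?thesis by metis
qed

lemma neg_not_Rp: "r \<in> Rp I a \<Longrightarrow> - r \<notin> Rp I a"
  using Rp_uminus_disjoint by (metis IntI imageI minus_minus empty_iff)

text \<open>Orbit sums determine orbits. Reflecting both roots over the same orbit reduces the claim
  to a simple root, where the support of the orbit sum decides.\<close>

lemma beta_unique:
  assumes "r \<in> Rp I a" "s \<in> Rp I a" "beta r = beta s"
  shows "\<exists>k. s = (pact ^^ k) r"
  using assms
proof (induction arbitrary: s rule: Rp_orbit_induct)
  case (simple i)
  then have "s \<in> alp ` orb i" using beta_simple[of i s] by simp
  then show ?case using alp_orbit by blast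
next
  case (reduce i r)
  have "s \<notin> alp ` orb i"
  proof
    assume "s \<in> alp ` orb i"
    then obtain j where j: "j \<in> orb i" "s = alp j" by blast
    then have jI: "j \<in> I" using orb_I[OF reduce.hyps(1)] by blast
    have "r \<in> alp ` orb j" using beta_simple[OF jI reduce.hyps(2)] reduce.prems(2) j by simp
    then show False using reduce.hyps(3) orb_I[OF jI] by blast
  qed
  then have "sO (orb i) s \<in> Rp I a" using sO_Rp reduce by blast
  moreover have "beta (sO (orb i) r) = beta (sO (orb i) s)" using reduce by (simp add: beta_sO)
  ultimately obtain k where "sO (orb i) s = (pact ^^ k) (sO (orb i) r)" using reduce.IH by blast
  also have "\<dots> = sO (orb i) ((pact ^^ k) r)" by (rule sO_pact_pow[OF reduce.hyps(1)])
  finally have "s = (pact ^^ k) r" using sO_sO[OF reduce.hyps(1)] by metis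
  then show ?case by blast
qed

lemma period_pact: "period (pact r) = period r"
  unfolding period_def using pact_inj by (metis (full_types))

lemma beta_pact: "beta (pact r) = beta r"
proof -
  have "beta (pact r) = pact (beta r)"
    by (simp add: beta_def period_pact pact_sum funpow_swap1)
  then show ?thesis by (simp add: pact_beta)
qed

lemma beta_pact_pow: "beta ((pact ^^ k) r) = beta r"
  by (induction k) (simp_all add: beta_pact)

lemma pact_pow_mod: "(pact ^^ k) r \<in> (\<lambda>k. (pact ^^ k) r) ` {1..period r}"
proof -
  have *: "(pact ^^ (period r * m)) r = r" for m
  proof (induction m)
    case (Suc m)
    have "(pact ^^ (period r * Suc m)) r = (pact ^^ (period r * m)) ((pact ^^ period r) r)"
      by (simp only: funpow_add[symmetric, THEN fun_cong, unfolded o_apply] mult_Suc_right add.commute)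
    then show ?case using Suc by (simp only: period_pow)
  qed simp
  define l where "l = k mod period r"
  have "(pact ^^ k) r = (pact ^^ (l + period r * (k div period r))) r" by (simp add: l_def)
  also have "\<dots> = (pact ^^ l) r" by (simp only: funpow_add o_apply *)
  finally have eq: "(pact ^^ k) r = (pact ^^ l) r" .
  show ?thesis
  proof (cases "l = 0")
    case True
    then have "(pact ^^ k) r = (pact ^^ period r) r" using eq period_pow by simp
    then show ?thesis using period_pos[of r] by (intro image_eqI[of _ _ "period r"]) auto
  next
    case False
    have "l \<le> period r" using period_pos[of r] by (simp add: l_def less_imp_le)
    then show ?thesis using eq False by (intro image_eqI[of _ _ l]) auto
  qed
qed

text \<open>By \<open>beta_unique\<close> the class is a single orbit, and the powers up to the
  period enumerate it without repetition.\<close>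

lemma sum_beta_class:
  assumes "s \<in> Rp I a"
  shows "(\<Sum>r\<in>{r \<in> Rp I a. beta r = beta s}. r) = beta s"
proof -
  have eq: "{r \<in> Rp I a. beta r = beta s} = (\<lambda>k. (pact ^^ k) s) ` {1..period s}"
  proof
    show "{r \<in> Rp I a. beta r = beta s} \<subseteq> (\<lambda>k. (pact ^^ k) s) ` {1..period s}"
      using beta_unique[OF assms] pact_pow_mod by fastforce
    show "(\<lambda>k. (pact ^^ k) s) ` {1..period s} \<subseteq> {r \<in> Rp I a. beta r = beta s}"
      using pact_pow_Rp[OF assms] beta_pact_pow by auto
  qed
  have inj: "inj_on (\<lambda>k. (pact ^^ k) s) {1..period s}"
  proof (rule linorder_inj_onI)
    fix k l assume kl: "k < l" "k \<in> {1..period s}" "l \<in> {1..period s}"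
    show "(pact ^^ k) s \<noteq> (pact ^^ l) s"
    proof
      assume "(pact ^^ k) s = (pact ^^ l) s"
      then have "(pact ^^ k) s = (pact ^^ k) ((pact ^^ (l - k)) s)"
        using kl by (simp add: funpow_add[symmetric, THEN fun_cong, unfolded o_apply])
      then have "s = (pact ^^ (l - k)) s" by (rule pact_pow_inj)
      moreover have "(pact ^^ (l - k)) s \<noteq> s" using kl by (intro period_not_fixed) auto
      ultimately show False by simp
    qed
  qed auto
  show ?thesis unfolding eq by (subst sum.reindex[OF inj]) (simp add: beta_def)
qed

end

section \<open>Comparison with the dual Lie algebra\<close>

text \<open>\<open>aL\<close> is the transpose of the folded Cartan matrix, in which entries are
  summed over an orbit of coroots. The function \<open>mu\<close> on orbits holds the values of both
  highest weights on simple coroots.\<close>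

locale folding =
  twirr sg br C I a e f t p \<sigma> d D sv ac M lam v0 +
  L: irr sgL brL CL J aL eL fL tL svL acL UL lamL w0
  for sg :: "complex \<Rightarrow> 'g::ab_group_add \<Rightarrow> 'g" and br :: "'g \<Rightarrow> 'g \<Rightarrow> 'g" and C :: "'g set"
    and I :: "'i set" and a :: "'i \<Rightarrow> 'i \<Rightarrow> int" and e f t :: "'i \<Rightarrow> 'g"
    and p :: "'i \<Rightarrow> 'i" and \<sigma> :: "'g \<Rightarrow> 'g" and d :: nat and D :: "'i \<Rightarrow> real"
    and sv :: "complex \<Rightarrow> 'v::ab_group_add \<Rightarrow> 'v" and ac :: "'g \<Rightarrow> 'v \<Rightarrow> 'v" and M :: "'v set"
    and lam :: "'i \<Rightarrow> complex" and v0 :: 'v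
    and sgL :: "complex \<Rightarrow> 'l::ab_group_add \<Rightarrow> 'l" and brL :: "'l \<Rightarrow> 'l \<Rightarrow> 'l" and CL :: "'l set"
    and J :: "'i set set" and aL :: "'i set \<Rightarrow> 'i set \<Rightarrow> int" and eL fL tL :: "'i set \<Rightarrow> 'l"
    and svL :: "complex \<Rightarrow> 'w::ab_group_add \<Rightarrow> 'w" and acL :: "'l \<Rightarrow> 'w \<Rightarrow> 'w" and UL :: "'w set"
    and lamL :: "'i set \<Rightarrow> complex" and w0 :: 'w +
  fixes mu :: "'i set \<Rightarrow> nat"
  assumes D1: "i \<in> I \<Longrightarrow> D i = 1" and J: "J = orb ` I"
    and aL: "P \<in> J \<Longrightarrow> R \<in> J \<Longrightarrow> i \<in> P \<Longrightarrow> aL P R = (\<Sum>j\<in>R. a i j)"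
    and lamL: "P \<in> J \<Longrightarrow> lamL P = of_nat (mu P)"
    and lam: "i \<in> I \<Longrightarrow> lam i = of_nat (mu (orb i))"
begin

lemma J_orb: assumes "P \<in> J" "i \<in> P" shows "i \<in> I \<and> orb i = P"
proof -
  obtain j where "j \<in> I" "P = orb j" using assms(1) unfolding J by blast
  then show ?thesis using orb_I[of j] orb_eq[of i j] assms(2) by blast
qed

lemma orb_J: "i \<in> I \<Longrightarrow> orb i \<in> J"
  by (simp add: J)

lemma sum_orbits: "(\<Sum>i\<in>I. g i) = (\<Sum>P\<in>J. \<Sum>i\<in>P. g i)"
proof -
  have I: "I = \<Union> J" using J_orb orb_self orb_J by blast
  have "(\<Sum>i\<in>\<Union> J. g i) = (\<Sum>P\<in>J. \<Sum>i\<in>P. g i)"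
  proof (subst sum.Union_disjoint)
    show "\<forall>A\<in>J. finite A" using finite_orb unfolding J by blast
    show "\<forall>A\<in>J. \<forall>B\<in>J. A \<noteq> B \<longrightarrow> A \<inter> B = {}" using J_orb by blast
  qed simp
  then show ?thesis using I by simp
qed

definition DL :: "'i set \<Rightarrow> real" where
  "DL P = real (card P)"

lemma a_sym: "i \<in> I \<Longrightarrow> j \<in> I \<Longrightarrow> a i j = a j i"
  using D_sym[of i j] by (simp add: D1)

lemma DL_pos: "P \<in> J \<Longrightarrow> DL P > 0"
  unfolding DL_def J using finite_orb orb_self by (auto simp: card_gt_0_iff)

text \<open>Both sides are the sum of \<open>a\<close> over all pairs in \<open>P\<close> \<times>
  \<open>R\<close>, counted by rows and by columns of the symmetric matrix \<open>a\<close>.\<close>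

lemma DL_sym:
  assumes "P \<in> J" "R \<in> J" shows "DL P * of_int (aL P R) = DL R * of_int (aL R P)"
proof -
  have *: "int (card P) * aL P R = (\<Sum>i\<in>P. \<Sum>j\<in>R. a i j)" if "P \<in> J" "R \<in> J" for P R
  proof -
    have "(\<Sum>i\<in>P. \<Sum>j\<in>R. a i j) = (\<Sum>i\<in>P. aL P R)"
      by (intro sum.cong refl aL[OF that, symmetric])
    then show ?thesis by simp
  qed
  have "(\<Sum>i\<in>P. \<Sum>j\<in>R. a i j) = (\<Sum>j\<in>R. \<Sum>i\<in>P. a j i)"
    by (subst sum.swap, intro sum.cong refl a_sym) (use J_orb assms in blast)+
  then have "int (card P) * aL P R = int (card R) * aL R P" using * assms by simp
  then have "(of_int (int (card P) * aL P R) :: real) = of_int (int (card R) * aL R P)" by (rule arg_cong)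
  then show ?thesis by (simp add: DL_def)
qed

text \<open>For the trivial automorphism the twisted trace counts weight multiplicities.\<close>

lemma dual_twirr: "twirr sgL brL CL J aL eL fL tL id id 2 DL svL acL UL lamL w0"
proof -
  have [simp]: "(id ^^ k) x = x" for k and x :: 'b by (induction k) auto
  show ?thesis
    by unfold_locales (simp_all add: permutes_id lin_def DL_pos DL_sym)
qed

text \<open>Embeds the root lattice of the dual algebra as labels constant on orbits: a simple root
  goes to the sum of the simple roots of its orbit.\<close>

definition E :: "('i set \<Rightarrow> int) \<Rightarrow> 'i \<Rightarrow> int" where
  "E n = (\<lambda>i. if i \<in> I then n (orb i) else 0)"

lemma E_add: "E (n + m) = E n + E m" and E_zero: "E 0 = 0"
  by (auto simp: E_def fun_eq_iff)

lemma E_lattice: "E n \<in> lattice I"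
  by (simp add: lattice_def E_def)

lemma orb_q_eq: "orb (q i) = orb i"
  using orb_eq[of "q i" i] orb_pow[of 1 i] by simp

lemma q_I_iff: "q i \<in> I \<longleftrightarrow> i \<in> I"
  using q_I p_I[of "q i"] by auto

lemma E_pact: "pact (E n) = E n"
  unfolding pact_def E_def orb_q_eq q_I_iff ..

lemma E_inj: assumes "n \<in> lattice J" "m \<in> lattice J" "E n = E m" shows "n = m"
proof
  fix P show "n P = m P"
  proof (cases "P \<in> J")
    case True
    then obtain i where "i \<in> I" "P = orb i" unfolding J by blast
    then show ?thesis using fun_cong[OF assms(3), of i] by (simp add: E_def)
  next
    case False
    then show ?thesis using assms by (simp add: lattice_def)
  qed
qed

lemma E_rho: assumes "i \<in> I" shows "ar (E n) i = rho_pair J aL n (orb i)"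
proof -
  have "ar (E n) i = (\<Sum>P\<in>J. \<Sum>j\<in>P. a i j * E n j)" unfolding rho_pair_def by (rule sum_orbits)
  also have "\<dots> = (\<Sum>P\<in>J. aL (orb i) P * n P)"
  proof (intro sum.cong refl)
    fix P assume P: "P \<in> J"
    have "(\<Sum>j\<in>P. a i j * E n j) = (\<Sum>j\<in>P. a i j * n P)"
      using J_orb[OF P] by (intro sum.cong) (auto simp: E_def)
    then show "(\<Sum>j\<in>P. a i j * E n j) = aL (orb i) P * n P"
      using aL[OF orb_J[OF assms] P orb_self] by (simp add: sum_distrib_right)
  qed
  finally show ?thesis by (simp add: rho_pair_def)
qed

lemma orb_eq_iff: "orb j = orb i \<longleftrightarrow> j \<in> orb i"
  using orb_eq orb_self by metis

lemma E_alp: assumes "i \<in> I" shows "E (alp (orb i)) = beta (alp i)"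
  unfolding beta_alp[OF assms] using orb_I[OF assms]
  by (auto simp: E_def alp_def fun_eq_iff orb_eq_iff)

lemma E_srefl: assumes "i \<in> I" shows "E (srefl J aL (orb i) n) = sO (orb i) (E n)"
proof
  fix j
  show "E (srefl J aL (orb i) n) j = sO (orb i) (E n) j"
  proof (cases "j \<in> I")
    case True
    have Ej: "E m j = m (orb j)" for m using True by (simp add: E_def)
    show ?thesis
    proof (cases "j \<in> orb i")
      case in_orb: True
      then have "orb j = orb i" by (simp only: orb_eq_iff)
      then show ?thesis using in_orb by (simp add: Ej srefl_def sO_def alp_def E_rho[OF True])
    next
      case False
      then have "orb j \<noteq> orb i" by (simp only: orb_eq_iff not_False_eq_True)
      then show ?thesis using False by (simp add: Ej srefl_def sO_def alp_def)
    qed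
  next
    case False
    then show ?thesis using orb_I[OF assms] by (auto simp: E_def sO_def)
  qed
qed

text \<open>Under \<open>E\<close> the simple reflection of the dual at an orbit becomes
  \<open>sO\<close>, and \<open>beta\<close> commutes with \<open>sO\<close>. The case excluded in
  the definition of \<open>Rp\<close> corresponds to \<open>r\<close> being a simple root of that
  orbit.\<close>

lemma dual_root_to_orbit: "\<gamma> \<in> Rp J aL \<Longrightarrow> \<exists>r\<in>Rp I a. beta r = E \<gamma>"
proof (induction rule: Rp.induct)
  case (Rp_simple P)
  then obtain i where i: "i \<in> I" "P = orb i" unfolding J by blast
  then show ?case using E_alp Rp.Rp_simple[of i I a] by metis
next
  case (Rp_refl \<gamma> P)
  then obtain i where i: "i \<in> I" "P = orb i" unfolding J by blast
  obtain r where r: "r \<in> Rp I a" "beta r = E \<gamma>" using Rp_refl.IH by blast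
  have "r \<notin> alp ` orb i"
  proof
    assume "r \<in> alp ` orb i"
    then obtain j where j: "j \<in> orb i" "r = alp j" by blast
    have jI: "j \<in> I" using j(1) orb_I[OF i(1)] by blast
    have "E \<gamma> = E (alp (orb i))" using E_alp[OF jI] r(2) j(2) orb_eq[OF j(1)] by simp
    then have "\<gamma> = alp P"
      using E_inj[of \<gamma> "alp P"] Rp_lattice[OF Rp_refl.hyps(1)] lattice_alp[OF Rp_refl.hyps(2)] i(2) by simp
    then show False using Rp_refl.hyps(3) by simp
  qed
  then have "sO (orb i) r \<in> Rp I a" by (rule sO_Rp[OF i(1) r(1)])
  moreover have "beta (sO (orb i) r) = E (srefl J aL P \<gamma>)"
    using beta_sO[OF i(1)] E_srefl[OF i(1)] r(2) i(2) by simp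
  ultimately show ?case by blast
qed

text \<open>The converse by reflections over orbits. The reflected dual root cannot be the simple
  root of that orbit, since then \<open>r\<close> itself would be negative.\<close>

lemma orbit_to_dual_root: "r \<in> Rp I a \<Longrightarrow> \<exists>\<gamma>\<in>Rp J aL. E \<gamma> = beta r"
proof (induction rule: Rp_orbit_induct)
  case (simple i)
  then show ?case using E_alp Rp.Rp_simple[OF orb_J] by metis
next
  case (reduce i r)
  then obtain \<gamma> where \<gamma>: "\<gamma> \<in> Rp J aL" "E \<gamma> = beta (sO (orb i) r)" by blast
  have "\<gamma> \<noteq> alp (orb i)"
  proof
    assume "\<gamma> = alp (orb i)"
    then have "beta (sO (orb i) r) = beta (alp i)" using \<gamma>(2) E_alp[OF reduce.hyps(1)] by simp
    then obtain j where j: "j \<in> orb i" "sO (orb i) r = alp j"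
      using beta_simple[OF reduce.hyps(1,4)] by blast
    then have "r = - alp j" using sO_sO[OF reduce.hyps(1), of r] sO_alp[OF reduce.hyps(1) j(1)] by simp
    then show False using neg_not_Rp[OF reduce.hyps(2)] reduce.hyps(4) j by simp
  qed
  then have "srefl J aL (orb i) \<gamma> \<in> Rp J aL"
    using Rp_refl[OF \<gamma>(1) orb_J[OF reduce.hyps(1)]] by blast
  moreover have "E (srefl J aL (orb i) \<gamma>) = beta r"
    using E_srefl[OF reduce.hyps(1)] \<gamma>(2) beta_sO[OF reduce.hyps(1), of "sO (orb i) r"]
      sO_sO[OF reduce.hyps(1), of r] by simp
  ultimately show ?case by blast
qed

text \<open>Up to the common scaling, \<open>qL n\<close> is \<open>\<bar>\<mu> + \<rho> + n\<bar>\<^sup>2 - \<bar>\<mu> + \<rho>\<bar>\<^sup>2\<close>. The system below is satisfied by the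
  weight multiplicities of the dual Lie algebra and by the twisted trace.\<close>

definition qL :: "('i set \<Rightarrow> int) \<Rightarrow> real" where
  "qL n = (\<Sum>P\<in>J. DL P * of_int (n P) * of_int (2 * int (mu P) + rho_pair J aL n P + 2))"

definition nuL :: "('i set \<Rightarrow> int) \<Rightarrow> ('i set \<Rightarrow> int) \<Rightarrow> complex" where
  "nuL n r = (\<Sum>P\<in>J. of_real (DL P) * of_int (r P) * (of_nat (mu P) + of_int (rho_pair J aL n P)))"

definition freudenthal_system ::
  "(('i set \<Rightarrow> int) \<Rightarrow> complex) \<Rightarrow> (('i set \<Rightarrow> int) \<Rightarrow> ('i set \<Rightarrow> int) \<Rightarrow> complex) \<Rightarrow> bool" where
  "freudenthal_system u F \<longleftrightarrow> u 0 = 1 \<and>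
     (\<forall>n\<in>lattice J. (\<exists>j. n j > 0) \<longrightarrow> u n = 0 \<and> (\<forall>\<gamma>. F \<gamma> n = 0)) \<and>
     (\<forall>n\<in>lattice J. - of_real (qL n) * u n = 2 * (\<Sum>\<gamma>\<in>Rp J aL. F \<gamma> n)) \<and>
     (\<forall>\<gamma>\<in>Rp J aL. \<forall>n\<in>lattice J. F \<gamma> n = F \<gamma> (n + \<gamma>) + nuL (n + \<gamma>) \<gamma> * u (n + \<gamma>)) \<and>
     (\<forall>n\<in>lattice J. u n \<noteq> 0 \<longrightarrow> n \<noteq> 0 \<longrightarrow> qL n \<noteq> 0)"

text \<open>Induction on the depth below 0. For n \<noteq> 0 either \<open>qL n\<close> is nonzero
  and can be cancelled, or it is zero, and then the last clause of the system makes both solutions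
  vanish at \<open>n\<close>.\<close>

lemma freudenthal_unique:
  assumes "freudenthal_system u F" "freudenthal_system u' F'" "n \<in> lattice J"
  shows "u n = u' n \<and> (\<forall>\<gamma>\<in>Rp J aL. F \<gamma> n = F' \<gamma> n)"
  using assms(3)
proof (induction "nat (- height J n)" arbitrary: n rule: less_induct)
  case less
  note A = assms(1,2)[unfolded freudenthal_system_def]
  show ?case
  proof (cases "\<exists>j. n j > 0")
    case True
    then show ?thesis using A less.prems by simp
  next
    case False
    have step: "F \<gamma> n = F' \<gamma> n" if \<gamma>: "\<gamma> \<in> Rp J aL" for \<gamma>
    proof -
      note G = L.Rp_props[OF \<gamma>]
      have L: "n + \<gamma> \<in> lattice J" using less.prems G by (intro lattice_add) auto
      have "F \<gamma> (n + \<gamma>) = F' \<gamma> (n + \<gamma>) \<and> u (n + \<gamma>) = u' (n + \<gamma>)"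
      proof (cases "\<exists>j. (n + \<gamma>) j > 0")
        case True
        then show ?thesis using A L by simp
      next
        case False
        have "\<exists>P\<in>J. \<gamma> P > 0"
        proof -
          obtain P where P: "\<gamma> P \<noteq> 0" using G by (auto simp: fun_eq_iff)
          moreover have "P \<in> J" using G P by (auto simp: lattice_def)
          moreover have "\<gamma> P \<ge> 0" using G by blast
          ultimately show ?thesis by (intro bexI[of _ P]) auto
        qed
        then have "height J \<gamma> > 0" unfolding height_def using G L.finI by (meson sum_pos2)
        moreover have "height J (n + \<gamma>) = height J n + height J \<gamma>" by (simp add: height_def sum.distrib)
        moreover have "height J (n + \<gamma>) \<le> 0"
          unfolding height_def using False by (intro sum_nonpos) (auto simp: not_less)
        ultimately have "nat (- height J (n + \<gamma>)) < nat (- height J n)" by simp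
        then show ?thesis using less.hyps L \<gamma> by blast
      qed
      then show ?thesis using A \<gamma> less.prems by simp
    qed
    have "u n = u' n"
    proof (cases "n = 0")
      case True
      then show ?thesis using A by simp
    next
      case n0: False
      have "- of_real (qL n) * u n = - of_real (qL n) * u' n"
        using A less.prems step by simp
      then show ?thesis using A less.prems n0 by (cases "qL n = 0") auto
    qed
    then show ?thesis using step by blast
  qed
qed

lemma dual_system:
  obtains B wt F where "wmod sgL brL CL J aL eL fL tL svL acL UL lamL B wt"
    "freudenthal_system (\<lambda>n. of_nat (card {b \<in> B. wt b = n})) F"
proof -
  \<comment> \<open>The locale asks for a prime exponent; 2 is one that annihilates the identity,
    and every period is 1 anyway.\<close>
  interpret T: twirr sgL brL CL J aL eL fL tL id id 2 DL svL acL UL lamL w0 by (rule dual_twirr)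
  obtain B wt where B: "wmod sgL brL CL J aL eL fL tL svL acL UL lamL B wt"
    using L.weight_basis[OF L.fwords_M L.span_fwords L.fwords_weight] by metis
  interpret W: wmod sgL brL CL J aL eL fL tL svL acL UL lamL B wt by (rule B)
  interpret T: twmod sgL brL CL J aL eL fL tL id id 2 DL svL acL UL lamL w0 B wt id
    by unfold_locales (simp_all add: lin_def)
  have pact: "T.pact r = r" for r by (simp add: T.pact_def)
  have beta: "T.beta r = r" for r by (rule T.beta_fixed[OF pact])
  have T: "T.T n = of_nat (card {b \<in> B. wt b = n})" for n
    using W.coord_basis by (simp add: T.T_def T.trn_def)
  have q: "T.qD n = - of_real (qL n)" for n
    unfolding T.qD_def qL_def of_real_sum by (intro arg_cong[of _ _ uminus] sum.cong) (simp_all add: lamL)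
  have nu: "T.nuD n r = nuL n r" for n r
    unfolding T.nuD_def nuL_def by (intro sum.cong) (simp_all add: lamL L.ev_def)
  obtain FF where FF: "\<And>n. n \<in> lattice J \<Longrightarrow> T.qD n * T.T n = 2 * (\<Sum>r\<in>Rp J aL. FF r n)"
     "\<And>r n. r \<in> Rp J aL \<Longrightarrow> n \<in> lattice J \<Longrightarrow> FF r n = FF r (n + r) + T.nuD (n + r) r * T.T (n + r)"
     "\<And>r n. (\<exists>j. n j > 0) \<Longrightarrow> FF r n = 0"
    using T.twisted_freudenthal unfolding pact beta by blast
  have pos: "qL n \<noteq> 0" if n: "n \<in> lattice J" "n \<noteq> 0" and T: "T.T n \<noteq> 0" for n
  proof -
    have "{b \<in> B. wt b = n} \<noteq> {}" using T unfolding T.T_def T.trn_def by (metis sum.empty)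
    then obtain b where b: "b \<in> B" "wt b = n" by blast
    have "b \<noteq> 0" using b W.indB L.vv.dependent_zero by metis
    then show ?thesis
      using L.highest_norm_positive[OF DL_sym DL_pos lamL, of b n] W.wt_wsp[OF b(1)] b(2) n
      unfolding qL_def by simp
  qed
  have "freudenthal_system T.T FF"
    unfolding freudenthal_system_def using FF T.T_0 T.T_positive pos by (auto simp: q nu)
  moreover have "T.T = (\<lambda>n. of_nat (card {b \<in> B. wt b = n}))" by (rule ext) (rule T)
  ultimately show thesis using that[OF B, of FF] by simp
qed

lemma finite_dual_roots: "finite (Rp J aL)"
  by (rule L.finite_Rp)

lemma sum_Rp_classes: "(\<Sum>\<gamma>\<in>Rp J aL. \<Sum>r\<in>{r \<in> Rp I a. beta r = E \<gamma>}. g r) = (\<Sum>r\<in>Rp I a. g r)"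
proof -
  have "Rp I a = (\<Union>\<gamma>\<in>Rp J aL. {r \<in> Rp I a. beta r = E \<gamma>})"
    using orbit_to_dual_root by fastforce
  then have "(\<Sum>r\<in>Rp I a. g r) = (\<Sum>r\<in>(\<Union>\<gamma>\<in>Rp J aL. {r \<in> Rp I a. beta r = E \<gamma>}). g r)" by simp
  also have "\<dots> = (\<Sum>\<gamma>\<in>Rp J aL. \<Sum>r\<in>{r \<in> Rp I a. beta r = E \<gamma>}. g r)"
  proof (rule sum.UNION_disjoint)
    show "finite (Rp J aL)" by (rule finite_dual_roots)
    show "\<forall>\<gamma>\<in>Rp J aL. finite {r \<in> Rp I a. beta r = E \<gamma>}" using finite_Rp by simp
    show "\<forall>\<gamma>\<in>Rp J aL. \<forall>\<delta>\<in>Rp J aL. \<gamma> \<noteq> \<delta> \<longrightarrow>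
        {r \<in> Rp I a. beta r = E \<gamma>} \<inter> {r \<in> Rp I a. beta r = E \<delta>} = {}"
      using E_inj Rp_lattice by fastforce
  qed
  finally show ?thesis by simp
qed

lemma class_sum: assumes "\<gamma> \<in> Rp J aL" shows "(\<Sum>r\<in>{r \<in> Rp I a. beta r = E \<gamma>}. r i) = E \<gamma> i"
proof -
  obtain s where s: "s \<in> Rp I a" "beta s = E \<gamma>" using dual_root_to_orbit[OF assms] by blast
  show ?thesis using fun_cong[OF sum_beta_class[OF s(1)], of i] unfolding s(2) sum_fun_apply .
qed

lemma sum_orbit_const:
  assumes "\<And>P i. P \<in> J \<Longrightarrow> i \<in> P \<Longrightarrow> g i = h P"
  shows "(\<Sum>i\<in>I. g i) = (\<Sum>P\<in>J. of_nat (card P) * h P)"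
  unfolding sum_orbits using assms by (intro sum.cong) simp_all

lemma E_J: "P \<in> J \<Longrightarrow> i \<in> P \<Longrightarrow> E n i = n P"
  using J_orb by (auto simp: E_def)

lemma E_rho_J: "P \<in> J \<Longrightarrow> i \<in> P \<Longrightarrow> ar (E n) i = rho_pair J aL n P"
  using J_orb[of P i] E_rho[of i n] by simp

lemma qL_E: "(\<Sum>i\<in>I. D i * of_int (E n i) * of_int (2 * int (mu (orb i)) + ar (E n) i + 2)) = qL n"
proof -
  have "(\<Sum>i\<in>I. D i * of_int (E n i) * of_int (2 * int (mu (orb i)) + ar (E n) i + 2)) =
      (\<Sum>P\<in>J. of_nat (card P) * (of_int (n P) * of_int (2 * int (mu P) + rho_pair J aL n P + 2)))"
    by (rule sum_orbit_const) (use J_orb in \<open>simp add: E_J E_rho_J D1\<close>)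
  then show ?thesis by (simp add: qL_def DL_def mult.assoc)
qed

lemma qD_E: "qD (E n) = - of_real (qL n)"
proof -
  have "qD (E n) = - (\<Sum>i\<in>I. of_real (D i * of_int (E n i) * of_int (2 * int (mu (orb i)) + ar (E n) i + 2)))"
    unfolding qD_def by (intro arg_cong[of _ _ uminus] sum.cong refl) (simp add: lam)
  then show ?thesis by (simp only: of_real_sum[symmetric] qL_E)
qed

text \<open>\<open>nuD\<close> is linear in the root, so summing over an orbit puts the orbit sum in
  place of the root. The remaining summands are constant on each orbit, whose size supplies the
  factor \<open>DL P\<close>.\<close>

lemma nuD_E:
  assumes "\<gamma> \<in> Rp J aL"
  shows "(\<Sum>r\<in>{r \<in> Rp I a. beta r = E \<gamma>}. nuD (E n) r) = nuL n \<gamma>"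
proof -
  let ?R = "{r \<in> Rp I a. beta r = E \<gamma>}"
  have "(\<Sum>r\<in>?R. nuD (E n) r) = (\<Sum>i\<in>I. \<Sum>r\<in>?R. of_real (D i) * of_int (r i) * ev (E n) i)"
    unfolding nuD_def by (rule sum.swap)
  also have "\<dots> = (\<Sum>i\<in>I. of_real (D i) * of_int (\<Sum>r\<in>?R. r i) * ev (E n) i)"
    by (simp add: sum_distrib_left sum_distrib_right)
  also have "\<dots> = (\<Sum>P\<in>J. of_nat (card P) * (of_int (\<gamma> P) * (of_nat (mu P) + of_int (rho_pair J aL n P))))"
    unfolding class_sum[OF assms]
    by (rule sum_orbit_const) (use J_orb in \<open>simp add: E_J E_rho_J D1 ev_def lam\<close>)
  finally show ?thesis by (simp add: nuL_def DL_def mult.assoc)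
qed

text \<open>The roots of one orbit share the shift \<open>beta r\<close>, so their auxiliary
  functions add up to one function per dual root. Where \<open>u\<close> is nonzero the bound
  provides an actual weight, and \<open>highest_norm_positive\<close> gives the nonvanishing of
  \<open>qL\<close>.\<close>

lemma folded_system:
  obtains B wt u F where "wmod sg br C I a e f t sv ac M lam B wt" "freudenthal_system u F"
    "\<And>n. norm (u n) \<le> real (card {b \<in> B. wt b = E n})"
proof -
  obtain B wt u FF where B: "wmod sg br C I a e f t sv ac M lam B wt"
    and norm: "\<And>n. pact n = n \<Longrightarrow> norm (u n) \<le> real (card {b \<in> B. wt b = n})"
    and u0: "u 0 = (1::complex)" and upos: "\<And>n. (\<exists>j. n j > 0) \<Longrightarrow> u n = 0"
    and rec: "\<And>n. n \<in> lattice I \<Longrightarrow> pact n = n \<Longrightarrow> qD n * u n = 2 * (\<Sum>r\<in>Rp I a. FF r n)"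
    and step: "\<And>r n. r \<in> Rp I a \<Longrightarrow> n \<in> lattice I \<Longrightarrow> pact n = n \<Longrightarrow>
        FF r n = FF r (n + beta r) + nuD (n + beta r) r * u (n + beta r)"
    and Fpos: "\<And>r n. (\<exists>j. n j > 0) \<Longrightarrow> FF r n = (0::complex)"
    using twisted_trace by blast
  interpret W: wmod sg br C I a e f t sv ac M lam B wt by (rule B)
  define F where "F = (\<lambda>\<gamma> n. \<Sum>r\<in>{r \<in> Rp I a. beta r = E \<gamma>}. FF r (E n))"
  have pos: "\<exists>j. E n j > 0" if n: "n \<in> lattice J" "\<exists>j. n j > 0" for n
  proof -
    obtain P where P: "n P > 0" using n by blast
    then have "P \<in> J" using n(1) by (force simp: lattice_def)
    then obtain i where "i \<in> I" "P = orb i" unfolding J by blast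
    then show ?thesis using P by (intro exI[of _ i]) (simp add: E_def)
  qed
  have "freudenthal_system (\<lambda>n. u (E n)) F"
    unfolding freudenthal_system_def
  proof (intro conjI ballI impI allI)
    show "u (E 0) = 1" by (simp only: E_zero u0)
    fix n assume n: "n \<in> lattice J"
    show "- of_real (qL n) * u (E n) = 2 * (\<Sum>\<gamma>\<in>Rp J aL. F \<gamma> n)"
      using rec[OF E_lattice E_pact, of n] unfolding F_def sum_Rp_classes qD_E .
    { assume "\<exists>j. n j > 0"
      from pos[OF n this] show "u (E n) = 0" "F \<gamma> n = 0" for \<gamma> by (simp_all add: upos F_def Fpos) }
    { fix \<gamma> assume \<gamma>: "\<gamma> \<in> Rp J aL"
      have "F \<gamma> n = (\<Sum>r\<in>{r \<in> Rp I a. beta r = E \<gamma>}. FF r (E (n + \<gamma>)) + nuD (E (n + \<gamma>)) r * u (E (n + \<gamma>)))"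
        unfolding F_def
      proof (intro sum.cong refl)
        fix r assume r: "r \<in> {r \<in> Rp I a. beta r = E \<gamma>}"
        then have "E n + beta r = E (n + \<gamma>)" by (simp add: E_add)
        then show "FF r (E n) = FF r (E (n + \<gamma>)) + nuD (E (n + \<gamma>)) r * u (E (n + \<gamma>))"
          using step[of r "E n", OF _ E_lattice E_pact] r by simp
      qed
      also have "\<dots> = F \<gamma> (n + \<gamma>) + (\<Sum>r\<in>{r \<in> Rp I a. beta r = E \<gamma>}. nuD (E (n + \<gamma>)) r) * u (E (n + \<gamma>))"
        unfolding F_def by (simp only: sum.distrib sum_distrib_right)
      finally show "F \<gamma> n = F \<gamma> (n + \<gamma>) + nuL (n + \<gamma>) \<gamma> * u (E (n + \<gamma>))"
        unfolding nuD_E[OF \<gamma>] . }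
    { assume nz: "u (E n) \<noteq> 0" "n \<noteq> 0"
      have "0 < norm (u (E n))" using nz by simp
      also have "\<dots> \<le> real (card {b \<in> B. wt b = E n})" by (rule norm[OF E_pact])
      finally have "{b \<in> B. wt b = E n} \<noteq> {}" by (auto simp: card_gt_0_iff)
      then obtain b where b: "b \<in> B" "wt b = E n" by blast
      have b0: "b \<noteq> 0" using b W.indB vv.dependent_zero by metis
      have "E n \<noteq> 0" using E_inj[OF n lattice_zero] nz(2) E_zero by metis
      then have "(\<Sum>i\<in>I. D i * of_int (E n i) * of_int (2 * int (mu (orb i)) + ar (E n) i + 2)) < 0"
        using highest_norm_positive[of D "\<lambda>i. mu (orb i)" b "E n"] D_sym D_pos lam b0 W.wt_wsp[OF b(1)] b(2)
          E_lattice by simp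
      then show "qL n \<noteq> 0" unfolding qL_E by simp }
  qed
  then show thesis using that[OF B, of "\<lambda>n. u (E n)" F] norm[OF E_pact] by blast
qed

text \<open>The inequality is summed over the weights of the dual module; \<open>E\<close> is
  injective, so different weights use disjoint parts of \<open>B\<close>.\<close>

theorem dimension_le:
  obtains B' B where "fbasis svL B' UL" "fbasis sv B M" "card B' \<le> card B"
proof -
  obtain B' wt' F' where B': "wmod sgL brL CL J aL eL fL tL svL acL UL lamL B' wt'"
    and S': "freudenthal_system (\<lambda>n. of_nat (card {b \<in> B'. wt' b = n})) F'" by (rule dual_system)
  obtain B wt u F where B: "wmod sg br C I a e f t sv ac M lam B wt"
    and S: "freudenthal_system u F" and norm: "\<And>n. norm (u n) \<le> real (card {b \<in> B. wt b = E n})"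
    by (rule folded_system) blast
  interpret W': wmod sgL brL CL J aL eL fL tL svL acL UL lamL B' wt' by (rule B')
  interpret W: wmod sg br C I a e f t sv ac M lam B wt by (rule B)
  have le: "card {b \<in> B'. wt' b = n} \<le> card {b \<in> B. wt b = E n}" if "n \<in> lattice J" for n
  proof -
    have "u n = of_nat (card {b \<in> B'. wt' b = n})"
      using freudenthal_unique[OF S S' that] by blast
    then have "real (card {b \<in> B'. wt' b = n}) = norm (u n)" by simp
    also have "\<dots> \<le> real (card {b \<in> B. wt b = E n})" by (rule norm)
    finally show ?thesis by simp
  qed
  have fin: "finite (wt' ` B')" using W'.finB by simp
  have "card B' = card (\<Union>n\<in>wt' ` B'. {b \<in> B'. wt' b = n})" by (rule arg_cong[of _ _ card]) auto
  also have "\<dots> = (\<Sum>n\<in>wt' ` B'. card {b \<in> B'. wt' b = n})"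
    using fin W'.finB by (intro card_UN_disjoint) auto
  also have "\<dots> \<le> (\<Sum>n\<in>wt' ` B'. card {b \<in> B. wt b = E n})"
    using le W'.wt_lattice by (intro sum_mono) auto
  also have "\<dots> = card (\<Union>n\<in>wt' ` B'. {b \<in> B. wt b = E n})"
  proof (rule card_UN_disjoint[symmetric])
    show "\<forall>n\<in>wt' ` B'. \<forall>m\<in>wt' ` B'. n \<noteq> m \<longrightarrow> {b \<in> B. wt b = E n} \<inter> {b \<in> B. wt b = E m} = {}"
      using E_inj W'.wt_lattice by fastforce
  qed (use fin W.finB in auto)
  also have "\<dots> \<le> card B" using W.finB by (intro card_mono) auto
  finally show thesis by (rule that[OF W'.fbasis_axioms W.fbasis_axioms])
qed

end

section \<open>Tensor products\<close>

lemma vs_tensor: "vector_space (tensor_scale :: complex \<Rightarrow> ('f \<Rightarrow> complex) \<Rightarrow> 'f \<Rightarrow> complex)"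
  by unfold_locales (simp_all add: tensor_scale_def fun_eq_iff algebra_simps)

lemma linear_form_on_sum:
  assumes "vector_space s" "module.subspace s U" "linear_form_on s U u" "\<And>b. b \<in> A \<Longrightarrow> g b \<in> U"
  shows "u (\<Sum>b\<in>A. s (c b) (g b)) = (\<Sum>b\<in>A. c b * u (g b))"
proof -
  interpret vector_space s by fact
  have "u (s 0 0) = 0 * u 0"
    using assms(3) subspace_0[OF assms(2)] unfolding linear_form_on_def by blast
  then have u0: "u 0 = 0" by simp
  show ?thesis using assms(4)
  proof (induction A rule: infinite_finite_induct)
    case (insert x A)
    have "s (c x) (g x) \<in> U" "(\<Sum>b\<in>A. s (c b) (g b)) \<in> U" "g x \<in> U"
      using insert.prems assms(2) by (auto intro: subspace_scale subspace_sum)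
    then show ?case using insert assms(3) unfolding linear_form_on_def by simp
  qed (simp_all add: u0)
qed

lemma pure_tensor_expand:
  assumes V: "vector_space (vscale (V k))" "module.subspace (vscale (V k)) (space (V k))"
    and v: "v \<in> (\<Pi>\<^sub>E k\<in>K. space (V k))" "k \<in> K" and g: "\<And>b. b \<in> A \<Longrightarrow> g b \<in> space (V k)"
  shows "pure_tensor K V (v(k := \<Sum>b\<in>A. vscale (V k) (c b) (g b))) =
    (\<Sum>b\<in>A. tensor_scale (c b) (pure_tensor K V (v(k := g b))))"
proof
  fix \<phi>
  show "pure_tensor K V (v(k := \<Sum>b\<in>A. vscale (V k) (c b) (g b))) \<phi> =
      (\<Sum>b\<in>A. tensor_scale (c b) (pure_tensor K V (v(k := g b)))) \<phi>"
  proof (cases "multilinear_form K V \<phi>")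
    case True
    then have "linear_form_on (vscale (V k)) (space (V k)) (\<lambda>a. \<phi> (v(k := a)))"
      using v unfolding multilinear_form_def by blast
    from linear_form_on_sum[OF V this g] True show ?thesis
      by (simp add: sum_fun_apply pure_tensor_def tensor_scale_def)
  qed (simp add: sum_fun_apply pure_tensor_def tensor_scale_def)
qed

text \<open>The factors are expanded in their bases one position at a time; \<open>A\<close> is the
  set of positions that are still arbitrary.\<close>

lemma tensor_spanned:
  assumes K: "finite K"
    and B: "\<And>k. k \<in> K \<Longrightarrow> fbasis (vscale (V k)) (B k) (space (V k))"
    and v: "v \<in> (\<Pi>\<^sub>E k\<in>K. space (V k))"
  shows "pure_tensor K V v \<in> module.span tensor_scale (pure_tensor K V ` (\<Pi>\<^sub>E k\<in>K. B k))"
proof -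
  interpret ts: vector_space "tensor_scale :: complex \<Rightarrow> ((('a \<Rightarrow> 'b) \<Rightarrow> complex) \<Rightarrow> complex) \<Rightarrow> _"
    by (rule vs_tensor)
  let ?S = "ts.span (pure_tensor K V ` (\<Pi>\<^sub>E k\<in>K. B k))"
  have "\<forall>v\<in>(\<Pi>\<^sub>E k\<in>K. space (V k)). (\<forall>k\<in>K - A. v k \<in> B k) \<longrightarrow> pure_tensor K V v \<in> ?S" if "A \<subseteq> K" for A
    using finite_subset[OF that K] that
  proof (induction A rule: finite_induct)
    case empty
    show ?case by (auto intro!: ts.span_base simp: PiE_def)
  next
    case (insert k A)
    show ?case
    proof (intro ballI impI)
      fix v assume v: "v \<in> (\<Pi>\<^sub>E k\<in>K. space (V k))" "\<forall>j\<in>K - insert k A. v j \<in> B j"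
      have k: "k \<in> K" using insert.prems by simp
      interpret Bk: fbasis "vscale (V k)" "B k" "space (V k)" by (rule B[OF k])
      have vk: "v k \<in> space (V k)" using v k by auto
      have "pure_tensor K V v = pure_tensor K V (v(k := \<Sum>b\<in>B k. vscale (V k) (Bk.coord b (v k)) b))"
        by (simp only: Bk.expand[OF vk, symmetric] fun_upd_triv)
      also have "\<dots> = (\<Sum>b\<in>B k. tensor_scale (Bk.coord b (v k)) (pure_tensor K V (v(k := b))))"
        by (rule pure_tensor_expand) (use Bk.vector_space_axioms Bk.subspace_M Bk.B_sub v k in auto)
      also have "\<dots> \<in> ?S"
      proof (intro ts.span_sum ts.span_scale)
        fix b assume b: "b \<in> B k"
        have "v(k := b) \<in> (\<Pi>\<^sub>E k\<in>K. space (V k))" using v(1) k b Bk.B_sub by (auto simp: PiE_def extensional_def)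
        moreover have "\<forall>j\<in>K - A. (v(k := b)) j \<in> B j" using v(2) b by auto
        ultimately show "pure_tensor K V (v(k := b)) \<in> ?S" using insert.IH insert.prems by blast
      qed
      finally show "pure_tensor K V v \<in> ?S" .
    qed
  qed
  from this[of K] v show ?thesis by auto
qed

text \<open>Products of coordinate functionals are multilinear forms, and as arguments of the
  tensors they form a system dual to the pure tensors of basis vectors.\<close>

lemma tensor_basis_independent:
  assumes K: "finite K"
    and B: "\<And>k. k \<in> K \<Longrightarrow> fbasis (vscale (V k)) (B k) (space (V k))"
  shows "inj_on (pure_tensor K V) (\<Pi>\<^sub>E k\<in>K. B k)"
    "\<not> module.dependent tensor_scale (pure_tensor K V ` (\<Pi>\<^sub>E k\<in>K. B k))"
proof -
  interpret ts: vector_space "tensor_scale :: complex \<Rightarrow> ((('a \<Rightarrow> 'b) \<Rightarrow> complex) \<Rightarrow> complex) \<Rightarrow> _"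
    by (rule vs_tensor)
  let ?P = "\<Pi>\<^sub>E k\<in>K. B k"
  define \<phi> where "\<phi> = (\<lambda>b v. \<Prod>k\<in>K. fbasis.coord (vscale (V k)) (B k) (b k) (v k))"
  have ml: "multilinear_form K V (\<phi> b)" for b
    unfolding multilinear_form_def
  proof (intro ballI)
    fix v k assume k: "k \<in> K"
    interpret Bk: fbasis "vscale (V k)" "B k" "space (V k)" by (rule B[OF k])
    have "\<phi> b (v(k := x)) = Bk.coord (b k) x * (\<Prod>j\<in>K - {k}. fbasis.coord (vscale (V j)) (B j) (b j) (v j))" for x
      unfolding \<phi>_def using K k by (subst prod.remove[of K k]) (auto intro!: prod.cong)
    then show "linear_form_on (vscale (V k)) (space (V k)) (\<lambda>a. \<phi> b (v(k := a)))"
      unfolding linear_form_on_def by (simp add: Bk.coord_add Bk.coord_scale distrib_right)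
  qed
  have eval: "pure_tensor K V c (\<phi> b) = (if b = c then 1 else 0)" if bc: "b \<in> ?P" "c \<in> ?P" for b c
  proof -
    have coord: "fbasis.coord (vscale (V k)) (B k) (b k) (c k) = (if b k = c k then 1 else 0)" if k: "k \<in> K" for k
    proof -
      interpret Bk: fbasis "vscale (V k)" "B k" "space (V k)" by (rule B[OF k])
      show ?thesis by (rule Bk.coord_basis[OF PiE_mem[OF bc(2) k]])
    qed
    have "\<phi> b c = (if b = c then 1 else 0)"
    proof (cases "b = c")
      case False
      then obtain k where "k \<in> K" "b k \<noteq> c k" using bc by (meson PiE_ext)
      then have "\<phi> b c = 0" unfolding \<phi>_def using K coord by (intro prod_zero) auto
      then show ?thesis using False by simp
    next
      case True
      have "\<phi> b c = (\<Prod>k\<in>K. 1)" unfolding \<phi>_def using coord True by (intro prod.cong) auto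
      then show ?thesis using True by simp
    qed
    then show ?thesis using ml by (simp add: pure_tensor_def)
  qed
  show inj: "inj_on (pure_tensor K V) ?P"
  proof (rule inj_onI)
    fix b c assume bc: "b \<in> ?P" "c \<in> ?P" "pure_tensor K V b = pure_tensor K V c"
    then have "pure_tensor K V c (\<phi> b) = 1" using eval[of b b] by simp
    then show "b = c" using eval[OF bc(1,2)] by (simp split: if_splits)
  qed
  have fin: "finite ?P" by (intro finite_PiE K fbasis.finB[OF B])
  show "ts.independent (pure_tensor K V ` ?P)"
  proof
    assume "ts.dependent (pure_tensor K V ` ?P)"
    then have "\<exists>u. (\<exists>x\<in>pure_tensor K V ` ?P. u x \<noteq> 0) \<and>
        (\<Sum>x\<in>pure_tensor K V ` ?P. tensor_scale (u x) x) = 0"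
      unfolding ts.dependent_finite[OF finite_imageI[OF fin]] .
    then obtain u where u: "\<exists>x\<in>pure_tensor K V ` ?P. u x \<noteq> 0"
      "(\<Sum>x\<in>pure_tensor K V ` ?P. tensor_scale (u x) x) = 0" by (elim exE conjE)
    obtain b where b: "b \<in> ?P" "u (pure_tensor K V b) \<noteq> 0" using u(1) by (elim bexE imageE) simp
    have "(\<Sum>c\<in>?P. tensor_scale (u (pure_tensor K V c)) (pure_tensor K V c)) = 0"
      using u(2) unfolding sum.reindex[OF inj] o_def .
    then have "(\<Sum>c\<in>?P. tensor_scale (u (pure_tensor K V c)) (pure_tensor K V c)) (\<phi> b) = 0"
      by (simp only: zero_fun_apply)
    then have "(\<Sum>c\<in>?P. tensor_scale (u (pure_tensor K V c)) (pure_tensor K V c) (\<phi> b)) = 0"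
      unfolding sum_fun_apply .
    moreover have "(\<Sum>c\<in>?P. tensor_scale (u (pure_tensor K V c)) (pure_tensor K V c) (\<phi> b)) =
        (\<Sum>c\<in>?P. if c = b then u (pure_tensor K V c) else 0)"
      by (intro sum.cong refl) (simp add: tensor_scale_def eval[OF b(1)])
    ultimately show False using b fin by simp
  qed
qed

text \<open>A basis \<open>C\<close> of the source taken among its basis tensors has at most as many
  elements as there are basis tensors of the target; an injection into these independent vectors
  extends to an injective linear map.\<close>

lemma tensor_embeds:
  assumes K: "finite K"
    and B: "\<And>k. k \<in> K \<Longrightarrow> fbasis (vscale (V k)) (B k) (space (V k))"
    and B': "\<And>k. k \<in> K \<Longrightarrow> fbasis (vscale (W k)) (B' k) (space (W k))"
    and card: "\<And>k. k \<in> K \<Longrightarrow> card (B k) \<le> card (B' k)"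
  shows "vector_space_embeds (tensor_module K V) (tensor_module K W)"
proof -
  interpret ts: vector_space "tensor_scale :: complex \<Rightarrow> ((('a \<Rightarrow> 'b) \<Rightarrow> complex) \<Rightarrow> complex) \<Rightarrow> _"
    by (rule vs_tensor)
  interpret tt: vector_space "tensor_scale :: complex \<Rightarrow> ((('a \<Rightarrow> 'd) \<Rightarrow> complex) \<Rightarrow> complex) \<Rightarrow> _"
    by (rule vs_tensor)
  interpret pair: vector_space_pair "tensor_scale :: complex \<Rightarrow> ((('a \<Rightarrow> 'b) \<Rightarrow> complex) \<Rightarrow> complex) \<Rightarrow> _"
    "tensor_scale :: complex \<Rightarrow> ((('a \<Rightarrow> 'd) \<Rightarrow> complex) \<Rightarrow> complex) \<Rightarrow> _" ..
  let ?P = "\<Pi>\<^sub>E k\<in>K. B k" and ?P' = "\<Pi>\<^sub>E k\<in>K. B' k"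
  let ?S = "ts.span (pure_tensor K V ` (\<Pi>\<^sub>E k\<in>K. space (V k)))"
  have finP: "finite ?P" using fbasis.finB[OF B] by (intro finite_PiE K)
  have finP': "finite ?P'" using fbasis.finB[OF B'] by (intro finite_PiE K)
  have "?S \<subseteq> ts.span (pure_tensor K V ` ?P)"
    using tensor_spanned[OF K B] by (intro ts.span_minimal) auto
  obtain C where C: "C \<subseteq> pure_tensor K V ` ?P" "ts.independent C" "pure_tensor K V ` ?P \<subseteq> ts.span C"
    using ts.maximal_independent_subset by blast
  have finC: "finite C" using C(1) finP by (meson finite_imageI finite_subset)
  have "?S \<subseteq> ts.span C"
    using \<open>?S \<subseteq> ts.span (pure_tensor K V ` ?P)\<close> ts.span_minimal[OF C(3)] by auto
  let ?T = "pure_tensor K W ` ?P'"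
  have "card C \<le> card ?P" using C(1) finP by (meson card_image_le card_mono finite_imageI le_trans)
  also have "\<dots> = (\<Prod>k\<in>K. card (B k))" by (rule card_PiE[OF K])
  also have "\<dots> \<le> (\<Prod>k\<in>K. card (B' k))" using card by (intro prod_mono) auto
  also have "\<dots> = card ?P'" by (rule card_PiE[OF K, symmetric])
  also have "\<dots> = card ?T" using tensor_basis_independent(1)[OF K B'] by (intro card_image[symmetric])
  finally obtain j where j: "j ` C \<subseteq> ?T" "inj_on j C"
    using card_le_inj[OF finC finite_imageI[OF finP']] by blast
  define F where "F = pair.construct C j"
  have lin: "Vector_Spaces.linear tensor_scale tensor_scale F"
    unfolding F_def by (rule pair.linear_construct[OF C(2)])
  interpret F: Vector_Spaces.linear "tensor_scale :: complex \<Rightarrow> ((('a \<Rightarrow> 'b) \<Rightarrow> complex) \<Rightarrow> complex) \<Rightarrow> _"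
    "tensor_scale :: complex \<Rightarrow> ((('a \<Rightarrow> 'd) \<Rightarrow> complex) \<Rightarrow> complex) \<Rightarrow> _" F by (rule lin)
  have FC: "F c = j c" if "c \<in> C" for c unfolding F_def by (rule pair.construct_basis[OF C(2) that])
  have FjC: "F ` C = j ` C" using FC by auto
  have "tt.independent (F ` C)"
    unfolding FjC by (rule tt.independent_mono[OF tensor_basis_independent(2)[OF K B'] j(1)])
  moreover have "inj_on F C" using j(2) FC by (simp add: inj_on_def)
  ultimately have inj: "inj_on F (ts.span C)" by (rule F.inj_on_span_independent_image)
  have "F ` ts.span C = tt.span (j ` C)" unfolding FjC[symmetric] by (rule F.span_image[symmetric])
  also have "\<dots> \<subseteq> tt.span (pure_tensor K W ` (\<Pi>\<^sub>E k\<in>K. space (W k)))"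
  proof (rule tt.span_mono)
    have "?P' \<subseteq> (\<Pi>\<^sub>E k\<in>K. space (W k))" by (intro PiE_mono fbasis.B_sub[OF B'])
    then show "j ` C \<subseteq> pure_tensor K W ` (\<Pi>\<^sub>E k\<in>K. space (W k))" using j(1) by blast
  qed
  finally have "F ` ts.span C \<subseteq> tt.span (pure_tensor K W ` (\<Pi>\<^sub>E k\<in>K. space (W k)))" .
  then show ?thesis
    unfolding vector_space_embeds_def tensor_module_def
    using lin inj \<open>?S \<subseteq> ts.span C\<close> by (intro exI[of _ F]) (auto intro: inj_on_subset)
qed

section \<open>The folded Lie algebra\<close>

text \<open>Composing the bracket and the actions with projections onto the carriers makes them bilinear
  on the ambient types.\<close>

definition gproj :: "(complex \<Rightarrow> 'v::ab_group_add \<Rightarrow> 'v) \<Rightarrow> 'v set \<Rightarrow> 'v \<Rightarrow> 'v" where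
  "gproj s U = fbasis.proj s (SOME B. fbasis s B U)"

lemma gproj:
  assumes "vector_space s" "finite_dim s U"
  shows "gproj s U (v + w) = gproj s U v + gproj s U w" "gproj s U (s c v) = s c (gproj s U v)"
    "gproj s U v \<in> U" "v \<in> U \<Longrightarrow> gproj s U v = v"
proof -
  have "\<exists>B. fbasis s B U" using fbasis_exists[OF assms] by metis
  then interpret fbasis s "SOME B. fbasis s B U" U by (rule someI_ex)
  show "gproj s U (v + w) = gproj s U v + gproj s U w" "gproj s U (s c v) = s c (gproj s U v)"
    "gproj s U v \<in> U" "v \<in> U \<Longrightarrow> gproj s U v = v"
    unfolding gproj_def by (rule proj_add proj_scale proj_in proj_id; assumption?)+
qed

definition gbr :: "'g::ab_group_add lie \<Rightarrow> 'g \<Rightarrow> 'g \<Rightarrow> 'g" where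
  "gbr G x y = bracket G (gproj (smult G) (carrier G) x) (gproj (smult G) (carrier G) y)"

definition gac :: "'g::ab_group_add lie \<Rightarrow> ('g, 'v::ab_group_add) rep \<Rightarrow> 'g \<Rightarrow> 'v \<Rightarrow> 'v" where
  "gac G V x v = act V (gproj (smult G) (carrier G) x) (gproj (vscale V) (space V) v)"

lemma chevalley_chev:
  assumes CG: "chevalley_generators G h I a e f t"
  shows "chev (smult G) (gbr G) (carrier G) I a e f t"
proof -
  note D = CG[unfolded chevalley_generators_def]
  have S: "simple_lie_algebra G" using D by blast
  have LG: "lie_algebra G" and fd: "finite_dim (smult G) (carrier G)"
    using S unfolding simple_lie_algebra_def by blast+
  have vs: "vector_space (smult G)" using LG unfolding lie_algebra_def by blast
  interpret vector_space "smult G" by (rule vs)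
  let ?C = "carrier G" and ?p = "gproj (smult G) (carrier G)"
  note P = gproj[OF vs fd]
  have sub: "subspace ?C" using LG unfolding lie_algebra_def by blast
  have closed: "bracket G x y \<in> ?C" if "x \<in> ?C" "y \<in> ?C" for x y
    using LG that unfolding lie_algebra_def by blast
  have addl: "bracket G (x + y) z = bracket G x z + bracket G y z"
    and addr: "bracket G x (y + z) = bracket G x y + bracket G x z"
    if "x \<in> ?C" "y \<in> ?C" "z \<in> ?C" for x y z
    using LG that unfolding lie_algebra_def by blast+
  have scl: "bracket G (smult G c x) y = smult G c (bracket G x y)"
    and scr: "bracket G x (smult G c y) = smult G c (bracket G x y)"
    if "x \<in> ?C" "y \<in> ?C" for x y c
    using LG that unfolding lie_algebra_def by blast+
  have self: "bracket G x x = 0" if "x \<in> ?C" for x using LG that unfolding lie_algebra_def by blast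
  have jac: "bracket G x (bracket G y z) + bracket G y (bracket G z x) + bracket G z (bracket G x y) = 0"
    if "x \<in> ?C" "y \<in> ?C" "z \<in> ?C" for x y z
    using LG that unfolding lie_algebra_def by blast
  have anti: "bracket G y x = - bracket G x y" if "x \<in> ?C" "y \<in> ?C" for x y
  proof -
    have xy: "x + y \<in> ?C" using that sub by (intro subspace_add)
    have "bracket G x y + bracket G y x = bracket G (x + y) (x + y)"
      using self[OF that(1)] self[OF that(2)] by (simp only: addl addr that xy) simp
    then have "bracket G x y + bracket G y x = 0" by (simp only: self[OF xy])
    then show ?thesis by (simp add: eq_neg_iff_add_eq_0 add.commute)
  qed
  have br: "gbr G x y = bracket G x y" if "x \<in> ?C" "y \<in> ?C" for x y
    using that by (simp add: gbr_def P(4))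
  have ef: "e i \<in> ?C" "f i \<in> ?C" "t i \<in> h" if "i \<in> I" for i using D that by blast+
  have hC: "h \<subseteq> ?C" using D unfolding cartan_subalgebra_def lie_subalgebra_def by blast
  have ind: "(\<Sum>i\<in>I. smult G (u i) (t i)) = 0 \<Longrightarrow> i \<in> I \<Longrightarrow> u i = 0" for u i
  proof -
    assume 0: "(\<Sum>i\<in>I. smult G (u i) (t i)) = 0" and i: "i \<in> I"
    have inj: "inj_on t I" and indep: "independent (t ` I)" and fin: "finite I" using D by blast+
    have "(\<Sum>x\<in>t ` I. smult G (u (inv_into I t x)) x) = 0"
      using 0 inj by (simp add: sum.reindex cong: sum.cong)
    then have "u (inv_into I t (t i)) = 0"
      using independentD[OF indep finite_imageI[OF fin] order_refl, of "\<lambda>x. u (inv_into I t x)" "t i"] i by blast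
    then show "u i = 0" using inj i by simp
  qed
  have gen: "S = ?C" if "lie_subalgebra G S" "e ` I \<union> f ` I \<subseteq> S" for S
    using D that by blast
  have ideal: "S = {0} \<or> S = ?C" if "lie_ideal G S" for S
    using S that unfolding simple_lie_algebra_def by blast
  have nonempty: "I \<noteq> {}"
  proof
    assume I: "I = {}"
    have "0 \<in> ?C" by (rule subspace_0[OF sub])
    then have "lie_subalgebra G {0}"
      using self[of 0] unfolding lie_subalgebra_def by simp
    moreover have "e ` I \<union> f ` I \<subseteq> {0}" using I by simp
    ultimately have C0: "?C = {0}" using gen by simp
    obtain x y where xy: "x \<in> ?C" "y \<in> ?C" "bracket G x y \<noteq> 0"
      using S unfolding simple_lie_algebra_def by blast
    then have "x = 0" "y = 0" unfolding C0 by simp_all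
    then show False using xy(1,3) self by simp
  qed
  show ?thesis
  proof
    show "gbr G (gbr G x y) z = gbr G x (gbr G y z) - gbr G y (gbr G x z)" for x y z
    proof -
      let ?x = "?p x" and ?y = "?p y" and ?z = "?p z"
      have C: "?x \<in> ?C" "?y \<in> ?C" "?z \<in> ?C" by (simp_all add: P)
      have "bracket G ?y (bracket G ?z ?x) = - bracket G ?y (bracket G ?x ?z)"
        using C scr[of ?y "bracket G ?x ?z" "-1"] closed anti[of ?x ?z] by simp
      moreover have "bracket G ?z (bracket G ?x ?y) = - bracket G (bracket G ?x ?y) ?z"
        using C closed anti[of "bracket G ?x ?y" ?z] by simp
      ultimately have "bracket G (bracket G ?x ?y) ?z = bracket G ?x (bracket G ?y ?z) - bracket G ?y (bracket G ?x ?z)"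
        using jac[OF C] by (simp add: algebra_simps)
      then show ?thesis using C closed by (simp add: gbr_def P(4))
    qed
    show "S = ?C" if "subspace S" "S \<subseteq> ?C" and closedS: "\<And>x y. x \<in> S \<Longrightarrow> y \<in> S \<Longrightarrow> gbr G x y \<in> S"
      and "\<And>i. i \<in> I \<Longrightarrow> e i \<in> S" "\<And>i. i \<in> I \<Longrightarrow> f i \<in> S" for S
    proof -
      have "bracket G x y \<in> S" if "x \<in> S" "y \<in> S" for x y
        using br[of x y] subsetD[OF \<open>S \<subseteq> ?C\<close>] closedS[OF that] that by simp
      then have "lie_subalgebra G S" unfolding lie_subalgebra_def using that(1,2) by blast
      moreover have "e ` I \<union> f ` I \<subseteq> S" using that(4,5) by blast
      ultimately show ?thesis by (rule gen)
    qed
    show "S = {0} \<or> S = ?C" if "subspace S" "S \<subseteq> ?C" and closedS: "\<And>x y. x \<in> ?C \<Longrightarrow> y \<in> S \<Longrightarrow> gbr G x y \<in> S" for S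
    proof -
      have "bracket G x y \<in> S" if "x \<in> ?C" "y \<in> S" for x y
        using br[of x y] subsetD[OF \<open>S \<subseteq> ?C\<close>] closedS[OF that] that by simp
      then have "lie_ideal G S" unfolding lie_ideal_def using that(1,2) by blast
      then show ?thesis by (rule ideal)
    qed
    show "(\<Sum>i\<in>I. smult G (u i) (t i)) = 0 \<Longrightarrow> i \<in> I \<Longrightarrow> u i = 0" for u i by (rule ind)
    show "finite I" "I \<noteq> {}" using D nonempty by blast+
    have tC: "t i \<in> ?C" if "i \<in> I" for i using ef[OF that] hC by blast
    fix i j assume i: "i \<in> I"
    show "e i \<in> ?C" "f i \<in> ?C" "t i \<in> ?C" using ef i tC by blast+
    show "a i i = 2" using D i by blast
    assume j: "j \<in> I"
    show "gbr G (t i) (t j) = 0" "gbr G (e i) (f j) = (if i = j then t i else 0)"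
      "gbr G (t i) (e j) = smult G (of_int (a i j)) (e j)"
      "gbr G (t i) (f j) = smult G (- of_int (a i j)) (f j)"
      using D i j br ef tC by simp_all
  qed (simp_all add: gbr_def P addl addr scl scr self closed sub fd)
qed

lemma highest_weight_irr:
  assumes CG: "chevalley_generators G h I a e f t" and HW: "simple_highest_weight_module G h I e \<mu> V"
  shows "\<exists>v0. irr (smult G) (gbr G) (carrier G) I a e f t (vscale V) (gac G V) (space V) (\<lambda>i. \<mu> (t i)) v0"
proof -
  note D = CG[unfolded chevalley_generators_def]
  interpret chev "smult G" "gbr G" "carrier G" I a e f t by (rule chevalley_chev[OF CG])
  have IR: "irreducible_module G V" and fdV: "finite_dim (vscale V) (space V)"
    using HW unfolding simple_highest_weight_module_def by blast+
  have LM: "lie_module G V" using IR unfolding irreducible_module_def by blast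
  have vs: "vector_space (vscale V)" using LM unfolding lie_module_def by blast
  interpret v: vector_space "vscale V" by (rule vs)
  note P = gproj[OF vsg fdC] and R = gproj[OF vs fdV]
  obtain v0 where v0: "v0 \<in> space V" "v0 \<noteq> 0" "\<And>i. i \<in> I \<Longrightarrow> act V (e i) v0 = 0"
    "\<And>x. x \<in> h \<Longrightarrow> act V x v0 = vscale V (\<mu> x) v0"
    using HW unfolding simple_highest_weight_module_def by blast
  have sub: "v.subspace (space V)" using LM unfolding lie_module_def by blast
  have closed: "act V x w \<in> space V" if "x \<in> carrier G" "w \<in> space V" for x w
    using LM that unfolding lie_module_def by blast
  have addl: "act V (x + y) w = act V x w + act V y w" if "x \<in> carrier G" "y \<in> carrier G" "w \<in> space V" for x y w
    using LM that unfolding lie_module_def by blast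
  have addr: "act V x (w + w') = act V x w + act V x w'" if "x \<in> carrier G" "w \<in> space V" "w' \<in> space V" for x w w'
    using LM that unfolding lie_module_def by blast
  have scl: "act V (smult G c x) w = vscale V c (act V x w)" and scr: "act V x (vscale V c w) = vscale V c (act V x w)"
    if "x \<in> carrier G" "w \<in> space V" for x w c
    using LM that unfolding lie_module_def by blast+
  have brk: "act V (bracket G x y) w = act V x (act V y w) - act V y (act V x w)"
    if "x \<in> carrier G" "y \<in> carrier G" "w \<in> space V" for x y w
    using LM that unfolding lie_module_def by blast
  have ac: "gac G V x w = act V x w" if "x \<in> carrier G" "w \<in> space V" for x w
    using that by (simp add: gac_def P(4) R(4))
  have th: "t i \<in> h" if "i \<in> I" for i using D that by blast
  have "irr (smult G) (gbr G) (carrier G) I a e f t (vscale V) (gac G V) (space V) (\<lambda>i. \<mu> (t i)) v0"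
  proof
    show "gac G V (gbr G x y) w = gac G V x (gac G V y w) - gac G V y (gac G V x w)" for x y w
      using br_C[of x y] closed by (simp add: gac_def gbr_def P R brk)
    show "W = {0} \<or> W = space V" if "v.subspace W" "W \<subseteq> space V"
      and closedW: "\<And>x w. x \<in> carrier G \<Longrightarrow> w \<in> W \<Longrightarrow> gac G V x w \<in> W" for W
    proof -
      have "act V x w \<in> W" if "x \<in> carrier G" "w \<in> W" for x w
        using ac[of x w] subsetD[OF \<open>W \<subseteq> space V\<close>] closedW[OF that] that by simp
      then show ?thesis using IR that(1,2) unfolding irreducible_module_def by blast
    qed
    show "gac G V (e i) v0 = 0" if "i \<in> I" for i using v0 ac eC that by simp
    show "gac G V (t i) v0 = vscale V (\<mu> (t i)) v0" if "i \<in> I" for i using v0 ac tC th that by simp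
  qed (simp_all add: gac_def P R addl addr scl scr closed sub fdV v0)
  then show ?thesis by blast
qed

text \<open>Bracketing with \<open>f i\<close> leaves only the multiple \<open>u i\<close> of the
  nonzero coroot \<open>t i\<close>.\<close>

lemma (in chev) e_indep:
  assumes "A \<subseteq> I" "(\<Sum>j\<in>A. sg (u j) (e j)) = 0" "i \<in> A"
  shows "u i = 0"
proof -
  have i: "i \<in> I" and fin: "finite A" using assms finI finite_subset by auto
  have "0 = br (\<Sum>j\<in>A. sg (u j) (e j)) (f i)" using assms(2) by simp
  also have "\<dots> = (\<Sum>j\<in>A. if j = i then sg (u i) (t i) else 0)"
    unfolding ad.ac_sum_left br_scale_left
    by (intro sum.cong refl) (use assms(1) i in \<open>auto simp: br_ef\<close>)
  also have "\<dots> = sg (u i) (t i)" using fin assms(3) by simp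
  finally show ?thesis using t_nonzero[OF i] by simp
qed

lemma (in chev) bracket_t_e_sum:
  assumes "A \<subseteq> I"
  shows "br (\<Sum>i\<in>I. sg (x i) (t i)) (\<Sum>j\<in>A. e j) = (\<Sum>j\<in>A. sg (\<Sum>i\<in>I. x i * of_int (a i j)) (e j))"
  unfolding ad.ac_sum_right ad.ac_sum_left br_scale_left vg.scale_sum_left
  by (intro sum.cong refl) (use assms in \<open>auto simp: br_te\<close>)

lemma cartan_matrix_sym: "cartan_matrix X i j = cartan_matrix X j i"
  by (simp add: cartan_matrix_def insert_commute)

lemma cartan_matrix_nonpos: "i \<noteq> j \<Longrightarrow> cartan_matrix X i j \<le> 0"
  by (simp add: cartan_matrix_def)

lemma folding_type_prime: "folding_type X d \<Longrightarrow> prime d"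
  by (erule folding_type.cases) simp_all

lemma fixed_subalgebra_simps:
  "smult (fixed_subalgebra \<sigma> G) = smult G" "bracket (fixed_subalgebra \<sigma> G) = bracket G"
  by (simp_all add: fixed_subalgebra_def)

lemma orbit_in: "p permutes I \<Longrightarrow> i \<in> I \<Longrightarrow> orbit p i \<subseteq> I"
  by (rule permutes_orbit_subset)

lemma twist_orb_eq:
  assumes "twist sg br C I a e f t p \<sigma> d D" shows "twist.orb p d i = orbit p i"
proof -
  interpret twist sg br C I a e f t p \<sigma> d D by (rule assms)
  have pq: "(p ^^ k) ((q ^^ k) j) = j" for k j
  proof (induction k arbitrary: j)
    case (Suc k)
    have "(p ^^ Suc k) ((q ^^ Suc k) j) = p ((p ^^ k) ((q ^^ k) (q j)))" by (simp only: funpow.simps(2) o_apply funpow_swap1)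
    then show ?case using Suc by simp
  qed simp
  show ?thesis
  proof
    show "orb i \<subseteq> orbit p i"
    proof
      fix j assume "j \<in> orb i"
      then obtain k where k: "k < d" "j = (q ^^ k) i" by (rule orbE)
      have "(p ^^ (d - k)) i = (p ^^ (d - k)) ((p ^^ k) j)" using k pq by simp
      also have "\<dots> = (p ^^ (d - k + k)) j" by (simp only: funpow_add o_apply)
      also have "\<dots> = j" using k p_d by simp
      finally have "j = (p ^^ (d - k)) i" by simp
      then show "j \<in> orbit p i" using k(1) unfolding orbit_altdef by (intro CollectI exI[of _ "d - k"]) simp
    qed
    show "orbit p i \<subseteq> orb i"
    proof
      fix j assume "j \<in> orbit p i"
      then show "j \<in> orb i"
      proof induction
        case base
        show ?case using q_orb_iff[of "p i" i] orb_self by simp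
      next
        case (step j)
        then show ?case using q_orb_iff[of "p j" i] by simp
      qed
    qed
  qed
qed

text \<open>As for the Killing form, invariance gives the Cartan matrix times c = \<kappa>(e_j,
  f_j). Then t_j / c represents the simple root \<alpha>_j and has square length 2 / c, so the
  normalization forces c = 1.\<close>

lemma normalized_form_coroots:
  assumes CG: "chevalley_generators G h I a e f t" and NF: "normalized_form G h \<kappa>"
    and ij: "i \<in> I" "j \<in> I"
  shows "\<kappa> (t j) (t i) = of_int (a i j)"
proof -
  note D = CG[unfolded chevalley_generators_def]
  interpret chev "smult G" "gbr G" "carrier G" I a e f t by (rule chevalley_chev[OF CG])
  have gbr: "gbr G x y = bracket G x y" if "x \<in> carrier G" "y \<in> carrier G" for x y
    using gproj(4)[OF vsg fdC] that by (simp add: gbr_def)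
  have hC: "h \<subseteq> carrier G" and hspan: "vg.span (t ` I) = h"
    using D unfolding cartan_subalgebra_def lie_subalgebra_def by blast+
  have th: "t i \<in> h" if "i \<in> I" for i using D that by blast
  have lin: "linear_form_on (smult G) (carrier G) (\<kappa> x)" if "x \<in> carrier G" for x
    using NF that unfolding normalized_form_def by blast
  have sym: "\<kappa> x y = \<kappa> y x" if "x \<in> carrier G" "y \<in> carrier G" for x y
    using NF that unfolding normalized_form_def by blast
  have inv: "\<kappa> (bracket G x y) z = \<kappa> x (bracket G y z)"
    if "x \<in> carrier G" "y \<in> carrier G" "z \<in> carrier G" for x y z
    using NF that unfolding normalized_form_def by blast
  have scale: "\<kappa> x (smult G c y) = c * \<kappa> x y" if "x \<in> carrier G" "y \<in> carrier G" for x y c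
    using lin[OF that(1)] that(2) unfolding linear_form_on_def by blast
  have scale_left: "\<kappa> (smult G c x) y = c * \<kappa> x y" if "x \<in> carrier G" "y \<in> carrier G" for x y c
    using that subC sym[of "smult G c x" y] scale[of y x c] sym[of x y] by (simp add: vg.subspace_scale)
  define c where "c = \<kappa> (e j) (f j)"
  have tt: "\<kappa> (t j) (t k) = of_int (a k j) * c" if k: "k \<in> I" for k
  proof -
    have "\<kappa> (t j) (t k) = \<kappa> (bracket G (e j) (f j)) (t k)" using D ij(2) by simp
    also have "\<dots> = \<kappa> (e j) (bracket G (f j) (t k))" using ij k eC fC tC by (intro inv) auto
    also have "bracket G (f j) (t k) = smult G (of_int (a k j)) (f j)"
      using gbr[of "f j" "t k"] br_anti[of "f j" "t k"] br_tf[OF k ij(2)] fC tC ij k by simp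
    finally show ?thesis using ij eC fC by (simp add: scale c_def)
  qed
  have expand: "\<exists>u. y = (\<Sum>i\<in>I. smult G (u i) (t i))" if "y \<in> h" for y
    using span_t_expand that hspan by blast
  have \<kappa>_sum: "\<kappa> (t j) (\<Sum>i\<in>I. smult G (u i) (t i)) = (\<Sum>i\<in>I. u i * \<kappa> (t j) (t i))" for u
    by (rule linear_form_on_sum[OF vsg subC lin]) (use ij tC in auto)
  have "c \<noteq> 0"
  proof
    assume "c = 0"
    then have "\<kappa> (t j) y = 0" if "y \<in> h" for y using expand[OF that] \<kappa>_sum tt by auto
    then have "t j = 0" using NF th[OF ij(2)] unfolding normalized_form_def by blast
    then show False using t_nonzero[OF ij(2)] by simp
  qed
  define v where "v = smult G (1 / c) (t j)"
  have vC: "v \<in> h" "v \<noteq> 0"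
    using th[OF ij(2)] hspan vg.subspace_span t_nonzero[OF ij(2)] \<open>c \<noteq> 0\<close>
    by (auto simp: v_def intro: vg.subspace_scale)
  have "bracket G y (e j) = smult G (\<kappa> v y) (e j)" if y: "y \<in> h" for y
  proof -
    obtain u where u: "y = (\<Sum>i\<in>I. smult G (u i) (t i))" using expand[OF y] by blast
    have "\<kappa> v y = 1 / c * (\<Sum>i\<in>I. u i * \<kappa> (t j) (t i))"
      using y hC tC[OF ij(2)] \<kappa>_sum[of u] u by (auto simp: v_def scale_left)
    also have "\<dots> = (\<Sum>i\<in>I. u i * of_int (a i j))"
      using \<open>c \<noteq> 0\<close> by (simp add: tt sum_distrib_left)
    finally have "\<kappa> v y = (\<Sum>i\<in>I. u i * of_int (a i j))" .
    moreover have "gbr G y (e j) = smult G (\<Sum>i\<in>I. u i * of_int (a i j)) (e j)"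
      using bracket_t_e_sum[of "{j}" u] ij(2) u by simp
    ultimately show ?thesis using gbr[of y "e j"] y hC eC[OF ij(2)] by auto
  qed
  then have "\<kappa> v v = 2"
    using NF vC eC[OF ij(2)] e_nonzero[OF ij(2)] unfolding normalized_form_def by blast
  moreover have "\<kappa> v v = 1 / c * (1 / c * (2 * c))"
    using ij(2) tC[OF ij(2)] subC tt[OF ij(2)] a_diag[OF ij(2)]
    by (simp add: v_def scale scale_left vg.subspace_scale)
  ultimately have "c = 1" using \<open>c \<noteq> 0\<close> by (simp add: field_simps)
  then show ?thesis using tt[OF ij(1)] by simp
qed

text \<open>Supplies the combinatorial data of the locale \<open>folding\<close>: the folded Cartan
  matrix, the orthogonality within orbits and the agreement of the two highest weights.\<close>

lemma folded_dimension:
  fixes G :: "'g::ab_group_add lie" and L :: "'l::ab_group_add lie"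
    and V :: "('l, 'v::ab_group_add) rep" and V' :: "('g, 'w::ab_group_add) rep"
    and I :: "nat set" and X :: dynkin
  defines "a \<equiv> cartan_matrix X"
  assumes d: "prime d"
    and CG: "chevalley_generators G h' I a e f t"
    and DA: "diagram_automorphism G I a e f p \<sigma>"
    and ord: "has_order G \<sigma> d"
    and h: "h \<subseteq> h'"
    and J: "J = orbit p ` I"
    and LD: "langlands_dual (fixed_subalgebra \<sigma> G) h (orbit_sum e) (orbit_sum f) (orbit_sum t) J L hL eL fL tL"
    and NF: "normalized_form G h' \<kappa>"
    and dom: "dominant_integral L hL J tL \<mu>"
    and m: "corresponding_coweight (fixed_subalgebra \<sigma> G) h J (orbit_sum e) tL \<mu> m"
    and \<mu>': "\<And>x. x \<in> h' \<Longrightarrow> \<mu>' x = \<kappa> m x"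
    and V: "simple_highest_weight_module L hL J eL \<mu> V"
    and V': "simple_highest_weight_module G h' I e \<mu>' V'"
  obtains B B' where "fbasis (vscale V) B (space V)" "fbasis (vscale V') B' (space V')" "card B \<le> card B'"
proof -
  note D = CG[unfolded chevalley_generators_def]
  interpret chev "smult G" "gbr G" "carrier G" I a e f t by (rule chevalley_chev[OF CG])
  have gbr: "gbr G x y = bracket G x y" if "x \<in> carrier G" "y \<in> carrier G" for x y
    using gproj(4)[OF vsg fdC] that by (simp add: gbr_def)
  have hspan: "vg.span (t ` I) = h'" and hC: "h' \<subseteq> carrier G"
    using D unfolding cartan_subalgebra_def lie_subalgebra_def by blast+
  obtain b where Cg: "chevalley_generators (fixed_subalgebra \<sigma> G) h J b (orbit_sum e) (orbit_sum f) (orbit_sum t)"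
    and CL: "chevalley_generators L hL J (\<lambda>i j. b j i) eL fL tL"
    using LD unfolding langlands_dual_def by blast
  have perm: "p permutes I" and a_p: "\<And>i j. i \<in> I \<Longrightarrow> j \<in> I \<Longrightarrow> a (p i) (p j) = a i j"
    and aut: "lie_automorphism G \<sigma>"
    and \<sigma>_ef: "\<And>i. i \<in> I \<Longrightarrow> \<sigma> (e i) = e (p i) \<and> \<sigma> (f i) = f (p i)"
    using DA unfolding diagram_automorphism_def by blast+
  have JI: "P \<subseteq> I" if "P \<in> J" for P using that orbit_in[OF perm] unfolding J by blast
  have sub_sum: "orbit_sum x P \<in> carrier G" if "P \<subseteq> I" "\<And>i. i \<in> I \<Longrightarrow> x i \<in> carrier G" for x P
    unfolding orbit_sum_def using that subC by (intro vg.subspace_sum) auto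
  have t_sum: "orbit_sum t R = (\<Sum>i\<in>I. smult G (if i \<in> R then 1 else 0) (t i))" if "R \<subseteq> I" for R
    unfolding orbit_sum_def using that finI
    by (simp add: if_distrib[of "\<lambda>c. smult G c _"] sum.If_cases Int_absorb1 cong: if_cong)
  \<comment> \<open>An eigenvalue on an orbit sum of root vectors can be read off at any single
    \<open>e j\<close>, since these are independent.\<close>
  have pairing: "x j = y" if eq: "gbr G (\<Sum>i\<in>I. smult G (u i) (t i)) (orbit_sum e P) = smult G y (orbit_sum e P)"
    and x: "\<And>j. x j = (\<Sum>i\<in>I. u i * of_int (a i j))" and P: "P \<subseteq> I" and j: "j \<in> P" for u y P x j
  proof -
    have "(\<Sum>j\<in>P. smult G (x j) (e j)) = smult G y (orbit_sum e P)"
      using eq unfolding orbit_sum_def bracket_t_e_sum[OF P] x .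
    then have "(\<Sum>j\<in>P. smult G (x j - y) (e j)) = 0"
      by (simp add: orbit_sum_def vg.scale_left_diff_distrib sum_subtractf vg.scale_sum_right)
    then have "x j - y = 0" using e_indep[OF P, of "\<lambda>j. x j - y" j] j by blast
    then show ?thesis by simp
  qed
  have b: "of_int (b R P) = (of_int (\<Sum>i\<in>R. a i j) :: complex)" if "R \<in> J" "P \<in> J" "j \<in> P" for R P j
  proof -
    have "bracket G (orbit_sum t R) (orbit_sum e P) = smult G (of_int (b R P)) (orbit_sum e P)"
      using Cg that(1,2) unfolding chevalley_generators_def fixed_subalgebra_simps by blast
    then have "gbr G (orbit_sum t R) (orbit_sum e P) = smult G (of_int (b R P)) (orbit_sum e P)"
      using gbr sub_sum[OF JI[OF that(1)] tC] sub_sum[OF JI[OF that(2)] eC] by simp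
    then have "(\<Sum>i\<in>I. (if i \<in> R then 1 else 0) * of_int (a i j)) = (of_int (b R P) :: complex)"
      unfolding t_sum[OF JI[OF that(1)]] by (rule pairing) (use JI[OF that(2)] that in auto)
    moreover have "(\<Sum>i\<in>I. (if i \<in> R then 1 else 0) * of_int (a i j)) = (of_int (\<Sum>i\<in>R. a i j) :: complex)"
      using JI[OF that(1)] finI by (simp add: if_distrib[of "\<lambda>c. c * _"] sum.If_cases Int_absorb1 cong: if_cong)
    ultimately show ?thesis by simp
  qed
  have b_int: "b R P = (\<Sum>i\<in>R. a i j)" if "R \<in> J" "P \<in> J" "j \<in> P" for R P j
    using b[OF that] by (simp only: of_int_eq_iff)
  have permutation: "permutation p" using perm finI unfolding permutation_permutes by blast
  \<comment> \<open>The diagonal entry 2 of the folded matrix is a sum of the entry 2 of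
    \<open>a\<close> and of nonpositive entries over the rest of the orbit, which must therefore all
    vanish.\<close>
  have orth: "a i ((inv p ^^ k) i) = 0" if i: "i \<in> I" and ne: "(inv p ^^ k) i \<noteq> i" for i k
  proof -
    let ?P = "orbit p i"
    have P: "?P \<in> J" "i \<in> ?P" using i permutation_self_in_orbit[OF permutation] by (auto simp: J)
    have fin: "finite ?P" using JI[OF P(1)] finI finite_subset by blast
    have "b ?P ?P = 2" using Cg P(1) unfolding chevalley_generators_def by blast
    then have "(\<Sum>j\<in>?P. a j i) = 2" using b_int[OF P(1) P(1) P(2)] by simp
    then have "(\<Sum>j\<in>?P - {i}. a j i) = 0"
      using sum.remove[OF fin P(2), of "\<lambda>j. a j i"] a_diag[OF i] by simp
    moreover have "a j i \<le> 0" if "j \<in> ?P - {i}" for j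
      using that unfolding a_def by (intro cartan_matrix_nonpos) auto
    ultimately have *: "\<forall>j\<in>?P - {i}. a j i = 0"
      using fin sum_nonneg_eq_0_iff[of "?P - {i}" "\<lambda>j. - a j i"] by (simp add: sum_negf)
    have "(inv p ^^ k) i \<in> orbit (inv p) i"
      using P(2) by (intro funpow_in_orbit) (simp add: orbit_inv_eq[OF permutation])
    then have "a ((inv p ^^ k) i) i = 0" using * ne orbit_inv_eq[OF permutation] by blast
    then show ?thesis unfolding a_def by (subst cartan_matrix_sym)
  qed
  define \<pi> where "\<pi> = gproj (smult G) (carrier G)"
  note P = gproj[OF vsg fdC, folded \<pi>_def]
  have \<sigma>C: "\<sigma> x \<in> carrier G" if "x \<in> carrier G" for x
    using aut that unfolding lie_automorphism_def bij_betw_def by blast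
  have \<sigma>_add: "\<sigma> (x + y) = \<sigma> x + \<sigma> y" and \<sigma>_br: "\<sigma> (bracket G x y) = bracket G (\<sigma> x) (\<sigma> y)"
    if "x \<in> carrier G" "y \<in> carrier G" for x y
    using aut that unfolding lie_automorphism_def by blast+
  have \<sigma>_scale: "\<sigma> (smult G c x) = smult G c (\<sigma> x)" if "x \<in> carrier G" for c x
    using aut that unfolding lie_automorphism_def by blast
  have pow: "((\<lambda>x. \<sigma> (\<pi> x)) ^^ k) x = (\<sigma> ^^ k) x \<and> (\<sigma> ^^ k) x \<in> carrier G" if "x \<in> carrier G" for k x
    using that by (induction k) (simp_all add: P \<sigma>C)
  \<comment> \<open>Composing \<open>\<sigma>\<close> with the projection \<open>\<pi>\<close> makes
    it linear on the ambient type and changes nothing on the carrier.\<close>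
  have tw: "twist (smult G) (gbr G) (carrier G) I a e f t p (\<lambda>x. \<sigma> (\<pi> x)) d (\<lambda>_. 1)"
  proof unfold_locales
    show "\<sigma> (\<pi> (gbr G x y)) = gbr G (\<sigma> (\<pi> x)) (\<sigma> (\<pi> y))" for x y
      using br_C[of x y] by (simp add: P(4) gbr \<sigma>C P(3)) (simp add: gbr_def \<pi>_def[symmetric] \<sigma>_br P(3))
    show "((\<lambda>x. \<sigma> (\<pi> x)) ^^ d) x = x" if "x \<in> carrier G" for x
      using pow[OF that] ord that unfolding has_order_def by simp
    show "1 * real_of_int (a i j) = 1 * real_of_int (a j i)" for i j
      unfolding a_def by (subst cartan_matrix_sym) simp
  qed (simp_all add: perm a_p d orth P \<sigma>C \<sigma>_add \<sigma>_scale lin_def eC fC \<sigma>_ef)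
  interpret tw: twist "smult G" "gbr G" "carrier G" I a e f t p "\<lambda>x. \<sigma> (\<pi> x)" d "\<lambda>_. 1" by (rule tw)
  have orb: "tw.orb i = orbit p i" for i by (rule twist_orb_eq[OF tw])
  have "\<forall>P\<in>J. \<exists>n::nat. \<mu> (tL P) = of_nat n"
    using dom unfolding dominant_integral_def Nats_def by blast
  then obtain mu where mu: "\<And>P. P \<in> J \<Longrightarrow> \<mu> (tL P) = of_nat (mu P)" by metis
  have mh: "m \<in> h'" and mb: "\<And>P. P \<in> J \<Longrightarrow> bracket G m (orbit_sum e P) = smult G (\<mu> (tL P)) (orbit_sum e P)"
    using m h unfolding corresponding_coweight_def fixed_subalgebra_simps by blast+
  obtain x where x: "m = (\<Sum>i\<in>I. smult G (x i) (t i))" using span_t_expand mh hspan by blast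
  have mC: "m \<in> carrier G" using mh hC by blast
  have th: "t i \<in> h'" if "i \<in> I" for i using D that by blast
  \<comment> \<open>Under the normalized form the value of \<mu>' on \<open>t j\<close> is the value
    of the simple root \<alpha>_j on the coweight \<open>m\<close>, which depends only on the orbit
    of \<open>j\<close>: fundamental weights go to sums over orbits.\<close>
  have lam: "\<mu>' (t j) = of_nat (mu (tw.orb j))" if j: "j \<in> I" for j
  proof -
    have PJ: "orbit p j \<in> J" "j \<in> orbit p j"
      using j permutation_self_in_orbit[OF permutation] by (auto simp: J)
    have lin: "linear_form_on (smult G) (carrier G) (\<kappa> (t j))" and sym: "\<kappa> m (t j) = \<kappa> (t j) m"
      using NF tC[OF j] mC unfolding normalized_form_def by blast+
    have "\<mu>' (t j) = \<kappa> (t j) m" using \<mu>' th[OF j] sym by simp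
    also have "\<dots> = (\<Sum>i\<in>I. x i * \<kappa> (t j) (t i))"
      unfolding x by (rule linear_form_on_sum[OF vsg subC lin]) (rule tC)
    also have "\<dots> = (\<Sum>i\<in>I. x i * of_int (a i j))"
      by (intro sum.cong refl) (simp add: normalized_form_coroots[OF CG NF _ j])
    also have "\<dots> = \<mu> (tL (orbit p j))"
    proof (rule pairing)
      show "gbr G (\<Sum>i\<in>I. smult G (x i) (t i)) (orbit_sum e (orbit p j)) =
          smult G (\<mu> (tL (orbit p j))) (orbit_sum e (orbit p j))"
        using mb[OF PJ(1)] gbr[OF mC sub_sum[OF JI[OF PJ(1)] eC]] unfolding x by simp
    qed (use JI PJ in auto)
    finally show ?thesis using mu PJ orb by simp
  qed
  obtain v0 where v0: "irr (smult G) (gbr G) (carrier G) I a e f t (vscale V') (gac G V') (space V') (\<lambda>i. \<mu>' (t i)) v0"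
    using highest_weight_irr[OF CG V'] by blast
  obtain w0 where w0: "irr (smult L) (gbr L) (carrier L) J (\<lambda>i j. b j i) eL fL tL (vscale V) (gac L V) (space V) (\<lambda>i. \<mu> (tL i)) w0"
    using highest_weight_irr[OF CL V] by blast
  interpret G: irr "smult G" "gbr G" "carrier G" I a e f t "vscale V'" "gac G V'" "space V'" "\<lambda>i. \<mu>' (t i)" v0 by (rule v0)
  interpret L: irr "smult L" "gbr L" "carrier L" J "\<lambda>i j. b j i" eL fL tL "vscale V" "gac L V" "space V" "\<lambda>i. \<mu> (tL i)" w0 by (rule w0)
  interpret folding "smult G" "gbr G" "carrier G" I a e f t p "\<lambda>x. \<sigma> (\<pi> x)" d "\<lambda>_. 1" "vscale V'" "gac G V'" "space V'"
    "\<lambda>i. \<mu>' (t i)" v0 "smult L" "gbr L" "carrier L" J "\<lambda>i j. b j i" eL fL tL "vscale V" "gac L V" "space V" "\<lambda>i. \<mu> (tL i)" w0 mu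
  proof unfold_locales
    show "J = tw.orb ` I" unfolding J by (intro image_cong refl) (rule orb[symmetric])
    show "\<mu>' (t (p i)) = \<mu>' (t i)" if "i \<in> I" for i
    proof -
      have "tw.orb (p i) = tw.orb i"
        using tw.orb_eq[of "p i" i] tw.q_orb_iff[of "p i" i] tw.orb_self[of i] by simp
      then show ?thesis using lam that tw.p_I by simp
    qed
    show "b R P = (\<Sum>j\<in>R. a i j)" if "P \<in> J" "R \<in> J" "i \<in> P" for P R i
      using b_int[OF that(2,1,3)] unfolding a_def by (simp add: cartan_matrix_sym[of X i])
  qed (simp_all add: mu lam)
  show thesis using dimension_le that by blast
qed

theorem theorem9p5:
  fixes g' g :: "'g::ab_group_add lie" and h' h :: "'g set"
    and e f t :: "nat \<Rightarrow> 'g" and X :: dynkin and d :: nat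
    and p :: "nat \<Rightarrow> nat" and \<sigma> :: "'g \<Rightarrow> 'g" and \<kappa> :: "'g \<Rightarrow> 'g \<Rightarrow> complex"
    and J :: "nat set set"
    and L :: "'l::ab_group_add lie" and hL :: "'l set" and eL fL tL :: "nat set \<Rightarrow> 'l"
    and N :: nat
    and \<mu> :: "nat \<Rightarrow> 'l \<Rightarrow> complex" and m :: "nat \<Rightarrow> 'g" and \<mu>' :: "nat \<Rightarrow> 'g \<Rightarrow> complex"
    and V :: "nat \<Rightarrow> ('l, 'v::ab_group_add) rep" and V' :: "nat \<Rightarrow> ('g, 'w::ab_group_add) rep"
  assumes "folding_type X d"
    and "chevalley_generators g' h' {1..rank X} (cartan_matrix X) e f t"
    and "diagram_automorphism g' {1..rank X} (cartan_matrix X) e f p \<sigma>"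
    and "has_order g' \<sigma> d"
    and "g = fixed_subalgebra \<sigma> g'"
    and "h = {x \<in> h'. \<sigma> x = x}"
    and "J = orbit p ` {1..rank X}"
    and "langlands_dual g h (orbit_sum e) (orbit_sum f) (orbit_sum t) J L hL eL fL tL"
    and "normalized_form g' h' \<kappa>"
    and "\<forall>k\<in>{1..N}. dominant_integral L hL J tL (\<mu> k)"
    and "\<forall>k\<in>{1..N}. corresponding_coweight g h J (orbit_sum e) tL (\<mu> k) (m k)"
    and "\<forall>k\<in>{1..N}. \<forall>x\<in>h'. \<mu>' k x = \<kappa> (m k) x"
    and "\<forall>k\<in>{1..N}. simple_highest_weight_module L hL J eL (\<mu> k) (V k)"
    and "\<forall>k\<in>{1..N}. simple_highest_weight_module g' h' {1..rank X} e (\<mu>' k) (V' k)"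
  shows "generically (h \<times> UNIV) (parameter_coordinates g h {1..N})
    (\<lambda>(\<chi>, z). regular_element g h \<chi> \<and> regular_element g' h' \<chi> \<and> inj_on z {1..N} \<longrightarrow>
       vector_space_embeds
         (tensor_module {1..N} (\<lambda>k. evaluation_module L (V k) (z k)))
         (tensor_module {1..N} (\<lambda>k. evaluation_module g' (V' k) (z k))))"
proof -
  \<comment> \<open>The constant polynomial 1 serves as witness, and the point with both parameters
    0 shows that its nonvanishing locus is nonempty.\<close>
  have gen: "generically (h \<times> UNIV) (parameter_coordinates g h {1..N}) Q" if "\<And>p. Q p" for Q
  proof -
    have "\<exists>b. chevalley_generators g h J b (orbit_sum e) (orbit_sum f) (orbit_sum t)"
      using assms(8) unfolding langlands_dual_def by blast
    then have "lie_algebra g" "module.span (smult g) (orbit_sum t ` J) = h"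
      unfolding chevalley_generators_def simple_lie_algebra_def by blast+
    then interpret vector_space "smult g" unfolding lie_algebra_def by blast
    have "0 \<in> h" using \<open>span (orbit_sum t ` J) = h\<close> span_zero by blast
    then show ?thesis unfolding generically_def
      using that by (intro bexI[of _ "\<lambda>_. 1"] conjI bexI[of _ "(0, \<lambda>_. 0)"]) (auto intro: polynomial_functions.const)
  qed
  have "\<exists>B B'. fbasis (vscale (V k)) B (space (V k)) \<and> fbasis (vscale (V' k)) B' (space (V' k)) \<and> card B \<le> card B'"
    if k: "k \<in> {1..N}" for k
  proof -
    have "h \<subseteq> h'" using assms(6) by auto
    obtain B B' where "fbasis (vscale (V k)) B (space (V k))" "fbasis (vscale (V' k)) B' (space (V' k))" "card B \<le> card B'"
    proof (rule folded_dimension[OF folding_type_prime[OF assms(1)] assms(2-4) \<open>h \<subseteq> h'\<close> assms(7)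
          assms(8)[unfolded assms(5)] assms(9)])
      show "dominant_integral L hL J tL (\<mu> k)" using assms(10) k by blast
      show "corresponding_coweight (fixed_subalgebra \<sigma> g') h J (orbit_sum e) tL (\<mu> k) (m k)"
        using assms(11) k unfolding assms(5) by blast
      show "simple_highest_weight_module L hL J eL (\<mu> k) (V k)" using assms(13) k by blast
      show "simple_highest_weight_module g' h' {1..rank X} e (\<mu>' k) (V' k)" using assms(14) k by blast
      show "\<mu>' k x = \<kappa> (m k) x" if "x \<in> h'" for x using assms(12) k that by blast
    qed
    then show ?thesis by blast
  qed
  then obtain B B' where B: "\<And>k. k \<in> {1..N} \<Longrightarrow> fbasis (vscale (V k)) (B k) (space (V k)) \<and>
      fbasis (vscale (V' k)) (B' k) (space (V' k)) \<and> card (B k) \<le> card (B' k)" by metis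
  \<comment> \<open>Evaluation at a point changes only the action, so the bases of
    \<open>V k\<close> and \<open>V' k\<close> are bases of the evaluation modules.\<close>
  have "vector_space_embeds
      (tensor_module {1..N} (\<lambda>k. evaluation_module L (V k) (z k)))
      (tensor_module {1..N} (\<lambda>k. evaluation_module g' (V' k) (z k)))" for z
    by (rule tensor_embeds[of _ _ B _ B']) (use B in \<open>simp_all add: evaluation_module_def\<close>)
  then show ?thesis by (intro gen) auto
qed

end
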